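(* Let $\lambda>0$ and $f\in L^2(0,T)$. Then the equation $${}^c\partial_t^{\alpha_0}v+\lambda v+\lambda\, g'*v=I_t^{1-\alpha_0}f,\quad t\in(0,T],\qquad v(0)=0,$$ admits a unique solution $v\in H^1(0,T)$, and $$\|v\|_{H^1(0,T)}\le Q\|f\|_{L^2(0,T)},\qquad \|t^{\vartheta}v''\|_{L^2(0,T)}\le Q\big(\|f\|_{H^1(0,T)}+\lambda^{1-\gamma}|f(0)|\big),$$ where $\gamma\in(3/4,1)$ and $\vartheta\in(\vartheta_*,1/2)$ with $\vartheta_*:=\max\{\tfrac12-\alpha_0(1-\gamma),\ \alpha_0-\tfrac12\}$, and $Q>0$ is a constant independent of $\lambda$ and $f$.
   Context: $T>0$. $\alpha:[0,T]\to\mathbb R$ satisfies $0<\alpha(t)<1$, $|\alpha'(t)|\le Q_*$, and $\alpha_0:=\alpha(0)$. Convolution $(f*g)(t)=\int_0^t f(t-s)g(s)ds$. For $\mu>0$, $\beta_\mu(t)=t^{\mu-1}/\Gamma(\mu)$ and $I_t^\mu f=\beta_\mu*f$. Caputo derivative: ${}^c\partial_t^{\alpha_0}v=\beta_{1-\alpha_0}*v'$. With $k(t)=t^{\alpha(t)-1}/\Gamma(\alpha(t))$, $g:=\beta_{1-\alpha_0}*k$, i.e. $g(t)=\int_0^t\frac{(t-s)^{-\alpha_0}}{\Gamma(1-\alpha_0)}\frac{s^{\alpha(s)-1}}{\Gamma(\alpha(s))}ds$, and $g'$ is its derivative. *)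

theory Defs
  imports "HOL-Analysis.Analysis"
begin

definition beta_ker :: "real \<Rightarrow> real \<Rightarrow> real" where
  "beta_ker \<mu> t = t powr (\<mu> - 1) / Gamma \<mu>"

definition conv :: "(real \<Rightarrow> real) \<Rightarrow> (real \<Rightarrow> real) \<Rightarrow> real \<Rightarrow> real" where
  "conv f g t = (LINT s:{0..t}|lebesgue. f (t - s) * g s)"

definition RL_int :: "real \<Rightarrow> (real \<Rightarrow> real) \<Rightarrow> real \<Rightarrow> real" where
  "RL_int \<mu> f = conv (beta_ker \<mu>) f"

definition k_ker :: "(real \<Rightarrow> real) \<Rightarrow> real \<Rightarrow> real" where
  "k_ker \<alpha> t = t powr (\<alpha> t - 1) / Gamma (\<alpha> t)"

definition g_ker :: "(real \<Rightarrow> real) \<Rightarrow> real \<Rightarrow> real" where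
  "g_ker \<alpha> = conv (beta_ker (1 - \<alpha> 0)) (k_ker \<alpha>)"

definition L2 :: "real \<Rightarrow> (real \<Rightarrow> real) \<Rightarrow> bool" where
  "L2 T f \<longleftrightarrow> set_borel_measurable lebesgue {0..T} f
                \<and> set_integrable lebesgue {0..T} (\<lambda>t. (f t)\<^sup>2)"

definition L2_norm :: "real \<Rightarrow> (real \<Rightarrow> real) \<Rightarrow> real" where
  "L2_norm T f = sqrt (LINT t:{0..T}|lebesgue. (f t)\<^sup>2)"

text \<open>g is an (L^2) derivative of v on [0,T], with v taken as its absolutely
  continuous representative: v(t) = v(0) + int_0^t g.\<close>
definition is_H1_deriv :: "real \<Rightarrow> (real \<Rightarrow> real) \<Rightarrow> (real \<Rightarrow> real) \<Rightarrow> bool" where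
  "is_H1_deriv T v g \<longleftrightarrow> L2 T g \<and>
     (\<forall>t\<in>{0..T}. v t = v 0 + (LINT s:{0..t}|lebesgue. g s))"

definition H1 :: "real \<Rightarrow> (real \<Rightarrow> real) \<Rightarrow> bool" where
  "H1 T v \<longleftrightarrow> L2 T v \<and> (\<exists>g. is_H1_deriv T v g)"

definition H1_deriv :: "real \<Rightarrow> (real \<Rightarrow> real) \<Rightarrow> real \<Rightarrow> real" where
  "H1_deriv T v = (SOME g. is_H1_deriv T v g)"

definition H1_norm :: "real \<Rightarrow> (real \<Rightarrow> real) \<Rightarrow> real" where
  "H1_norm T v = sqrt ((L2_norm T v)\<^sup>2 + (L2_norm T (H1_deriv T v))\<^sup>2)"

definition caputo :: "real \<Rightarrow> real \<Rightarrow> (real \<Rightarrow> real) \<Rightarrow> real \<Rightarrow> real" where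
  "caputo T \<mu> v = conv (beta_ker (1 - \<mu>)) (H1_deriv T v)"

definition test_fun :: "real \<Rightarrow> real \<Rightarrow> (real \<Rightarrow> real) \<Rightarrow> bool" where
  "test_fun a b \<phi> \<longleftrightarrow> (\<forall>n x. ((deriv ^^ n) \<phi>) differentiable (at x)) \<and>
     (\<exists>c d. a < c \<and> d < b \<and> (\<forall>x. x \<notin> {c..d} \<longrightarrow> \<phi> x = 0))"

definition weak_deriv_on :: "real \<Rightarrow> real \<Rightarrow> (real \<Rightarrow> real) \<Rightarrow> (real \<Rightarrow> real) \<Rightarrow> bool" where
  "weak_deriv_on a b u w \<longleftrightarrow>
     (\<forall>c d. a < c \<and> d < b \<longrightarrow> set_integrable lebesgue {c..d} u \<and> set_integrable lebesgue {c..d} w) \<and>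
     (\<forall>\<phi>. test_fun a b \<phi> \<longrightarrow>
        (LINT t:{a<..<b}|lebesgue. u t * deriv \<phi> t) = - (LINT t:{a<..<b}|lebesgue. w t * \<phi> t))"

definition solves :: "real \<Rightarrow> (real \<Rightarrow> real) \<Rightarrow> real \<Rightarrow> (real \<Rightarrow> real) \<Rightarrow> (real \<Rightarrow> real) \<Rightarrow> bool" where
  "solves T \<alpha> lam f v \<longleftrightarrow> v 0 = 0 \<and>
     (AE t in lebesgue. t \<in> {0<..T} \<longrightarrow>
        caputo T (\<alpha> 0) v t + lam * v t + lam * conv (deriv (g_ker \<alpha>)) v t
          = RL_int (1 - \<alpha> 0) f t)"

end

theory Submission
  imports Defs
begin

text \<open>Write u = v', a = alpha 0, and let beta_a denote the kernel of order a. Convolving the equation with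
  beta_a and cancelling the convolution with 1 turns it into the Volterra equation
  u + lam beta_a * (u + g' * u) = f, which is solved by a resolvent constructed from the Neumann series.

  Uniformity in lam comes from the positivity of the quadratic form of beta_a, which is a consequence of
  |t - s|^(a - 1) being a multiple of the integral over z of ((t - z) (s - z))^(a/2 - 1) on z < min t s.
  Positivity persists under the weights exp(-2 sigma t), so w + lam beta_a * w = h implies
  ||w|| <= ||h|| in the weighted norm. This is applied to w = u + g' * u with sigma so large that
  convolution with g' is a small perturbation.

  If f = f(0) + 1 * f', then u' = q - f(0) s, where s is the resolvent of lam beta_a and q solves a Volterra
  equation with the square-integrable right-hand side f' - f(0) g' * s. The energy inequality applied to
  1 * s and t s(t) shows that the integral of t^2 s^2 over [0, r] is at most a multiple of both r and
  lam^2 r^(2 a + 1); interpolating and integrating over r gives the weighted bound for s.\<close>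

section \<open>The convolution ring of locally integrable functions\<close>

text \<open>The main obstacle is uniformity in \<open>lam\<close>. The Neumann series converges in a
  norm whose weight depends on \<open>lam\<close>, so it serves existence and uniqueness only; all
  estimates rest on the energy inequality, whose constant does not contain \<open>lam\<close>. The
  second obstacle is the initial layer. Formally differentiating u + k * u = f puts f(0) k on the
  right, and k behaves like t^(a - 1), which is not square integrable for a \<le> 1/2, so the energy
  inequality cannot be applied to u' directly. Subtracting f(0) s isolates this singularity, and
  multiplying s by t makes it square integrable. Interpolating the two moment bounds with exponents
  \<gamma> and 1 - \<gamma> gives lam^(2 (1 - \<gamma>)) r^(1 + 2 a (1 - \<gamma>)); against the
  weight t^(2 \<theta> - 2) this suffices exactly when \<theta> > 1/2 - a (1 - \<gamma>).
  Associativity of convolution holds only almost everywhere, and the equation only on (0, T]. Both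
  defects are removed algebraically: classes modulo null sets form a commutative ring without unit,
  in which the classes that vanish up to T form an ideal.\<close>

definition convl :: "(real \<Rightarrow> real) \<Rightarrow> (real \<Rightarrow> real) \<Rightarrow> real \<Rightarrow> real" where
  "convl f g x = (\<integral>y. f (x - y) * g y \<partial>lborel)"

definition trunc :: "real \<Rightarrow> (real \<Rightarrow> real) \<Rightarrow> real \<Rightarrow> real" where
  "trunc r f x = indicator {..r} x * f x"

text \<open>Vanishing on the negative half-line is required pointwise. The convolution over the
  whole line then has its integrand supported in [0, x], and truncating both factors at r leaves all
  values up to r exactly unchanged.\<close>

definition L1loc :: "(real \<Rightarrow> real) \<Rightarrow> bool" where
  "L1loc f \<longleftrightarrow> f \<in> borel_measurable borel \<and> (\<forall>x<0. f x = 0) \<and> (\<forall>r. integrable lborel (trunc r f))"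

text \<open>\<open>M\<close> and the shift \<open>h\<close> are general so that the same Fubini
  argument serves twice: with \<open>M\<close> the line for a product of two functions, and with
  \<open>M\<close> the plane and \<open>h\<close> its second coordinate for the triple product
  behind associativity.\<close>

lemma integrable_pair_shift:
  fixes F :: "real \<Rightarrow> real" and P :: "'a \<Rightarrow> real"
  assumes M: "sigma_finite_measure M" and P: "integrable M P" and h[measurable]: "h \<in> borel_measurable M"
    and F: "integrable lborel F"
  shows "integrable (M \<Otimes>\<^sub>M lborel) (\<lambda>(p, x). F (x - h p) * P p)"
proof -
  interpret M: sigma_finite_measure M by fact
  interpret pair_sigma_finite M lborel ..
  have [measurable]: "P \<in> borel_measurable M" "F \<in> borel_measurable borel"
    using P F by auto
  have int: "integrable lborel (\<lambda>x. F (x - c))" for c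
    using lborel_integrable_real_affine[OF F, of 1 "-c"] by (simp add: algebra_simps)
  have eq: "(\<integral>x. \<bar>F (x - c)\<bar> \<partial>lborel) = (\<integral>x. \<bar>F x\<bar> \<partial>lborel)" for c
    using lborel_integral_real_affine[of 1 "\<lambda>x. \<bar>F x\<bar>" "-c"] by (simp add: algebra_simps)
  show ?thesis
  proof (rule Fubini_integrable)
    show "integrable M (\<lambda>p. \<integral>x. norm (case (p, x) of (p, x) \<Rightarrow> F (x - h p) * P p) \<partial>lborel)"
      using P by (simp add: abs_mult eq integrable_abs)
    show "AE p in M. integrable lborel (\<lambda>x. case (p, x) of (p, x) \<Rightarrow> F (x - h p) * P p)"
      using int by simp
  qed measurable
qed

lemma convl_measurable[measurable]:
  assumes [measurable]: "f \<in> borel_measurable borel" "g \<in> borel_measurable borel"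
  shows "convl f g \<in> borel_measurable borel"
  unfolding convl_def[abs_def] by measurable

lemma
  assumes F: "integrable lborel F" and G: "integrable lborel G"
  shows convl_AE_integrable: "AE x in lborel. integrable lborel (\<lambda>y. F (x - y) * G y)"
    and convl_integrable: "integrable lborel (convl F G)"
    and convl_integral: "(\<integral>x. convl F G x \<partial>lborel) = (\<integral>x. F x \<partial>lborel) * (\<integral>x. G x \<partial>lborel)"
proof -
  have I: "integrable (lborel \<Otimes>\<^sub>M lborel) (\<lambda>(y, x). F (x - y) * G y)"
    using integrable_pair_shift[OF lborel.sigma_finite_measure_axioms G _ F, of "\<lambda>x. x"] by simp
  show "AE x in lborel. integrable lborel (\<lambda>y. F (x - y) * G y)"
    using lborel_pair.AE_integrable_snd[OF I] by simp
  show "integrable lborel (convl F G)"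
    using lborel_pair.integrable_snd[OF I] unfolding convl_def[abs_def] by simp
  have "(\<integral>x. convl F G x \<partial>lborel) = (\<integral>y. (\<integral>x. F (x - y) * G y \<partial>lborel) \<partial>lborel)"
    using lborel_pair.Fubini_integral[OF I] unfolding convl_def[abs_def] by simp
  also have "\<dots> = (\<integral>y. (\<integral>x. F x \<partial>lborel) * G y \<partial>lborel)"
  proof (rule Bochner_Integration.integral_cong, simp)
    fix y show "(\<integral>x. F (x - y) * G y \<partial>lborel) = (\<integral>x. F x \<partial>lborel) * G y"
      using lborel_integral_real_affine[of 1 F "-y"] by (simp add: algebra_simps)
  qed
  finally show "(\<integral>x. convl F G x \<partial>lborel) = (\<integral>x. F x \<partial>lborel) * (\<integral>x. G x \<partial>lborel)" by simp
qed

lemma convl_abs_le: "\<bar>convl F G x\<bar> \<le> convl (\<lambda>x. \<bar>F x\<bar>) (\<lambda>x. \<bar>G x\<bar>) x"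
  unfolding convl_def using integral_norm_bound[of lborel "\<lambda>y. F (x - y) * G y"] by (simp add: abs_mult)

lemma convl_commute: "convl f g = convl g f"
proof
  fix x show "convl f g x = convl g f x"
    unfolding convl_def using lborel_integral_real_affine[of "-1" "\<lambda>y. f (x - y) * g y" x]
    by (simp add: algebra_simps)
qed

text \<open>Both sides are iterated integrals of F (x - z) G (z - y) H y over the plane. The
  exceptional x are those at which this function of (y, z) fails to be integrable, a null set
  because the triple integral converges absolutely.\<close>

lemma convl_assoc_int:
  assumes F: "integrable lborel F" and G: "integrable lborel G" and H: "integrable lborel H"
  shows "AE x in lborel. convl (convl F G) H x = convl F (convl G H) x"
proof -
  have I: "integrable (lborel \<Otimes>\<^sub>M lborel) (\<lambda>(y, z). G (z - y) * H y)"
    using integrable_pair_shift[OF lborel.sigma_finite_measure_axioms H _ G, of "\<lambda>x. x"] by simp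
  interpret LL: sigma_finite_measure "lborel \<Otimes>\<^sub>M lborel :: (real \<times> real) measure"
    by (rule sigma_finite_pair_measure; rule lborel.sigma_finite_measure_axioms)
  have LL: "sigma_finite_measure (lborel \<Otimes>\<^sub>M lborel :: (real \<times> real) measure)" ..
  interpret P: pair_sigma_finite "lborel \<Otimes>\<^sub>M lborel :: (real \<times> real) measure" "lborel :: real measure" ..
  have "integrable ((lborel \<Otimes>\<^sub>M lborel) \<Otimes>\<^sub>M lborel) (\<lambda>(p, x). F (x - snd p) * (case p of (y, z) \<Rightarrow> G (z - y) * H y))"
    by (rule integrable_pair_shift[OF LL I _ F]) measurable
  from P.AE_integrable_snd[OF this]
  have "AE x in lborel. integrable (lborel \<Otimes>\<^sub>M lborel) (\<lambda>(y, z). F (x - z) * (G (z - y) * H y))"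
    by (simp add: case_prod_unfold)
  then show ?thesis
  proof eventually_elim
    case (elim x)
    have "convl F (convl G H) x = (\<integral>z. (\<integral>y. F (x - z) * (G (z - y) * H y) \<partial>lborel) \<partial>lborel)"
      unfolding convl_def by simp
    also have "\<dots> = (\<integral>y. (\<integral>z. F (x - z) * (G (z - y) * H y) \<partial>lborel) \<partial>lborel)"
      using lborel_pair.Fubini_integral[OF elim] by simp
    also have "\<dots> = (\<integral>y. convl F G (x - y) * H y \<partial>lborel)"
    proof (rule Bochner_Integration.integral_cong, simp)
      fix y
      have "(\<integral>z. F (x - z) * G (z - y) \<partial>lborel) = convl F G (x - y)"
        unfolding convl_def using lborel_integral_real_affine[of 1 "\<lambda>z. F (x - z) * G (z - y)" y]
        by (simp add: algebra_simps)
      then show "(\<integral>z. F (x - z) * (G (z - y) * H y) \<partial>lborel) = convl F G (x - y) * H y"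
        by (simp add: mult.assoc[symmetric])
    qed
    finally show ?case by (simp add: convl_def)
  qed
qed

lemma L1loc_measurable[measurable_dest]: "L1loc f \<Longrightarrow> f \<in> borel_measurable borel"
  by (simp add: L1loc_def)

lemma L1loc_neg: "L1loc f \<Longrightarrow> x < 0 \<Longrightarrow> f x = 0"
  by (simp add: L1loc_def)

lemma L1loc_trunc: "L1loc f \<Longrightarrow> integrable lborel (trunc r f)"
  by (simp add: L1loc_def)

lemma trunc_neg: "(\<And>x. x < 0 \<Longrightarrow> f x = 0) \<Longrightarrow> x < 0 \<Longrightarrow> trunc r f x = 0"
  by (simp add: trunc_def)

lemma trunc_eq: "x \<le> r \<Longrightarrow> trunc r f x = f x"
  by (simp add: trunc_def)

lemma convl_cong_le:
  assumes "\<And>x. x < 0 \<Longrightarrow> f x = 0" "\<And>x. x < 0 \<Longrightarrow> g x = 0"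
    "\<And>x. x < 0 \<Longrightarrow> f' x = 0" "\<And>x. x < 0 \<Longrightarrow> g' x = 0"
    "\<And>x. 0 \<le> x \<Longrightarrow> x \<le> r \<Longrightarrow> f x = f' x" "\<And>x. 0 \<le> x \<Longrightarrow> x \<le> r \<Longrightarrow> g x = g' x" "x \<le> r"
  shows "(\<lambda>y. f (x - y) * g y) = (\<lambda>y. f' (x - y) * g' y)" "convl f g x = convl f' g' x"
proof -
  show "(\<lambda>y. f (x - y) * g y) = (\<lambda>y. f' (x - y) * g' y)"
  proof
    fix y show "f (x - y) * g y = f' (x - y) * g' y"
      using assms(1)[of "x - y"] assms(3)[of "x - y"] assms(2)[of y] assms(4)[of y] assms(5)[of "x - y"] assms(6)[of y] assms(7)
      by (cases "y < 0"; cases "x - y < 0") auto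
  qed
  then show "convl f g x = convl f' g' x" by (simp add: convl_def)
qed

lemma convl_trunc:
  assumes "\<And>x. x < 0 \<Longrightarrow> f x = 0" "\<And>x. x < 0 \<Longrightarrow> g x = 0" "x \<le> r"
  shows "(\<lambda>y. f (x - y) * g y) = (\<lambda>y. trunc r f (x - y) * trunc r g y)" "convl f g x = convl (trunc r f) (trunc r g) x"
  using convl_cong_le[of f g "trunc r f" "trunc r g" r x] assms by (auto simp: trunc_def)

lemma convl_neg:
  assumes "\<And>x. x < 0 \<Longrightarrow> f x = 0" "\<And>x. x < 0 \<Longrightarrow> g x = 0" "x < 0"
  shows "convl f g x = 0"
proof -
  have "(\<lambda>y. f (x - y) * g y) = (\<lambda>y. 0)"
    using assms(1)[of "x - _"] assms(2,3) by (auto simp: fun_eq_iff) (metis diff_less_0_iff_less less_le_trans not_less)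
  then show ?thesis by (simp add: convl_def)
qed

text \<open>Glues statements proved for truncated functions: countably many integer cut-offs cover
  the line.\<close>

lemma AE_le_all:
  assumes "\<And>r::real. AE x in lborel. x \<le> r \<longrightarrow> P x"
  shows "AE x::real in lborel. P x"
proof -
  have "AE x in lborel. \<forall>n::nat. x \<le> real n \<longrightarrow> P x"
    unfolding AE_all_countable using assms by blast
  then show ?thesis
    by (rule eventually_mono) (meson real_arch_simple)
qed

lemma L1loc_convl:
  assumes f: "L1loc f" and g: "L1loc g"
  shows "L1loc (convl f g)"
  unfolding L1loc_def
proof safe
  show "convl f g \<in> borel_measurable borel" using f g by measurable
  show "convl f g x = 0" if "x < 0" for x by (rule convl_neg[OF L1loc_neg[OF f] L1loc_neg[OF g] that])
  fix r
  have "trunc r (convl f g) = trunc r (convl (trunc r f) (trunc r g))"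
    using convl_trunc(2)[OF L1loc_neg[OF f] L1loc_neg[OF g]] by (auto simp: trunc_def fun_eq_iff indicator_def)
  moreover have "integrable lborel (trunc r (convl (trunc r f) (trunc r g)))"
    unfolding trunc_def[of r "convl _ _", abs_def]
    using integrable_mult_indicator[OF _ convl_integrable[OF L1loc_trunc[OF f, of r] L1loc_trunc[OF g, of r]], of "{..r}"]
    by simp
  ultimately show "integrable lborel (trunc r (convl f g))" by simp
qed

lemma L1loc_convl_AE:
  assumes f: "L1loc f" and g: "L1loc g"
  shows "AE x in lborel. integrable lborel (\<lambda>y. f (x - y) * g y)"
proof (rule AE_le_all)
  fix r
  show "AE x in lborel. x \<le> r \<longrightarrow> integrable lborel (\<lambda>y. f (x - y) * g y)"
    using convl_AE_integrable[OF L1loc_trunc[OF f, of r] L1loc_trunc[OF g, of r]]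
  proof eventually_elim
    case (elim x)
    then show ?case
      using convl_trunc(1)[of f g x r] L1loc_neg[OF f] L1loc_neg[OF g] by auto
  qed
qed

lemma L1loc_convl_assoc:
  assumes f: "L1loc f" and g: "L1loc g" and h: "L1loc h"
  shows "AE x in lborel. convl (convl f g) h x = convl f (convl g h) x"
proof (rule AE_le_all)
  fix r
  note n = L1loc_neg[OF f] L1loc_neg[OF g] L1loc_neg[OF h]
  show "AE x in lborel. x \<le> r \<longrightarrow> convl (convl f g) h x = convl f (convl g h) x"
    using convl_assoc_int[OF L1loc_trunc[OF f, of r] L1loc_trunc[OF g, of r] L1loc_trunc[OF h, of r]]
  proof eventually_elim
    case (elim x)
    show ?case
    proof
      assume x: "x \<le> r"
      have "convl (convl f g) h x = convl (convl (trunc r f) (trunc r g)) (trunc r h) x"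
        using x n by (intro convl_cong_le(2)[where r=r]) (auto intro!: convl_neg trunc_neg simp: trunc_eq convl_trunc(2)[of f g _ r])
      moreover have "convl f (convl g h) x = convl (trunc r f) (convl (trunc r g) (trunc r h)) x"
        using x n by (intro convl_cong_le(2)[where r=r]) (auto intro!: convl_neg trunc_neg simp: trunc_eq convl_trunc(2)[of g h _ r])
      ultimately show "convl (convl f g) h x = convl f (convl g h) x" using elim by simp
    qed
  qed
qed

section \<open>The algebra of locally integrable functions modulo null sets\<close>

lemma L1loc_zero: "L1loc (\<lambda>x. 0)"
  by (simp add: L1loc_def trunc_def[abs_def])

lemma L1loc_add: "L1loc f \<Longrightarrow> L1loc g \<Longrightarrow> L1loc (\<lambda>x. f x + g x)"
  using Bochner_Integration.integrable_add[of lborel "trunc r f" "trunc r g" for r]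
  by (auto simp: L1loc_def trunc_def[abs_def] distrib_left)

lemma L1loc_scale: "L1loc f \<Longrightarrow> L1loc (\<lambda>x. c * f x)"
  using Bochner_Integration.integrable_mult_right[of c lborel "trunc r f" for r]
  by (auto simp: L1loc_def trunc_def[abs_def] mult.left_commute)

lemma L1loc_uminus: "L1loc f \<Longrightarrow> L1loc (\<lambda>x. - f x)"
  using L1loc_scale[of f "-1"] by simp

lemma AE_reflect:
  fixes f f' :: "real \<Rightarrow> real"
  assumes [measurable]: "f \<in> borel_measurable borel" "f' \<in> borel_measurable borel"
    and eq: "AE x in lborel. f x = f' x"
  shows "AE y in lborel. f (x - y) = f' (x - y)"
proof -
  have "(\<integral>\<^sup>+y. ennreal \<bar>f y - f' y\<bar> \<partial>lborel) = 0"
    by (subst nn_integral_0_iff_AE) (use eq in auto)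
  then have "(\<integral>\<^sup>+y. ennreal \<bar>f (x - y) - f' (x - y)\<bar> \<partial>lborel) = 0"
    by (subst (asm) nn_integral_real_affine[of _ "-1" x]) auto
  then show ?thesis
    by (subst (asm) nn_integral_0_iff_AE) auto
qed

text \<open>For each fixed x the two integrands differ only on a null set, so the convolutions agree
  everywhere. This is what lets convolution descend to classes.\<close>

lemma convl_cong_AE:
  assumes f: "L1loc f" "L1loc f'" "AE x in lborel. f x = f' x" and g: "L1loc g" "L1loc g'" "AE x in lborel. g x = g' x"
  shows "convl f g = convl f' g'"
proof
  fix x
  note [measurable] = f(1,2)[THEN L1loc_measurable] g(1,2)[THEN L1loc_measurable]
  have "AE y in lborel. f (x - y) = f' (x - y)"
    by (rule AE_reflect) (use f(3) in auto)
  with g(3) have "AE y in lborel. f (x - y) * g y = f' (x - y) * g' y"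
    by eventually_elim simp
  then show "convl f g x = convl f' g' x"
    unfolding convl_def by (intro integral_cong_AE) auto
qed

\<comment> \<open>The quotient is partial: only locally integrable functions represent classes.
  Identities that hold almost everywhere, associativity above all, become equations, so the later
  manipulations of Volterra equations are plain algebra in a commutative ring.\<close>
quotient_type locint = "real \<Rightarrow> real" / partial: "\<lambda>f g. L1loc f \<and> L1loc g \<and> (AE x in lborel. f x = g x)"
  morphisms rep_locint cls
proof (rule part_equivpI)
  show "\<exists>x. L1loc x \<and> L1loc x \<and> (AE xa in lborel. x xa = x xa)"
    using L1loc_zero by auto
  show "symp (\<lambda>f g. L1loc f \<and> L1loc g \<and> (AE x in lborel. f x = g x))"
    by (rule sympI) (auto elim: eventually_mono)
  show "transp (\<lambda>f g. L1loc f \<and> L1loc g \<and> (AE x in lborel. f x = g x))"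
    by (rule transpI) (auto elim: eventually_elim2)
qed


lemma L1loc_convl_add:
  assumes f: "L1loc f" and g: "L1loc g" and h: "L1loc h"
  shows "AE x in lborel. convl (\<lambda>x. f x + g x) h x = convl f h x + convl g h x"
  using L1loc_convl_AE[OF f h] L1loc_convl_AE[OF g h]
  by eventually_elim (simp add: convl_def distrib_right)

lemma convl_scale: "convl (\<lambda>x. c * f x) g = (\<lambda>x. c * convl f g x)"
  by (simp add: convl_def fun_eq_iff mult.assoc)

lemma convl_scale_right: "convl f (\<lambda>x. c * g x) = (\<lambda>x. c * convl f g x)"
  by (simp add: convl_def fun_eq_iff mult.left_commute)

instantiation locint :: "{comm_ring, real_algebra}"
begin

lift_definition zero_locint :: locint is "\<lambda>x. 0"
  by (simp add: L1loc_zero)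

lift_definition uminus_locint :: "locint \<Rightarrow> locint" is "\<lambda>f x. - f x"
  by (auto simp: L1loc_uminus)

lift_definition plus_locint :: "locint \<Rightarrow> locint \<Rightarrow> locint" is "\<lambda>f g x. f x + g x"
  by (auto intro: L1loc_add elim: eventually_elim2)

definition minus_locint :: "locint \<Rightarrow> locint \<Rightarrow> locint" where
  "minus_locint x y = x + - y"

lift_definition times_locint :: "locint \<Rightarrow> locint \<Rightarrow> locint" is convl
proof -
  fix f f' g g' :: "real \<Rightarrow> real"
  assume *: "L1loc f \<and> L1loc f' \<and> (AE x in lborel. f x = f' x)" "L1loc g \<and> L1loc g' \<and> (AE x in lborel. g x = g' x)"
  then have "convl f g = convl f' g'" by (intro convl_cong_AE) auto
  with * show "L1loc (convl f g) \<and> L1loc (convl f' g') \<and> (AE x in lborel. convl f g x = convl f' g' x)"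
    using L1loc_convl[of f g] by auto
qed

lift_definition scaleR_locint :: "real \<Rightarrow> locint \<Rightarrow> locint" is "\<lambda>c f x. c * f x"
  by (auto intro: L1loc_scale elim: eventually_mono)

instance
proof
  fix x y z :: locint and a b :: real
  show "x + y + z = x + (y + z)" by transfer (auto intro: L1loc_add simp: add.assoc)
  show "x + y = y + x" by transfer (auto intro: L1loc_add simp: add.commute)
  show "0 + x = x" by transfer auto
  show "- x + x = 0" by transfer (auto intro: L1loc_zero)
  show "x - y = x + - y" by (simp add: minus_locint_def)
  show "x * y * z = x * (y * z)" by transfer (auto intro: L1loc_convl L1loc_convl_assoc)
  have comm: "x * y = y * x" for x y :: locint by transfer (auto intro: L1loc_convl simp: convl_commute)
  then show "x * y = y * x" .
  show "(x + y) * z = x * z + y * z" by transfer (auto intro: L1loc_convl L1loc_add L1loc_convl_add)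
  show "x * (y + z) = x * y + x * z"
    unfolding comm[of x] by transfer (auto intro: L1loc_convl L1loc_add L1loc_convl_add)
  show "a *\<^sub>R (x + y) = a *\<^sub>R x + a *\<^sub>R y" by transfer (auto intro: L1loc_add L1loc_scale simp: distrib_left)
  show "(a + b) *\<^sub>R x = a *\<^sub>R x + b *\<^sub>R x"
    by transfer (auto intro: L1loc_add L1loc_scale simp: distrib_right)
  show "a *\<^sub>R b *\<^sub>R x = (a * b) *\<^sub>R x" by transfer (auto intro: L1loc_scale simp: mult.assoc)
  show "1 *\<^sub>R x = x" by transfer auto
  show "a *\<^sub>R x * y = a *\<^sub>R (x * y)" by transfer (auto intro: L1loc_convl L1loc_scale simp: convl_scale)
  show "x * a *\<^sub>R y = a *\<^sub>R (x * y)"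
    by transfer (auto intro: L1loc_convl L1loc_scale simp: convl_scale_right)
qed

end

lemma cls_eq: "L1loc f \<Longrightarrow> L1loc g \<Longrightarrow> cls f = cls g \<longleftrightarrow> (AE x in lborel. f x = g x)"
  using Quotient_rel[OF Quotient_locint] by auto

lemma cls_mult: "L1loc f \<Longrightarrow> L1loc g \<Longrightarrow> cls f * cls g = cls (convl f g)"
  using times_locint.abs_eq by auto

lemma cls_add: "L1loc f \<Longrightarrow> L1loc g \<Longrightarrow> cls f + cls g = cls (\<lambda>x. f x + g x)"
  using plus_locint.abs_eq by auto

lemma cls_uminus: "L1loc f \<Longrightarrow> - cls f = cls (\<lambda>x. - f x)"
  using uminus_locint.abs_eq by auto

lemma cls_scaleR: "L1loc f \<Longrightarrow> c *\<^sub>R cls f = cls (\<lambda>x. c * f x)"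
  using scaleR_locint.abs_eq by auto

lemma cls_zero: "cls (\<lambda>x. 0) = 0"
  by (simp add: zero_locint_def)

lemma cls_cases:
  obtains f where "L1loc f" "x = cls f"
  using locint.abs_induct[of "\<lambda>x. \<exists>f. L1loc f \<and> x = cls f" x] by blast

section \<open>Riemann--Liouville kernels\<close>

text \<open>\<open>beta_ker\<close> extended by zero to the negative half-line; at 0 both are 0,
  because \<open>0 powr x\<close> is 0.\<close>

definition rl_ker :: "real \<Rightarrow> real \<Rightarrow> real" where
  "rl_ker a t = (if 0 < t then t powr (a - 1) / Gamma a else 0)"

lemma rl_ker_measurable[measurable]: "rl_ker a \<in> borel_measurable borel"
  unfolding rl_ker_def[abs_def] by measurable

lemma rl_ker_nonneg: "a > 0 \<Longrightarrow> 0 \<le> rl_ker a t"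
  by (simp add: rl_ker_def)

text \<open>For nonnegative functions gauge integrability is absolute integrability. This carries
  the known gauge integrals for powers, Beta and Gamma over to \<open>lborel\<close>.\<close>

lemma nonneg_has_integral_lborel:
  fixes f :: "real \<Rightarrow> real"
  assumes "(f has_integral c) S" "\<And>x. x \<in> S \<Longrightarrow> 0 \<le> f x" "f \<in> borel_measurable borel" "S \<in> sets borel"
  shows "integrable lborel (\<lambda>x. indicator S x * f x)" "(\<integral>x. indicator S x * f x \<partial>lborel) = c"
proof -
  note [measurable] = assms(3,4)
  have "f absolutely_integrable_on S"
    using assms by (intro nonnegative_absolutely_integrable_1) (auto simp: has_integral_integrable)
  then have i: "set_integrable lborel S f"
    unfolding set_integrable_def by (subst (asm) integrable_completion) auto
  then show "integrable lborel (\<lambda>x. indicator S x * f x)"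
    by (simp add: set_integrable_def)
  show "(\<integral>x. indicator S x * f x \<partial>lborel) = c"
    using set_borel_integral_eq_integral(2)[OF i] integral_unique[OF assms(1)] by (simp add: set_lebesgue_integral_def)
qed

lemma powr_integrable_Icc:
  assumes "a > (0::real)"
  shows "set_integrable lborel {0..r} (\<lambda>t. t powr (a - 1))"
    "0 \<le> r \<Longrightarrow> (LINT t:{0..r}|lborel. t powr (a - 1)) = r powr a / a"
proof -
  have *: "((\<lambda>t. t powr (a - 1)) has_integral (r powr a / a)) {0..r}" if "0 \<le> r" for r
    using has_integral_powr_from_0[of "a - 1" r] that assms by simp
  show "set_integrable lborel {0..r} (\<lambda>t. t powr (a - 1))"
    using nonneg_has_integral_lborel(1)[OF *] by (cases "0 \<le> r") (auto simp: set_integrable_def)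
  show "(LINT t:{0..r}|lborel. t powr (a - 1)) = r powr a / a" if "0 \<le> r"
    using nonneg_has_integral_lborel(2)[OF *[OF that]] by (simp add: set_lebesgue_integral_def)
qed

lemma L1loc_rl_ker: assumes "a > 0" shows "L1loc (rl_ker a)"
  unfolding L1loc_def
proof safe
  fix r
  have "trunc r (rl_ker a) = (\<lambda>t. (indicator {0..r} t *\<^sub>R (t powr (a - 1))) / Gamma a)"
    by (auto simp: trunc_def rl_ker_def indicator_def fun_eq_iff)
  then show "integrable lborel (trunc r (rl_ker a))"
    using powr_integrable_Icc(1)[OF assms, of r] by (simp add: set_integrable_def)
qed (auto simp: rl_ker_def)

lemma Beta_lborel:
  assumes "a > 0" "b > (0::real)"
  shows "integrable lborel (\<lambda>t. indicator {0<..<1} t * (t powr (a - 1) * (1 - t) powr (b - 1)))"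
    "(\<integral>t. indicator {0<..<1} t * (t powr (a - 1) * (1 - t) powr (b - 1)) \<partial>lborel) = Beta a b"
proof -
  have *: "((\<lambda>t. t powr (a - 1) * (1 - t) powr (b - 1)) has_integral Beta a b) {0<..<1}"
    using has_integral_Beta_real[OF assms] by (simp add: has_integral_Icc_iff_Ioo)
  show "integrable lborel (\<lambda>t. indicator {0<..<1} t * (t powr (a - 1) * (1 - t) powr (b - 1)))"
    "(\<integral>t. indicator {0<..<1} t * (t powr (a - 1) * (1 - t) powr (b - 1)) \<partial>lborel) = Beta a b"
    using nonneg_has_integral_lborel[OF *] by simp_all
qed

lemma convl_rl_ker:
  assumes a: "a > 0" and b: "b > 0"
  shows "convl (rl_ker a) (rl_ker b) = rl_ker (a + b)"
proof
  fix x show "convl (rl_ker a) (rl_ker b) x = rl_ker (a + b) x"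
  proof (cases "x > 0")
    case False
    have "(\<lambda>y. rl_ker a (x - y) * rl_ker b y) = (\<lambda>y. 0)"
      using False by (auto simp: rl_ker_def fun_eq_iff)
    then show ?thesis using False by (simp add: convl_def rl_ker_def)
  next
    case True
    \<comment> \<open>Rescaling [0, x] to the unit interval leaves the Beta integral, whose Gamma
      quotient cancels the two normalisations.\<close>
    have "convl (rl_ker a) (rl_ker b) x = x * (\<integral>y. rl_ker a (x - x * y) * rl_ker b (x * y) \<partial>lborel)"
      unfolding convl_def using lborel_integral_real_affine[of x "\<lambda>y. rl_ker a (x - y) * rl_ker b y" 0] True by simp
    also have "(\<lambda>y. rl_ker a (x - x * y) * rl_ker b (x * y)) =
        (\<lambda>y. x powr (a + b - 2) / (Gamma a * Gamma b) * (indicator {0<..<1} y * (y powr (b - 1) * (1 - y) powr (a - 1))))"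
    proof
      fix y
      have "x - x * y = x * (1 - y)" by (simp add: algebra_simps)
      moreover have "0 < x * (1 - y) \<longleftrightarrow> y < 1" "0 < x * y \<longleftrightarrow> 0 < y"
        using True by (auto simp: zero_less_mult_iff)
      moreover have "x powr (a + b - 2) = x powr (a - 1) * x powr (b - 1)"
        by (simp add: powr_add[symmetric])
      ultimately show "rl_ker a (x - x * y) * rl_ker b (x * y) =
        x powr (a + b - 2) / (Gamma a * Gamma b) * (indicator {0<..<1} y * (y powr (b - 1) * (1 - y) powr (a - 1)))"
        using True by (auto simp: rl_ker_def indicator_def powr_mult)
    qed
    also have "x * (\<integral>y. x powr (a + b - 2) / (Gamma a * Gamma b) * (indicator {0<..<1} y * (y powr (b - 1) * (1 - y) powr (a - 1))) \<partial>lborel)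
       = x * x powr (a + b - 2) * Beta b a / (Gamma a * Gamma b)"
      by (simp only: integral_mult_right_zero Beta_lborel(2)[OF b a]) simp
    also have "\<dots> = rl_ker (a + b) x"
      using True Gamma_real_pos[OF a] Gamma_real_pos[OF b]
      by (simp add: rl_ker_def Beta_def add.commute powr_mult_base)
    finally show ?thesis .
  qed
qed

lemma cls_rl_ker_mult: "a > 0 \<Longrightarrow> b > 0 \<Longrightarrow> cls (rl_ker a) * cls (rl_ker b) = cls (rl_ker (a + b))"
  by (simp add: cls_mult L1loc_rl_ker convl_rl_ker)

text \<open>An ideal of the convolution ring: equations that hold almost everywhere on (0, T] are
  congruences modulo it.\<close>
definition vanishes :: "real \<Rightarrow> locint \<Rightarrow> bool" where
  "vanishes T x \<longleftrightarrow> (\<exists>f. L1loc f \<and> x = cls f \<and> (\<forall>t\<le>T. f t = 0))"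

lemma vanishes_cls:
  assumes f: "L1loc f"
  shows "vanishes T (cls f) \<longleftrightarrow> (AE t in lborel. t \<in> {0<..T} \<longrightarrow> f t = 0)"
proof
  assume "vanishes T (cls f)"
  then obtain g where g: "L1loc g" "cls f = cls g" "\<forall>t\<le>T. g t = 0" by (auto simp: vanishes_def)
  then have "AE t in lborel. f t = g t" using f by (simp add: cls_eq)
  then show "AE t in lborel. t \<in> {0<..T} \<longrightarrow> f t = 0"
    by eventually_elim (use g(3) in auto)
next
  assume *: "AE t in lborel. t \<in> {0<..T} \<longrightarrow> f t = 0"
  \<comment> \<open>\<open>vanishes\<close> asks for a representative that is zero at every point up
    to T, so f is cut off there; this changes it on a null set only.\<close>
  define g where "g = (\<lambda>t. indicator {T<..} t * f t)"
  have "L1loc g"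
    unfolding L1loc_def
  proof safe
    show "g \<in> borel_measurable borel" unfolding g_def using f by measurable
    show "g x = 0" if "x < 0" for x using L1loc_neg[OF f that] by (simp add: g_def)
    fix r
    have "trunc r g = (\<lambda>t. indicator {T<..} t *\<^sub>R trunc r f t)" by (auto simp: trunc_def g_def indicator_def)
    then show "integrable lborel (trunc r g)"
      using integrable_mult_indicator[OF _ L1loc_trunc[OF f], of "{T<..}"] by simp
  qed
  moreover have "AE t in lborel. f t = g t"
    using * AE_lborel_singleton[of 0]
    by eventually_elim (use L1loc_neg[OF f] in \<open>auto simp: g_def indicator_def not_less\<close>, force)
  ultimately show "vanishes T (cls f)"
    unfolding vanishes_def using f by (intro exI[of _ g]) (auto simp: cls_eq g_def)
qed

lemma vanishes_add: "vanishes T x \<Longrightarrow> vanishes T y \<Longrightarrow> vanishes T (x + y)"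
  unfolding vanishes_def by (metis (mono_tags, lifting) add.right_neutral cls_add L1loc_add)

lemma vanishes_scaleR: "vanishes T x \<Longrightarrow> vanishes T (c *\<^sub>R x)"
  unfolding vanishes_def by (metis (mono_tags, lifting) mult_zero_right cls_scaleR L1loc_scale)

lemma vanishes_uminus: "vanishes T x \<Longrightarrow> vanishes T (- x)"
  using vanishes_scaleR[of T x "-1"] by simp

lemma vanishes_diff: "vanishes T x \<Longrightarrow> vanishes T y \<Longrightarrow> vanishes T (x - y)"
  using vanishes_add[OF _ vanishes_uminus] by fastforce

text \<open>Convolution is causal: its value at t \<le> T sees the second factor only up to t, since
  the first factor vanishes at negative arguments.\<close>

lemma vanishes_mult: "vanishes T x \<Longrightarrow> vanishes T (y * x)"
proof -
  assume "vanishes T x"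
  then obtain f where f: "L1loc f" "x = cls f" "\<forall>t\<le>T. f t = 0" by (auto simp: vanishes_def)
  obtain g where g: "L1loc g" "y = cls g" by (rule cls_cases)
  have "convl g f t = 0" if "t \<le> T" for t
  proof -
    have "(\<lambda>s. g (t - s) * f s) = (\<lambda>s. 0)"
    proof
      fix s show "g (t - s) * f s = 0"
        using f(3) that L1loc_neg[OF g(1), of "t - s"] by (cases "s \<le> T") auto
    qed
    then show ?thesis by (simp add: convl_def)
  qed
  then show "vanishes T (y * x)"
    unfolding vanishes_def f g using f g by (intro exI[of _ "convl g f"]) (auto simp: cls_mult L1loc_convl)
qed

section \<open>Cancelling the convolution with 1\<close>

lemma rl_ker1: "rl_ker 1 t = (if 0 < t then 1 else 0)"
  by (simp add: rl_ker_def)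

lemma convl_rl_ker1:
  assumes f: "L1loc f"
  shows "convl (rl_ker 1) f t = (LINT s:{0..t}|lborel. f s)"
proof -
  have "AE s in lborel. rl_ker 1 (t - s) * f s = indicator {0..t} s * f s"
    using AE_lborel_singleton[of t]
    by eventually_elim (use L1loc_neg[OF f] in \<open>auto simp: rl_ker1 indicator_def\<close>)
  then show ?thesis
    unfolding convl_def set_lebesgue_integral_def
    using f by (intro integral_cong_AE) (auto simp: L1loc_def)
qed

lemma L1loc_integrable_Icc: "L1loc f \<Longrightarrow> set_integrable lborel {0..r} f"
proof -
  assume f: "L1loc f"
  have "trunc r f = (\<lambda>x. indicator {0..r} x *\<^sub>R f x)"
    using L1loc_neg[OF f] by (auto simp: trunc_def indicator_def fun_eq_iff)
  then show ?thesis using L1loc_trunc[OF f, of r] by (simp add: set_integrable_def)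
qed

text \<open>The half-lines are an intersection-stable generator of the Borel sets, so the vanishing
  of all initial integrals extends to the integral over every Borel set, and a density with zero
  integrals is zero almost everywhere.\<close>

lemma integral_zero_imp_AE_zero:
  fixes f :: "real \<Rightarrow> real"
  assumes f: "set_integrable lborel {0..T} f" and z: "\<And>t. t \<in> {0..T} \<Longrightarrow> (LINT s:{0..t}|lborel. f s) = 0"
  shows "AE t in lborel. t \<in> {0..T} \<longrightarrow> f t = 0"
proof (cases "0 \<le> T")
  case False then show ?thesis by auto
next
  case True
  define h where "h t = indicator {0..T} t * f t" for t
  have h: "integrable lborel h" using f by (simp add: set_integrable_def h_def[abs_def])
  have hi: "set_integrable lborel A h" if "A \<in> sets lborel" for A
    using integrable_mult_indicator[OF that h] by (simp add: set_integrable_def)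
  have hz: "(LINT s:{..t}|lborel. h s) = 0" for t
  proof -
    have "(LINT s:{..t}|lborel. h s) = (LINT s:{0..min t T}|lborel. f s)"
      unfolding set_lebesgue_integral_def h_def by (rule Bochner_Integration.integral_cong) (auto simp: indicator_def)
    also have "\<dots> = 0"
      using z[of "min t T"] True by (cases "0 \<le> t") (auto simp: set_lebesgue_integral_def)
    finally show ?thesis .
  qed
  have "set_lebesgue_integral lborel A h = 0" if "A \<in> sets lborel" for A
  proof -
    let ?G = "range (\<lambda>t::real. {..t})"
    have gen: "sets borel = sigma_sets UNIV ?G" by (simp add: borel_eq_atMost sets_measure_of)
    have tot: "(\<integral>x. h x \<partial>lborel) = 0"
      using hz[of T] unfolding set_lebesgue_integral_def h_def by (simp add: mult.assoc[symmetric] indicator_inter_arith[symmetric])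
    have "Int_stable ?G" "?G \<subseteq> Pow UNIV" "A \<in> sigma_sets UNIV ?G"
      using that gen by (auto simp: Int_stable_def)
    then show ?thesis
    proof (induction rule: sigma_sets_induct_disjoint)
      show "set_lebesgue_integral lborel {} h = 0" by (simp add: set_lebesgue_integral_def)
    next
      fix A assume "A \<in> ?G" then show "set_lebesgue_integral lborel A h = 0" using hz by auto
    next
      fix A assume A: "A \<in> sigma_sets UNIV ?G" "set_lebesgue_integral lborel A h = 0"
      then have "A \<in> sets lborel" using gen by simp
      then have "(LINT x:A|lborel. h x) + (LINT x:UNIV - A|lborel. h x) = (LINT x:A \<union> (UNIV - A)|lborel. h x)"
        by (intro set_integral_Un[symmetric] hi) auto
      then show "(LINT x:UNIV - A|lborel. h x) = 0"
        using A tot by (simp add: set_lebesgue_integral_def)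
    next
      fix A :: "nat \<Rightarrow> real set"
      assume A: "disjoint_family A" "range A \<subseteq> sigma_sets UNIV ?G" "\<And>i. set_lebesgue_integral lborel (A i) h = 0"
      have "set_lebesgue_integral lborel (\<Union>i. A i) h = (\<Sum>i. set_lebesgue_integral lborel (A i) h)"
      proof (intro lebesgue_integral_countable_add hi)
        have "range A \<subseteq> sets borel" using A(2) gen by simp
        then show "A i \<in> sets lborel" "(\<Union>i. A i) \<in> sets lborel" for i by auto
      qed (use A(1) in \<open>auto simp: disjoint_family_on_def\<close>)
      then show "set_lebesgue_integral lborel (\<Union>i. A i) h = 0" using A by simp
    qed
  qed
  then have "AE x in lborel. h x = 0"
    using sigma_finite_measure.density_zero[OF lborel.sigma_finite_measure_axioms h] by simp
  then show ?thesis by eventually_elim (auto simp: h_def)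
qed

lemma continuous_AE_zero:
  fixes F :: "real \<Rightarrow> real"
  assumes c: "continuous_on {0..T} F" and z: "AE t in lborel. t \<in> {0<..T} \<longrightarrow> F t = 0"
    and t: "t \<in> {0..T}" and T: "T > 0"
  shows "F t = 0"
proof -
  have "AE t in lebesgue. t \<in> {0<..T} \<longrightarrow> F t = 0"
    using z by (rule AE_completion)
  then obtain N where N: "negligible N" "\<And>s. s \<in> {0<..T} \<Longrightarrow> F s \<noteq> 0 \<Longrightarrow> s \<in> N"
    unfolding eventually_ae_filter_negligible by auto
  have "((\<lambda>s. \<bar>F s\<bar>) has_integral 0) {0..T}"
    by (rule has_integral_negligible[of "insert 0 N"]) (use N in \<open>auto simp: less_le\<close>)
  then have "\<bar>F t\<bar> = 0"
    using c t T by (intro has_integral_0_cbox_imp_0[of 0 T "\<lambda>s. \<bar>F s\<bar>"]) (auto intro!: continuous_intros simp: box_real)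
  then show ?thesis by simp
qed

text \<open>Convolution with \<open>rl_ker 1\<close> is integration from 0. The primitive vanishes
  almost everywhere up to T, hence everywhere there by continuity, and then so does its integrand
  almost everywhere.\<close>

lemma vanishes_rl_ker1_cancel:
  assumes "vanishes T (cls (rl_ker 1) * x)"
  shows "vanishes T x"
proof -
  obtain f where f: "L1loc f" "x = cls f" by (rule cls_cases)
  have z: "AE t in lborel. t \<in> {0<..T} \<longrightarrow> (LINT s:{0..t}|lborel. f s) = 0"
    using assms f by (simp add: cls_mult L1loc_rl_ker L1loc_convl vanishes_cls convl_rl_ker1)
  have c: "continuous_on {0..T} (\<lambda>t. LINT s:{0..t}|lborel. f s)"
  proof -
    have "continuous_on {0..T} (\<lambda>t. integral {0..t} f)"
      using set_borel_integral_eq_integral(1)[OF L1loc_integrable_Icc[OF f(1)]]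
      by (intro indefinite_integral_continuous_1) auto
    then show ?thesis
      by (simp add: set_borel_integral_eq_integral(2)[OF L1loc_integrable_Icc[OF f(1)]])
  qed
  have "(LINT s:{0..t}|lborel. f s) = 0" if "t \<in> {0..T}" for t
  proof (cases "t = 0")
    case True
    have "AE x in lborel. indicator {0} x *\<^sub>R f x = 0"
      using AE_lborel_singleton[of 0] by eventually_elim auto
    from integral_cong_AE[OF _ _ this] True f show ?thesis
      by (simp add: set_lebesgue_integral_def L1loc_def)
  next
    case False
    then show ?thesis
      using continuous_AE_zero[OF c z that] that by auto
  qed
  then have "AE t in lborel. t \<in> {0..T} \<longrightarrow> f t = 0"
    by (intro integral_zero_imp_AE_zero L1loc_integrable_Icc f)
  then show ?thesis using f by (simp add: vanishes_cls) (auto elim: eventually_mono)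
qed

section \<open>Young's inequality\<close>

text \<open>Cauchy--Schwarz for the measure F dM: integrating F (s - G)^2 gives a quadratic
  polynomial in s that is nonnegative everywhere.\<close>

lemma cauchy_weight:
  fixes F G :: "real \<Rightarrow> real"
  assumes F: "integrable M F" "\<And>y. F y \<ge> 0" and FG: "integrable M (\<lambda>y. F y * (G y)\<^sup>2)"
    and [measurable]: "G \<in> borel_measurable M"
  shows "integrable M (\<lambda>y. F y * G y)"
    and "(\<integral>y. F y * G y \<partial>M)\<^sup>2 \<le> (\<integral>y. F y \<partial>M) * (\<integral>y. F y * (G y)\<^sup>2 \<partial>M)"
proof -
  have b: "\<bar>F y * G y\<bar> \<le> F y + F y * (G y)\<^sup>2" for y
  proof -
    have "\<bar>G y\<bar> \<le> 1 + (G y)\<^sup>2"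
      using sum_squares_bound[of 1 "\<bar>G y\<bar>"] by simp
    from mult_left_mono[OF this F(2)[of y]] show ?thesis
      using F(2)[of y] by (simp add: abs_mult algebra_simps)
  qed
  have [measurable]: "F \<in> borel_measurable M" using F(1) by auto
  show i: "integrable M (\<lambda>y. F y * G y)"
    by (rule Bochner_Integration.integrable_bound[OF Bochner_Integration.integrable_add[OF F(1) FG]])
      (use b in \<open>auto intro!: AE_I2 order_trans[OF _ abs_ge_self]\<close>)
  let ?a = "\<integral>y. F y \<partial>M" and ?b = "\<integral>y. F y * G y \<partial>M" and ?c = "\<integral>y. F y * (G y)\<^sup>2 \<partial>M"
  have q: "0 \<le> s * s * ?a - 2 * s * ?b + ?c" for s
  proof -
    have "0 \<le> (\<integral>y. F y * (s - G y)\<^sup>2 \<partial>M)" using F(2) by (intro integral_nonneg_AE) auto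
    also have "(\<lambda>y. F y * (s - G y)\<^sup>2) = (\<lambda>y. s * s * F y - 2 * s * (F y * G y) + F y * (G y)\<^sup>2)"
      by (auto simp: fun_eq_iff power2_eq_square algebra_simps)
    also have "(\<integral>y. s * s * F y - 2 * s * (F y * G y) + F y * (G y)\<^sup>2 \<partial>M) = s * s * ?a - 2 * s * ?b + ?c"
      using F(1) i FG by (simp add: mult.assoc)
    finally show ?thesis .
  qed
  show "?b\<^sup>2 \<le> ?a * ?c"
  proof (cases "?a = 0")
    case True
    have "?b = 0"
    proof (rule ccontr)
      assume "?b \<noteq> 0"
      \<comment> \<open>With zero leading coefficient the polynomial is affine, and this s gives it
        the value -1.\<close>
      with q[of "(?c + 1) / (2 * ?b)"] True show False by (simp add: field_simps)
    qed
    with True show ?thesis by simp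
  next
    case False
    have "?a \<ge> 0" using F(2) by (intro integral_nonneg_AE) auto
    with False have "?a > 0" by simp
    \<comment> \<open>The polynomial is evaluated at its minimiser s = b/a.\<close>
    have "0 \<le> ?a * ((?b/?a) * (?b/?a) * ?a - 2 * (?b/?a) * ?b + ?c)"
      using q[of "?b/?a"] \<open>?a > 0\<close> by (intro mult_nonneg_nonneg) auto
    also have "\<dots> = ?a * ?c - ?b\<^sup>2" using \<open>?a > 0\<close> by (simp add: field_simps power2_eq_square)
    finally show ?thesis by simp
  qed
qed

text \<open>Cauchy--Schwarz with the weight |F (x - y)| bounds the squared convolution at x by the
  L1 norm of F times the convolution of |F| with G^2; integrating in x turns the latter into a
  product of integrals.\<close>

lemma young_L2:
  fixes F G :: "real \<Rightarrow> real"
  assumes F: "integrable lborel F" and G: "integrable lborel (\<lambda>y. (G y)\<^sup>2)" "G \<in> borel_measurable borel"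
  shows "integrable lborel (\<lambda>x. (convl F G x)\<^sup>2)"
    and "(\<integral>x. (convl F G x)\<^sup>2 \<partial>lborel) \<le> (\<integral>x. \<bar>F x\<bar> \<partial>lborel)\<^sup>2 * (\<integral>x. (G x)\<^sup>2 \<partial>lborel)"
    and "AE x in lborel. integrable lborel (\<lambda>y. F (x - y) * G y)"
proof -
  note [measurable] = G(2) borel_measurable_integrable[OF F, simplified]
  let ?c = "convl (\<lambda>x. \<bar>F x\<bar>) (\<lambda>y. (G y)\<^sup>2)"
  have F': "integrable lborel (\<lambda>x. \<bar>F x\<bar>)" using F by simp
  have sh: "integrable lborel (\<lambda>y. \<bar>F (x - y)\<bar>)" "(\<integral>y. \<bar>F (x - y)\<bar> \<partial>lborel) = (\<integral>x. \<bar>F x\<bar> \<partial>lborel)" for x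
    using lborel_integrable_real_affine[OF F', of "-1" x] lborel_integral_real_affine[of "-1" "\<lambda>x. \<bar>F x\<bar>" x]
    by simp_all
  have *: "AE x in lborel. integrable lborel (\<lambda>y. F (x - y) * G y) \<and> (convl F G x)\<^sup>2 \<le> (\<integral>x. \<bar>F x\<bar> \<partial>lborel) * ?c x"
    using convl_AE_integrable[OF F' G(1)]
  proof eventually_elim
    case (elim x)
    note cw = cauchy_weight[OF sh(1)[of x] _ , of "\<lambda>y. \<bar>G y\<bar>", simplified, OF elim]
    have 1: "integrable lborel (\<lambda>y. F (x - y) * G y)"
      by (rule Bochner_Integration.integrable_bound[OF cw(1)]) (auto simp: abs_mult)
    have "(convl F G x)\<^sup>2 \<le> (\<integral>y. \<bar>F (x - y)\<bar> * \<bar>G y\<bar> \<partial>lborel)\<^sup>2"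
      using convl_abs_le[of F G x] by (simp add: convl_def abs_le_square_iff[symmetric])
    also have "\<dots> \<le> (\<integral>x. \<bar>F x\<bar> \<partial>lborel) * ?c x"
      using cw(2) by (simp add: sh convl_def)
    finally show ?case using 1 by simp
  qed
  note ci = convl_integrable[OF F' G(1)]
  show "AE x in lborel. integrable lborel (\<lambda>y. F (x - y) * G y)" using * by eventually_elim simp
  show i: "integrable lborel (\<lambda>x. (convl F G x)\<^sup>2)"
  proof (rule Bochner_Integration.integrable_bound[OF Bochner_Integration.integrable_mult_right[OF ci, of "\<integral>x. \<bar>F x\<bar> \<partial>lborel"]])
    show "AE x in lborel. norm ((convl F G x)\<^sup>2) \<le> norm ((\<integral>x. \<bar>F x\<bar> \<partial>lborel) * ?c x)"
      using * by eventually_elim (simp add: order_trans[OF _ abs_ge_self])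
  qed measurable
  have "(\<integral>x. (convl F G x)\<^sup>2 \<partial>lborel) \<le> (\<integral>x. (\<integral>x. \<bar>F x\<bar> \<partial>lborel) * ?c x \<partial>lborel)"
    using * by (intro integral_mono_AE i Bochner_Integration.integrable_mult_right ci) (auto elim: eventually_mono)
  also have "\<dots> = (\<integral>x. \<bar>F x\<bar> \<partial>lborel)\<^sup>2 * (\<integral>x. (G x)\<^sup>2 \<partial>lborel)"
    by (simp only: integral_mult_right_zero convl_integral[OF F' G(1)] power2_eq_square[of "\<integral>x. \<bar>F x\<bar> \<partial>lborel"] mult.assoc)
  finally show "(\<integral>x. (convl F G x)\<^sup>2 \<partial>lborel) \<le> (\<integral>x. \<bar>F x\<bar> \<partial>lborel)\<^sup>2 * (\<integral>x. (G x)\<^sup>2 \<partial>lborel)" .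
qed

section \<open>Exponentially weighted norms on [0, r]\<close>

definition L2loc :: "(real \<Rightarrow> real) \<Rightarrow> bool" where
  "L2loc f \<longleftrightarrow> L1loc f \<and> (\<forall>r. integrable lborel (\<lambda>x. (trunc r f x)\<^sup>2))"

text \<open>Multiplication by exp (- \<sigma> x) is a homomorphism for convolution. Young's
  inequality therefore holds in the weighted norms with the weighted L1 norm of the kernel, and a
  large \<sigma> makes that norm small.\<close>

definition wtrunc :: "real \<Rightarrow> real \<Rightarrow> (real \<Rightarrow> real) \<Rightarrow> real \<Rightarrow> real" where
  "wtrunc \<sigma> r f x = exp (- \<sigma> * x) * trunc r f x"

definition wsq :: "real \<Rightarrow> real \<Rightarrow> (real \<Rightarrow> real) \<Rightarrow> real" where
  "wsq \<sigma> r f = (\<integral>x. (wtrunc \<sigma> r f x)\<^sup>2 \<partial>lborel)"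

lemma L2loc_L1loc: "L2loc f \<Longrightarrow> L1loc f" by (simp add: L2loc_def)

lemma exp_weight_bound:
  assumes "\<And>x::real. x < 0 \<Longrightarrow> f x = (0::real)" "\<sigma> \<ge> 0"
  shows "\<bar>exp (- \<sigma> * x) * trunc r f x\<bar> \<le> \<bar>trunc r f x\<bar>"
proof (cases "x < 0")
  case False
  then have "exp (- \<sigma> * x) \<le> 1" using assms(2) by simp
  from mult_right_mono[OF this abs_ge_zero[of "trunc r f x"]] show ?thesis by (simp add: abs_mult)
qed (simp add: assms trunc_def)

lemma wtrunc_measurable[measurable]: "f \<in> borel_measurable borel \<Longrightarrow> wtrunc \<sigma> r f \<in> borel_measurable borel"
  unfolding wtrunc_def[abs_def] trunc_def[abs_def] by measurable

lemma wtrunc_integrable: "L1loc f \<Longrightarrow> \<sigma> \<ge> 0 \<Longrightarrow> integrable lborel (wtrunc \<sigma> r f)"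
proof -
  assume f: "L1loc f" and s: "\<sigma> \<ge> 0"
  note [measurable] = L1loc_measurable[OF f]
  show ?thesis
  proof (rule Bochner_Integration.integrable_bound[OF L1loc_trunc[OF f, of r]])
    show "AE x in lborel. norm (wtrunc \<sigma> r f x) \<le> norm (trunc r f x)"
      using exp_weight_bound[OF L1loc_neg[OF f] s] by (simp add: wtrunc_def)
  qed measurable
qed

lemma wtrunc_square_integrable: "L2loc f \<Longrightarrow> \<sigma> \<ge> 0 \<Longrightarrow> integrable lborel (\<lambda>x. (wtrunc \<sigma> r f x)\<^sup>2)"
proof -
  assume f: "L2loc f" and s: "\<sigma> \<ge> 0"
  note [measurable] = L1loc_measurable[OF L2loc_L1loc[OF f]]
  show ?thesis
  proof (rule Bochner_Integration.integrable_bound)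
    show "integrable lborel (\<lambda>x. (trunc r f x)\<^sup>2)" using f by (simp add: L2loc_def)
    show "AE x in lborel. norm ((wtrunc \<sigma> r f x)\<^sup>2) \<le> norm ((trunc r f x)\<^sup>2)"
      using exp_weight_bound[OF L1loc_neg[OF L2loc_L1loc[OF f]] s]
      by (auto simp: wtrunc_def abs_le_square_iff[symmetric])
  qed measurable
qed

lemma wtrunc_convl:
  assumes "L1loc f" "L1loc g" "x \<le> r"
  shows "convl (wtrunc \<sigma> r f) (wtrunc \<sigma> r g) x = wtrunc \<sigma> r (convl f g) x"
proof -
  have "convl (wtrunc \<sigma> r f) (wtrunc \<sigma> r g) x = (\<integral>y. exp (- \<sigma> * x) * (trunc r f (x - y) * trunc r g y) \<partial>lborel)"
    unfolding convl_def wtrunc_def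
  proof (rule Bochner_Integration.integral_cong, simp)
    fix y
    have "exp (- \<sigma> * x) = exp (- \<sigma> * (x - y)) * exp (- \<sigma> * y)" by (simp add: exp_add[symmetric] algebra_simps)
    then show "exp (- \<sigma> * (x - y)) * trunc r f (x - y) * (exp (- \<sigma> * y) * trunc r g y) = exp (- \<sigma> * x) * (trunc r f (x - y) * trunc r g y)"
      by simp
  qed
  also have "\<dots> = exp (- \<sigma> * x) * convl (trunc r f) (trunc r g) x" by (simp add: convl_def)
  also have "convl (trunc r f) (trunc r g) x = trunc r (convl f g) x"
    using convl_trunc(2)[of f g x r] assms L1loc_neg by (auto simp: trunc_def)
  finally show ?thesis by (simp only: wtrunc_def[of \<sigma> r "convl f g"])
qed

lemma trunc_measurable[measurable]: "f \<in> borel_measurable borel \<Longrightarrow> trunc r f \<in> borel_measurable borel"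
  unfolding trunc_def[abs_def] by measurable

lemma wtrunc0: "wtrunc 0 r f = trunc r f" by (auto simp: wtrunc_def)

lemma
  assumes f: "L1loc f" and g: "L2loc g" and s: "\<sigma> \<ge> 0"
  shows L2loc_convl: "L2loc (convl f g)"
    and wsq_convl: "wsq \<sigma> r (convl f g) \<le> (\<integral>x. \<bar>wtrunc \<sigma> r f x\<bar> \<partial>lborel)\<^sup>2 * wsq \<sigma> r g"
proof -
  note g' = L2loc_L1loc[OF g]
  note [measurable] = L1loc_measurable[OF f] L1loc_measurable[OF g']
  have y: "integrable lborel (\<lambda>x. (convl (wtrunc \<sigma> r f) (wtrunc \<sigma> r g) x)\<^sup>2)"
    "(\<integral>x. (convl (wtrunc \<sigma> r f) (wtrunc \<sigma> r g) x)\<^sup>2 \<partial>lborel) \<le> (\<integral>x. \<bar>wtrunc \<sigma> r f x\<bar> \<partial>lborel)\<^sup>2 * wsq \<sigma> r g"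
    if "\<sigma> \<ge> 0" for r \<sigma>
    using young_L2[OF wtrunc_integrable[OF f that, of r] wtrunc_square_integrable[OF g that, of r]] by (simp_all add: wsq_def)
  \<comment> \<open>Up to r the two sides agree; beyond r the left side is zero, whereas the
    convolution of the truncated factors need not be.\<close>
  have b: "(wtrunc \<sigma> r (convl f g) x)\<^sup>2 \<le> (convl (wtrunc \<sigma> r f) (wtrunc \<sigma> r g) x)\<^sup>2" for r x \<sigma>
    using wtrunc_convl[OF f g', of x r \<sigma>] by (cases "x \<le> r") (auto simp: wtrunc_def trunc_def)
  have i: "integrable lborel (\<lambda>x. (wtrunc \<sigma> r (convl f g) x)\<^sup>2)" if "\<sigma> \<ge> 0" for r \<sigma>
    by (rule Bochner_Integration.integrable_bound[OF y(1)[OF that]]) (use b in auto)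
  show "L2loc (convl f g)" unfolding L2loc_def using L1loc_convl[OF f g'] i[of 0] by (simp add: wtrunc0)
  show "wsq \<sigma> r (convl f g) \<le> (\<integral>x. \<bar>wtrunc \<sigma> r f x\<bar> \<partial>lborel)\<^sup>2 * wsq \<sigma> r g"
    unfolding wsq_def[of _ _ "convl f g"] using b y[OF s] i[OF s]
    by (intro order_trans[OF integral_mono y(2)[OF s]]) auto
qed

section \<open>Positivity of fractional integration\<close>

definition pos_powr :: "real \<Rightarrow> real \<Rightarrow> real" where
  "pos_powr a t = (if 0 < t then t powr a else 0)"

lemma pos_powr_measurable[measurable]: "pos_powr a \<in> borel_measurable borel"
  unfolding pos_powr_def[abs_def] by measurable

lemma pos_powr_nonneg: "0 \<le> pos_powr a t" by (simp add: pos_powr_def)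

text \<open>For s < t the substitution z = s - (t - s) x leaves C (t - s)^(\<alpha> - 1), where C is
  the integral of x^a (1 + x)^a over the positive half-line with a = \<alpha>/2 - 1. It converges at
  0 because a > -1 and at infinity because 2 a < -1. For s = t the integral diverges, which is why
  the diagonal is left out.\<close>

lemma square_root_kernel:
  assumes \<alpha>: "0 < \<alpha>" "\<alpha> < (1::real)"
  obtains C where "C > 0"
    "\<And>s t. s \<noteq> t \<Longrightarrow> integrable lborel (\<lambda>z. pos_powr (\<alpha>/2 - 1) (t - z) * pos_powr (\<alpha>/2 - 1) (s - z))"
    "\<And>s t. s \<noteq> t \<Longrightarrow> (\<integral>z. pos_powr (\<alpha>/2 - 1) (t - z) * pos_powr (\<alpha>/2 - 1) (s - z) \<partial>lborel) = C * \<bar>t - s\<bar> powr (\<alpha> - 1)"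
proof -
  define a where "a = \<alpha>/2 - 1"
  have a: "-1 < a" "a < 0" "2 * a < -1" "a + a < - 1" using \<alpha> by (auto simp: a_def)
  define f where "f x = pos_powr a x * pos_powr a (1 + x)" for x
  have [measurable]: "f \<in> borel_measurable borel" unfolding f_def[abs_def] by measurable
  have fnn: "0 \<le> f x" for x by (simp add: f_def pos_powr_nonneg)
  have i1: "integrable lborel (\<lambda>x. indicator {0..1} x * x powr a)"
    using nonneg_has_integral_lborel(1)[OF has_integral_powr_from_0[of a 1]] a by auto
  have i2: "integrable lborel (\<lambda>x. indicator {1..} x * x powr (2 * a))"
    using nonneg_has_integral_lborel(1)[OF has_integral_powr_to_inf[of "2*a" 1]] a by auto
  have i: "integrable lborel f"
  proof (rule Bochner_Integration.integrable_bound[OF Bochner_Integration.integrable_add[OF i1 i2]])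
    show "AE x in lborel. norm (f x) \<le> norm (indicator {0..1} x * x powr a + indicator {1..} x * x powr (2 * a))"
    proof (rule AE_I2)
      fix x :: real
      have "f x \<le> indicator {0..1} x * x powr a + indicator {1..} x * x powr (2 * a)"
      proof -
        consider "x \<le> 0" | "0 < x" "x \<le> 1" | "1 < x" by linarith
        then show ?thesis
        proof cases
          case 1 then show ?thesis by (auto simp: f_def pos_powr_def indicator_def)
        next
          case 2
          have "(1 + x) powr a \<le> 1" using 2 a powr_mono2'[of a 1 "1 + x"] by simp
          from mult_left_mono[OF this, of "x powr a"] have "f x \<le> x powr a" using 2 by (simp add: f_def pos_powr_def)
          then show ?thesis using 2 by (auto simp: indicator_def intro: order_trans)
        next
          case 3
          have "(1 + x) powr a \<le> x powr a" using 3 a by (intro powr_mono2') auto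
          from mult_left_mono[OF this, of "x powr a"] have "f x \<le> x powr a * x powr a" using 3 by (simp add: f_def pos_powr_def)
          then show ?thesis using 3 by (auto simp: indicator_def powr_add[symmetric])
        qed
      qed
      then show "norm (f x) \<le> norm (indicator {0..1} x * x powr a + indicator {1..} x * x powr (2 * a))"
        using fnn[of x] by simp
    qed
  qed measurable
  define C where "C = (\<integral>x. f x \<partial>lborel)"
  have "C > 0"
  proof -
    have "(\<integral>x. indicator {0<..1::real} x * (2 powr a) \<partial>lborel) \<le> C"
      unfolding C_def
    proof (rule Bochner_Integration.integral_mono)
      show "integrable lborel (\<lambda>x. indicator {0<..1::real} x * (2 powr a) :: real)"
        by (intro integrable_mult_left) simp
      show "integrable lborel f" by fact
      fix x :: real
      show "indicator {0<..1} x * (2 powr a) \<le> f x"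
      proof (cases "0 < x \<and> x \<le> 1")
        case True
        have "2 powr a \<le> (1 + x) powr a" using True a by (intro powr_mono2') auto
        also have "1 \<le> x powr a" using True a powr_mono2'[of a x 1] by auto
        from mult_right_mono[OF this, of "(1 + x) powr a"] have "(1 + x) powr a \<le> f x"
          using True by (simp add: f_def pos_powr_def)
        finally show ?thesis using True by simp
      qed (use fnn[of x] in \<open>auto simp: indicator_def\<close>)
    qed
    moreover have "(\<integral>x. indicator {0<..1::real} x * (2 powr a) \<partial>lborel) = 2 powr a" by simp
    moreover have "2 powr a > 0" by simp
    ultimately show ?thesis by linarith
  qed
  have *: "integrable lborel (\<lambda>z. pos_powr a (t - z) * pos_powr a (s - z)) \<and>
      (\<integral>z. pos_powr a (t - z) * pos_powr a (s - z) \<partial>lborel) = C * \<bar>t - s\<bar> powr (\<alpha> - 1)" if "s < t" for s t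
  proof -
    define d where "d = t - s"
    have d: "d > 0" using that by (simp add: d_def)
    have eq: "pos_powr a (t - (s + (-d) * x)) * pos_powr a (s - (s + (-d) * x)) = d powr (2 * a) * f x" for x
    proof -
      have 1: "t - (s + (-d) * x) = d * (1 + x)" "s - (s + (-d) * x) = d * x" by (simp_all add: d_def algebra_simps)
      have 2: "0 < d * (1 + x) \<longleftrightarrow> 0 < 1 + x" "0 < d * x \<longleftrightarrow> 0 < x" using d by (auto simp: zero_less_mult_iff)
      have "d powr (2 * a) = d powr a * d powr a" by (simp add: powr_add[symmetric])
      then show ?thesis unfolding 1 f_def pos_powr_def 2 using d by (auto simp: powr_mult)
    qed
    have "integrable lborel (\<lambda>x. pos_powr a (t - (s + (-d) * x)) * pos_powr a (s - (s + (-d) * x)))"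
      unfolding eq using i by simp
    then have 1: "integrable lborel (\<lambda>z. pos_powr a (t - z) * pos_powr a (s - z))"
      using lborel_integrable_real_affine_iff[of "-d" "\<lambda>z. pos_powr a (t - z) * pos_powr a (s - z)" s] d by simp
    have "(\<integral>z. pos_powr a (t - z) * pos_powr a (s - z) \<partial>lborel) = d * (\<integral>x. d powr (2 * a) * f x \<partial>lborel)"
      using lborel_integral_real_affine[of "-d" "\<lambda>z. pos_powr a (t - z) * pos_powr a (s - z)" s] d unfolding eq by simp
    also have "\<dots> = C * (d * d powr (2 * a))" by (simp add: C_def)
    also have "d * d powr (2 * a) = d powr (\<alpha> - 1)"
      using d by (simp add: powr_mult_base a_def)
    finally show ?thesis using 1 that by (simp add: d_def)
  qed
  have **: "integrable lborel (\<lambda>z. pos_powr a (t - z) * pos_powr a (s - z)) \<and>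
      (\<integral>z. pos_powr a (t - z) * pos_powr a (s - z) \<partial>lborel) = C * \<bar>t - s\<bar> powr (\<alpha> - 1)" if "s \<noteq> t" for s t
    using *[of s t] *[of t s] that by (cases "s < t") (auto simp: mult.commute abs_minus_commute)
  show ?thesis
    using that[OF \<open>C > 0\<close>] ** unfolding a_def by blast
qed

lemma mult_square_integrable:
  fixes f g :: "'a \<Rightarrow> real"
  assumes "integrable M (\<lambda>x. (f x)\<^sup>2)" "integrable M (\<lambda>x. (g x)\<^sup>2)"
    "f \<in> borel_measurable M" "g \<in> borel_measurable M"
  shows "integrable M (\<lambda>x. f x * g x)"
proof (rule Bochner_Integration.integrable_bound[OF Bochner_Integration.integrable_add[OF assms(1,2)]])
  have "\<bar>f x * g x\<bar> \<le> (f x)\<^sup>2 + (g x)\<^sup>2" for x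
  proof -
    have "0 \<le> \<bar>f x\<bar> * \<bar>g x\<bar>" by simp
    then show ?thesis
      using sum_squares_bound[of "\<bar>f x\<bar>" "\<bar>g x\<bar>"] unfolding abs_mult power2_abs by linarith
  qed
  then show "AE x in M. norm (f x * g x) \<le> norm ((f x)\<^sup>2 + (g x)\<^sup>2)" by (auto intro!: AE_I2)
qed (use assms(3,4) in measurable)

lemma integrable_tensor:
  fixes f g :: "real \<Rightarrow> real"
  assumes f: "integrable lborel f" and g: "integrable lborel g"
  shows "integrable (lborel \<Otimes>\<^sub>M lborel) (\<lambda>(x, y). f x * g y)"
proof (rule lborel_pair.Fubini_integrable)
  have [measurable]: "f \<in> borel_measurable borel" "g \<in> borel_measurable borel" using f g by auto
  show "(\<lambda>(x, y). f x * g y) \<in> borel_measurable (lborel \<Otimes>\<^sub>M lborel)" by measurable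
qed (use f g in \<open>simp_all add: abs_mult integrable_abs\<close>)

text \<open>Symmetrised in (t, s), the form has a multiple of |t - s|^(\<alpha> - 1) as its kernel,
  and \<open>square_root_kernel\<close> rewrites it as an integral over z of squares. Fubini applies
  because the factors in z are nonnegative: integrating |\<open>N\<close>| over z reproduces a
  multiple of the absolute value of the symmetrised integrand.\<close>

lemma rl_ker_positive:
  assumes \<alpha>: "0 < \<alpha>" "\<alpha> < 1" and U: "L2loc U"
  shows "integrable lborel (\<lambda>x. trunc r U x * convl (rl_ker \<alpha>) U x)"
    and "0 \<le> (\<integral>x. trunc r U x * convl (rl_ker \<alpha>) U x \<partial>lborel)"
proof -
  define V where "V = trunc r U"
  define \<kappa> where "\<kappa> = trunc r (rl_ker \<alpha>)"
  note Ul = L2loc_L1loc[OF U]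
  have [measurable]: "U \<in> borel_measurable borel" "V \<in> borel_measurable borel" "\<kappa> \<in> borel_measurable borel"
    using L1loc_measurable[OF Ul] by (auto simp: V_def \<kappa>_def)
  have V2: "integrable lborel (\<lambda>x. (V x)\<^sup>2)" using U by (simp add: L2loc_def V_def)
  have V1: "integrable lborel V" using L1loc_trunc[OF Ul] by (simp add: V_def)
  have Vz: "V x = 0" if "x < 0 \<or> r < x" for x using that L1loc_neg[OF Ul] by (auto simp: V_def trunc_def)
  have k: "integrable lborel \<kappa>" using L1loc_trunc[OF L1loc_rl_ker] \<alpha> by (simp add: \<kappa>_def)
  have knn: "\<kappa> x \<ge> 0" for x using rl_ker_nonneg[of \<alpha> x] \<alpha> by (simp add: \<kappa>_def trunc_def)
  have eq: "trunc r U x * convl (rl_ker \<alpha>) U x = V x * convl \<kappa> V x" for x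
    using convl_trunc(2)[of "rl_ker \<alpha>" U x r] L1loc_neg[OF Ul] by (cases "x \<le> r") (auto simp: V_def \<kappa>_def trunc_def rl_ker_def)
  have V2': "integrable lborel (\<lambda>x. (\<bar>V x\<bar>)\<^sup>2)" using V2 by simp
  note Y = young_L2[OF k V2'] and Y' = young_L2[OF k V2]
  show "integrable lborel (\<lambda>x. trunc r U x * convl (rl_ker \<alpha>) U x)"
    unfolding eq by (rule mult_square_integrable[OF V2 Y'(1)]) measurable
  define P where "P = (\<lambda>(t, s). V t * (\<kappa> (t - s) * V s))"
  have [measurable]: "P \<in> borel_measurable (lborel \<Otimes>\<^sub>M lborel)" unfolding P_def by measurable
  have P: "integrable (lborel \<Otimes>\<^sub>M lborel) P"
  proof (rule lborel_pair.Fubini_integrable)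
    have "(\<integral>s. norm (P (t, s)) \<partial>lborel) = \<bar>V t\<bar> * convl \<kappa> (\<lambda>x. \<bar>V x\<bar>) t" for t
      by (simp add: P_def abs_mult knn convl_def)
    moreover have "integrable lborel (\<lambda>t. \<bar>V t\<bar> * convl \<kappa> (\<lambda>x. \<bar>V x\<bar>) t)"
      by (rule mult_square_integrable[OF V2' Y(1)]) measurable
    ultimately show "integrable lborel (\<lambda>t. \<integral>s. norm (P (t, s)) \<partial>lborel)" by simp
    show "AE t in lborel. integrable lborel (\<lambda>s. P (t, s))"
      using Y'(3) by (rule eventually_mono) (auto simp: P_def)
  qed measurable
  have P': "integrable (lborel \<Otimes>\<^sub>M lborel) (\<lambda>(t, s). P (s, t))"
    using lborel_pair.integrable_product_swap[OF P] .
  have PP': "(\<integral>(t, s). P (s, t) \<partial>(lborel \<Otimes>\<^sub>M lborel)) = integral\<^sup>L (lborel \<Otimes>\<^sub>M lborel) P"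
    by (rule lborel_pair.integral_product_swap) measurable
  have Pint: "integral\<^sup>L (lborel \<Otimes>\<^sub>M lborel) P = (\<integral>x. trunc r U x * convl (rl_ker \<alpha>) U x \<partial>lborel)"
    using lborel_pair.integral_fst'[OF P] unfolding eq by (simp add: P_def convl_def)
  obtain C where C: "C > 0"
    "\<And>s t. s \<noteq> t \<Longrightarrow> integrable lborel (\<lambda>z. pos_powr (\<alpha>/2 - 1) (t - z) * pos_powr (\<alpha>/2 - 1) (s - z))"
    "\<And>s t. s \<noteq> t \<Longrightarrow> (\<integral>z. pos_powr (\<alpha>/2 - 1) (t - z) * pos_powr (\<alpha>/2 - 1) (s - z) \<partial>lborel) = C * \<bar>t - s\<bar> powr (\<alpha> - 1)"
    using square_root_kernel[OF \<alpha>] by blast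
  define \<phi> where "\<phi> z t = V t * pos_powr (\<alpha>/2 - 1) (t - z)" for z t
  define N where "N = (\<lambda>(p, z). \<phi> z (fst p) * \<phi> z (snd p))"
  have [measurable]: "(\<lambda>(z, t). \<phi> z t) \<in> borel_measurable (borel \<Otimes>\<^sub>M borel)"
    unfolding \<phi>_def by measurable
  have LL: "sigma_finite_measure (lborel \<Otimes>\<^sub>M lborel :: (real \<times> real) measure)"
    by (rule sigma_finite_pair_measure; rule lborel.sigma_finite_measure_axioms)
  interpret LL: sigma_finite_measure "lborel \<Otimes>\<^sub>M lborel :: (real \<times> real) measure" by (rule LL)
  interpret Q: pair_sigma_finite "lborel \<Otimes>\<^sub>M lborel :: (real \<times> real) measure" "lborel :: real measure" ..
  have [measurable]: "N \<in> borel_measurable ((lborel \<Otimes>\<^sub>M lborel) \<Otimes>\<^sub>M lborel)"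
    unfolding N_def \<phi>_def by measurable
  \<comment> \<open>The diagonal, excluded in \<open>square_root_kernel\<close>, is a null set of
    the plane.\<close>
  have ne: "AE p in lborel \<Otimes>\<^sub>M lborel. fst p \<noteq> (snd p :: real)"
  proof (rule lborel_pair.AE_pair_measure)
    show "{x \<in> space (lborel \<Otimes>\<^sub>M lborel). fst x \<noteq> (snd x :: real)} \<in> sets (lborel \<Otimes>\<^sub>M lborel)" by measurable
    show "AE x in lborel. AE y in lborel. fst (x, y) \<noteq> (snd (x, y) :: real)"
      using AE_lborel_singleton by (auto simp: eq_commute)
  qed
  let ?G = "C * Gamma \<alpha>"
  have G: "Gamma \<alpha> > 0" using \<alpha> by (simp add: Gamma_real_pos)
  \<comment> \<open>\<open>\<kappa>\<close> is one-sided: off the diagonal only one of \<kappa> (t -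
    s) and \<kappa> (s - t) is nonzero, and their sum is the symmetric kernel.\<close>
  have sumP: "V t * V s * (C * \<bar>t - s\<bar> powr (\<alpha> - 1)) = ?G * (P (t, s) + P (s, t))" if "s \<noteq> t" for s t
  proof (cases "(t < 0 \<or> r < t) \<or> (s < 0 \<or> r < s)")
    case True then show ?thesis using Vz[of t] Vz[of s] by (auto simp: P_def)
  next
    case False
    then have "\<kappa> (t - s) + \<kappa> (s - t) = \<bar>t - s\<bar> powr (\<alpha> - 1) / Gamma \<alpha>"
      using that by (cases "s < t") (auto simp: \<kappa>_def trunc_def rl_ker_def)
    then have "\<bar>t - s\<bar> powr (\<alpha> - 1) = Gamma \<alpha> * (\<kappa> (t - s) + \<kappa> (s - t))" using G by simp
    then show ?thesis by (simp add: P_def algebra_simps)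
  qed
  have Nz: "integrable lborel (\<lambda>z. N ((t, s), z)) \<and> (\<integral>z. N ((t, s), z) \<partial>lborel) = ?G * (P (t, s) + P (s, t))
      \<and> (\<integral>z. norm (N ((t, s), z)) \<partial>lborel) = ?G * \<bar>P (t, s) + P (s, t)\<bar>" if "s \<noteq> t" for s t
  proof -
    have Neq: "(\<lambda>z. N ((t, s), z)) = (\<lambda>z. V t * V s * (pos_powr (\<alpha>/2 - 1) (t - z) * pos_powr (\<alpha>/2 - 1) (s - z)))"
      by (auto simp: N_def \<phi>_def fun_eq_iff)
    have Neq': "(\<lambda>z. norm (N ((t, s), z))) = (\<lambda>z. \<bar>V t * V s\<bar> * (pos_powr (\<alpha>/2 - 1) (t - z) * pos_powr (\<alpha>/2 - 1) (s - z)))"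
      by (auto simp: N_def \<phi>_def fun_eq_iff abs_mult pos_powr_nonneg)
    have "(\<integral>z. norm (N ((t, s), z)) \<partial>lborel) = \<bar>V t * V s * (C * \<bar>t - s\<bar> powr (\<alpha> - 1))\<bar>"
      unfolding Neq' integral_mult_right_zero C(3)[OF that] using C(1) by (simp add: abs_mult)
    also have "\<dots> = ?G * \<bar>P (t, s) + P (s, t)\<bar>"
      unfolding sumP[OF that] using C(1) G by (simp add: abs_mult)
    finally have 1: "(\<integral>z. norm (N ((t, s), z)) \<partial>lborel) = ?G * \<bar>P (t, s) + P (s, t)\<bar>" .
    have 2: "integrable lborel (\<lambda>z. N ((t, s), z))"
      unfolding Neq using C(2)[OF that] by (rule Bochner_Integration.integrable_mult_right)
    have "(\<integral>z. N ((t, s), z) \<partial>lborel) = V t * V s * (C * \<bar>t - s\<bar> powr (\<alpha> - 1))"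
      unfolding Neq integral_mult_right_zero C(3)[OF that] ..
    with 1 2 show ?thesis unfolding sumP[OF that] by blast
  qed
  have Ps: "integrable (lborel \<Otimes>\<^sub>M lborel) (\<lambda>p. P p + (case p of (t, s) \<Rightarrow> P (s, t)))"
    by (rule Bochner_Integration.integrable_add[OF P P'])
  have Nint: "integrable ((lborel \<Otimes>\<^sub>M lborel) \<Otimes>\<^sub>M lborel) N"
  proof (rule Q.Fubini_integrable)
    have "AE p in lborel \<Otimes>\<^sub>M lborel. (\<integral>z. norm (N (p, z)) \<partial>lborel) = ?G * \<bar>P p + (case p of (t, s) \<Rightarrow> P (s, t))\<bar>"
      using ne
    proof eventually_elim
      case (elim p)
      obtain t s where p: "p = (t, s)" by (cases p)
      show ?case using elim Nz[of s t] by (simp add: p)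
    qed
    moreover have "integrable (lborel \<Otimes>\<^sub>M lborel) (\<lambda>p. ?G * \<bar>P p + (case p of (t, s) \<Rightarrow> P (s, t))\<bar>)"
      using Ps by (intro Bochner_Integration.integrable_mult_right integrable_abs)
    ultimately show "integrable (lborel \<Otimes>\<^sub>M lborel) (\<lambda>p. \<integral>z. norm (N (p, z)) \<partial>lborel)"
      by (subst integrable_cong_AE) auto
    show "AE p in lborel \<Otimes>\<^sub>M lborel. integrable lborel (\<lambda>z. N (p, z))"
      using ne by eventually_elim (auto simp: Nz)
  qed measurable
  have "integral\<^sup>L ((lborel \<Otimes>\<^sub>M lborel) \<Otimes>\<^sub>M lborel) N = (\<integral>p. (\<integral>z. N (p, z) \<partial>lborel) \<partial>(lborel \<Otimes>\<^sub>M lborel))"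
    by (rule Q.integral_fst'[OF Nint, symmetric])
  also have "\<dots> = (\<integral>p. ?G * (P p + (case p of (t, s) \<Rightarrow> P (s, t))) \<partial>(lborel \<Otimes>\<^sub>M lborel))"
    using ne by (intro integral_cong_AE) (auto simp: Nz elim!: eventually_mono)
  also have "\<dots> = ?G * (2 * (\<integral>x. trunc r U x * convl (rl_ker \<alpha>) U x \<partial>lborel))"
    using Bochner_Integration.integral_add[OF P P'] PP' Pint by simp
  finally have main: "integral\<^sup>L ((lborel \<Otimes>\<^sub>M lborel) \<Otimes>\<^sub>M lborel) N = ?G * (2 * (\<integral>x. trunc r U x * convl (rl_ker \<alpha>) U x \<partial>lborel))" .
  have "integral\<^sup>L ((lborel \<Otimes>\<^sub>M lborel) \<Otimes>\<^sub>M lborel) N = (\<integral>z. (\<integral>p. N (p, z) \<partial>(lborel \<Otimes>\<^sub>M lborel)) \<partial>lborel)"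
    using Q.integral_snd[of "\<lambda>p z. N (p, z)"] Nint by simp
  also have "\<dots> \<ge> 0"
  proof (rule Bochner_Integration.integral_nonneg)
    fix z
    show "0 \<le> (\<integral>p. N (p, z) \<partial>(lborel \<Otimes>\<^sub>M lborel))"
    \<comment> \<open>For z at which the section is not integrable the Bochner integral is 0 by
      convention, so the sign is right for every z.\<close>
    proof (cases "integrable (lborel \<Otimes>\<^sub>M lborel) (\<lambda>p. N (p, z))")
      case True
      have "(\<integral>p. N (p, z) \<partial>(lborel \<Otimes>\<^sub>M lborel)) = (\<integral>t. (\<integral>s. \<phi> z t * \<phi> z s \<partial>lborel) \<partial>lborel)"
        using lborel_pair.integral_fst'[OF True] by (simp add: N_def)
      also have "\<dots> = (\<integral>t. \<phi> z t \<partial>lborel)\<^sup>2" by (simp add: power2_eq_square)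
      finally show ?thesis by simp
    qed (simp add: not_integrable_integral_eq)
  qed
  finally show "0 \<le> (\<integral>x. trunc r U x * convl (rl_ker \<alpha>) U x \<partial>lborel)"
    unfolding main using mult_pos_pos[OF C(1) G] by (simp add: zero_le_mult_iff)
qed

text \<open>On [0, r] the weight is a positive mixture of cut-offs: exp (- 2 \<sigma> x) equals exp
  (- 2 \<sigma> r) plus the integral of 2 \<sigma> exp (- 2 \<sigma> \<rho>) over \<rho> in [x, r].
  After Fubini the weighted form is a positive combination of the unweighted forms truncated at
  \<rho> \<le> r, each of which is nonnegative.\<close>

lemma rl_ker_positive_weighted:
  assumes \<alpha>: "0 < \<alpha>" "\<alpha> < 1" and U: "L2loc U" and s: "\<sigma> \<ge> 0"
  shows "integrable lborel (\<lambda>x. exp (- 2 * \<sigma> * x) * (trunc r U x * convl (rl_ker \<alpha>) U x))" (is ?I)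
    and "0 \<le> (\<integral>x. exp (- 2 * \<sigma> * x) * (trunc r U x * convl (rl_ker \<alpha>) U x) \<partial>lborel)"
proof -
  define h where "h x = trunc r U x * convl (rl_ker \<alpha>) U x" for x
  note Ul = L2loc_L1loc[OF U]
  have [measurable]: "U \<in> borel_measurable borel" using L1loc_measurable[OF Ul] .
  have h: "integrable lborel h" unfolding h_def[abs_def] by (rule rl_ker_positive[OF \<alpha> U])
  have [measurable]: "h \<in> borel_measurable borel" using h by auto
  have hz: "h x = 0" if "x < 0 \<or> r < x" for x using that L1loc_neg[OF Ul] by (auto simp: h_def trunc_def)
  have "integrable lborel (\<lambda>x. exp (- 2 * \<sigma> * x) * h x)"
  proof (rule Bochner_Integration.integrable_bound[OF h])
    have "exp (- 2 * \<sigma> * x) * \<bar>h x\<bar> \<le> \<bar>h x\<bar>" for x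
    proof (cases "x < 0")
      case False
      then have "exp (- 2 * \<sigma> * x) \<le> 1" using s by simp
      from mult_right_mono[OF this abs_ge_zero[of "h x"]] show ?thesis by simp
    qed (simp add: hz)
    then show "AE x in lborel. norm (exp (- 2 * \<sigma> * x) * h x) \<le> norm (h x)" by (simp add: abs_mult)
  qed measurable
  then show ?I by (simp add: h_def)
  define w where "w \<rho> = indicator {0..r} \<rho> *\<^sub>R (2 * \<sigma> * exp (- 2 * \<sigma> * \<rho>))" for \<rho>
  have w: "integrable lborel w"
  proof -
    have "set_integrable lborel {0..r} (\<lambda>\<rho>. 2 * \<sigma> * exp (- 2 * \<sigma> * \<rho>))"
      by (intro borel_integrable_atLeastAtMost' continuous_intros)
    then show ?thesis by (simp add: set_integrable_def w_def[abs_def])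
  qed
  have [measurable]: "w \<in> borel_measurable borel" using w by auto
  have wnn: "w \<rho> \<ge> 0" for \<rho> using s by (simp add: w_def)
  have K0: "integrable (lborel \<Otimes>\<^sub>M lborel) (\<lambda>(x, \<rho>). h x * w \<rho>)"
    by (rule integrable_tensor[OF h w])
  have K: "integrable (lborel \<Otimes>\<^sub>M lborel) (\<lambda>(x, \<rho>). indicator {..\<rho>} x * (h x * w \<rho>))"
    by (rule Bochner_Integration.integrable_bound[OF K0]) (auto simp: indicator_def)
  have inner: "(\<integral>\<rho>. indicator {..\<rho>} x * (h x * w \<rho>) \<partial>lborel) = (exp (- 2 * \<sigma> * x) - exp (- 2 * \<sigma> * r)) * h x" for x
  proof (cases "x < 0 \<or> r < x")
    case False
    have "(\<lambda>\<rho>. indicator {..\<rho>} x * (h x * w \<rho>)) = (\<lambda>\<rho>. h x * (indicator {x..r} \<rho> *\<^sub>R (2 * \<sigma> * exp (- 2 * \<sigma> * \<rho>))))"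
      using False by (auto simp: indicator_def w_def fun_eq_iff)
    moreover have "(\<integral>\<rho>. indicator {x..r} \<rho> *\<^sub>R (2 * \<sigma> * exp (- 2 * \<sigma> * \<rho>)) \<partial>lborel) = - exp (- 2 * \<sigma> * r) - (- exp (- 2 * \<sigma> * x))"
      using False
      by (intro integral_FTC_atLeastAtMost)
        (auto intro!: continuous_intros derivative_eq_intros simp flip: has_real_derivative_iff_has_vector_derivative)
    ultimately show ?thesis by simp
  qed (simp add: hz)
  have "0 \<le> (\<integral>\<rho>. (\<integral>x. indicator {..\<rho>} x * (h x * w \<rho>) \<partial>lborel) \<partial>lborel)"
  proof (rule Bochner_Integration.integral_nonneg)
    fix \<rho>
    show "0 \<le> (\<integral>x. indicator {..\<rho>} x * (h x * w \<rho>) \<partial>lborel)"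
    proof (cases "\<rho> \<le> r")
      case True
      have "(\<lambda>x. indicator {..\<rho>} x * (h x * w \<rho>)) = (\<lambda>x. w \<rho> * (trunc \<rho> U x * convl (rl_ker \<alpha>) U x))"
        using True by (auto simp: h_def trunc_def indicator_def)
      then show ?thesis using wnn[of \<rho>] rl_ker_positive(2)[OF \<alpha> U, of \<rho>] by simp
    qed (simp add: w_def)
  qed
  also have "\<dots> = (\<integral>x. (\<integral>\<rho>. indicator {..\<rho>} x * (h x * w \<rho>) \<partial>lborel) \<partial>lborel)"
    by (rule lborel_pair.Fubini_integral[OF K])
  also have "\<dots> = (\<integral>x. exp (- 2 * \<sigma> * x) * h x - exp (- 2 * \<sigma> * r) * h x \<partial>lborel)"
    unfolding inner by (simp add: algebra_simps)
  also have "\<dots> = (\<integral>x. exp (- 2 * \<sigma> * x) * h x \<partial>lborel) - exp (- 2 * \<sigma> * r) * (\<integral>x. h x \<partial>lborel)"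
    using \<open>integrable lborel (\<lambda>x. exp (- 2 * \<sigma> * x) * h x)\<close> h by simp
  finally have "exp (- 2 * \<sigma> * r) * (\<integral>x. h x \<partial>lborel) \<le> (\<integral>x. exp (- 2 * \<sigma> * x) * h x \<partial>lborel)" by simp
  moreover have "0 \<le> exp (- 2 * \<sigma> * r) * (\<integral>x. h x \<partial>lborel)"
    using rl_ker_positive(2)[OF \<alpha> U, of r] by (simp add: h_def[abs_def])
  ultimately show "0 \<le> (\<integral>x. exp (- 2 * \<sigma> * x) * (trunc r U x * convl (rl_ker \<alpha>) U x) \<partial>lborel)"
    by (simp add: h_def)
qed

text \<open>Multiply the equation by exp (- 2 \<sigma> x) w and integrate up to r. The term with
  \<open>lam\<close> is nonnegative and is dropped, and w h \<le> (w^2 + h^2)/2 is absorbed on the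
  left. Hence no constant depends on \<open>lam\<close>.\<close>

lemma energy:
  assumes \<alpha>: "0 < \<alpha>" "\<alpha> < 1" and w: "L2loc w" and h: "L2loc h" and l: "lam \<ge> 0" and s: "\<sigma> \<ge> 0"
    and eq: "cls w + lam *\<^sub>R (cls (rl_ker \<alpha>) * cls w) = cls h"
  shows "wsq \<sigma> r w \<le> wsq \<sigma> r h"
proof -
  note wl = L2loc_L1loc[OF w] and hl = L2loc_L1loc[OF h]
  note [measurable] = L1loc_measurable[OF wl] L1loc_measurable[OF hl]
  note lb = L1loc_rl_ker[OF \<alpha>(1)]
  let ?e = "\<lambda>x. exp (- 2 * \<sigma> * x) * (trunc r w x * convl (rl_ker \<alpha>) w x)"
  note pos = rl_ker_positive_weighted[OF \<alpha> w s, of r]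
  have "AE x in lborel. w x + lam * convl (rl_ker \<alpha>) w x = h x"
    using eq wl hl lb by (simp add: cls_mult cls_scaleR cls_add cls_eq L1loc_convl L1loc_scale L1loc_add)
  then have ae: "AE x in lborel. (wtrunc \<sigma> r w x)\<^sup>2 + lam * ?e x = wtrunc \<sigma> r w x * wtrunc \<sigma> r h x"
  proof eventually_elim
    case (elim x)
    have e: "exp (- 2 * \<sigma> * x) = exp (- \<sigma> * x) * exp (- \<sigma> * x)" by (simp add: exp_add[symmetric])
    show ?case
    proof (cases "x \<le> r")
      case True
      then show ?thesis
        unfolding e elim[symmetric] wtrunc_def trunc_eq[OF True] by (simp add: power2_eq_square algebra_simps)
    qed (simp add: wtrunc_def trunc_def)
  qed
  note i = wtrunc_square_integrable[OF w s, of r] wtrunc_square_integrable[OF h s, of r]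
  have ip: "integrable lborel (\<lambda>x. wtrunc \<sigma> r w x * wtrunc \<sigma> r h x)"
    by (rule mult_square_integrable[OF i]) measurable
  have "wsq \<sigma> r w \<le> wsq \<sigma> r w + lam * (\<integral>x. ?e x \<partial>lborel)"
    using l pos(2) by simp
  also have "\<dots> = (\<integral>x. (wtrunc \<sigma> r w x)\<^sup>2 + lam * ?e x \<partial>lborel)"
    using i pos(1) by (simp add: wsq_def)
  also have "\<dots> = (\<integral>x. wtrunc \<sigma> r w x * wtrunc \<sigma> r h x \<partial>lborel)"
    by (rule integral_cong_AE) (use ae in auto)
  also have "\<dots> \<le> (\<integral>x. 1/2 * (wtrunc \<sigma> r w x)\<^sup>2 + 1/2 * (wtrunc \<sigma> r h x)\<^sup>2 \<partial>lborel)"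
  proof (rule integral_mono[OF ip])
    show "integrable lborel (\<lambda>x. 1/2 * (wtrunc \<sigma> r w x)\<^sup>2 + 1/2 * (wtrunc \<sigma> r h x)\<^sup>2)" using i by simp
    show "wtrunc \<sigma> r w x * wtrunc \<sigma> r h x \<le> 1/2 * (wtrunc \<sigma> r w x)\<^sup>2 + 1/2 * (wtrunc \<sigma> r h x)\<^sup>2" for x
      using sum_squares_bound[of "wtrunc \<sigma> r w x" "wtrunc \<sigma> r h x"] by simp
  qed
  also have "\<dots> = 1/2 * wsq \<sigma> r w + 1/2 * wsq \<sigma> r h"
    using i by (simp add: wsq_def)
  finally show ?thesis by simp
qed

section \<open>Resolvents\<close>

text \<open>The functions whose Laplace transform converges absolutely somewhere. Raising the weight
  pushes the norm of any such kernel below 1, so the Neumann series is available for kernels of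
  every size.\<close>

definition exp_integrable :: "(real \<Rightarrow> real) \<Rightarrow> bool" where
  "exp_integrable f \<longleftrightarrow> L1loc f \<and> (\<exists>\<sigma>\<ge>0. integrable lborel (\<lambda>x. exp (- \<sigma> * x) * f x))"

lemma exp_shift_bound:
  assumes f: "L1loc f" and i: "integrable lborel (\<lambda>x. exp (- \<sigma>0 * x) * f x)" and s: "\<sigma>0 \<le> \<sigma>"
  shows "\<bar>exp (- \<sigma> * x) * f x\<bar> \<le> \<bar>exp (- \<sigma>0 * x) * f x\<bar>"
proof (cases "x < 0")
  case False
  then have "exp (- \<sigma> * x) \<le> exp (- \<sigma>0 * x)" using s by (simp add: mult_right_mono)
  from mult_right_mono[OF this abs_ge_zero[of "f x"]] show ?thesis by (simp add: abs_mult)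
qed (simp add: L1loc_neg[OF f])

lemma exp_integrable_mono:
  assumes f: "L1loc f" and i: "integrable lborel (\<lambda>x. exp (- \<sigma>0 * x) * f x)" and s: "\<sigma>0 \<le> \<sigma>"
  shows "integrable lborel (\<lambda>x. exp (- \<sigma> * x) * f x)"
proof (rule Bochner_Integration.integrable_bound[OF i])
  note [measurable] = L1loc_measurable[OF f]
  show "(\<lambda>x. exp (- \<sigma> * x) * f x) \<in> borel_measurable lborel" by measurable
qed (use exp_shift_bound[OF assms] in auto)

text \<open>Dominated convergence as the weight grows: the integrand tends to 0 at every x >
  0.\<close>

lemma exp_integral_small:
  assumes f: "L1loc f" and i: "integrable lborel (\<lambda>x. exp (- \<sigma>0 * x) * f x)" and e: "e > 0"
  shows "\<exists>\<sigma>\<ge>\<sigma>0. \<sigma> \<ge> 0 \<and> (\<integral>x. \<bar>exp (- \<sigma> * x) * f x\<bar> \<partial>lborel) < e"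
proof -
  note [measurable] = L1loc_measurable[OF f]
  define s where "s n = \<bar>\<sigma>0\<bar> + real n" for n
  have "(\<lambda>n. \<integral>x. \<bar>exp (- s n * x) * f x\<bar> \<partial>lborel) \<longlonglongrightarrow> (\<integral>x. 0 \<partial>(lborel :: real measure))"
  proof (rule integral_dominated_convergence)
    show "integrable lborel (\<lambda>x. \<bar>exp (- \<sigma>0 * x) * f x\<bar>)" using i by (rule integrable_abs)
    show "AE x in lborel. norm \<bar>exp (- s n * x) * f x\<bar> \<le> \<bar>exp (- \<sigma>0 * x) * f x\<bar>" for n
      using exp_shift_bound[OF f i, of "s n"] by (simp add: s_def)
    show "AE x in lborel. (\<lambda>n. \<bar>exp (- s n * x) * f x\<bar>) \<longlonglongrightarrow> 0"
      using AE_lborel_singleton[of 0]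
    proof eventually_elim
      case (elim x)
      show ?case
      proof (cases "x < 0")
        case False
        with elim have x: "x > 0" by simp
        have eq: "\<bar>exp (- s n * x) * f x\<bar> = \<bar>f x\<bar> * exp (- \<bar>\<sigma>0\<bar> * x) * exp (- x) ^ n" for n
          by (simp add: s_def abs_mult exp_of_nat_mult[symmetric] exp_add[symmetric] algebra_simps)
        have "(\<lambda>n. \<bar>f x\<bar> * exp (- \<bar>\<sigma>0\<bar> * x) * exp (- x) ^ n) \<longlonglongrightarrow> \<bar>f x\<bar> * exp (- \<bar>\<sigma>0\<bar> * x) * 0"
          using x by (intro tendsto_intros LIMSEQ_power_zero) auto
        then show ?thesis unfolding eq by simp
      qed (simp add: L1loc_neg[OF f])
    qed
  qed measurable
  then have "eventually (\<lambda>n. (\<integral>x. \<bar>exp (- s n * x) * f x\<bar> \<partial>lborel) < e) sequentially"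
    using e by (auto intro: order_tendstoD(2))
  then obtain n where "(\<integral>x. \<bar>exp (- s n * x) * f x\<bar> \<partial>lborel) < e"
    by (auto simp: eventually_sequentially)
  then show ?thesis by (intro exI[of _ "s n"]) (auto simp: s_def)
qed

lemma convl_exp: "convl (\<lambda>x. exp (- \<sigma> * x) * f x) (\<lambda>x. exp (- \<sigma> * x) * g x) x = exp (- \<sigma> * x) * convl f g x"
proof -
  have "exp (- \<sigma> * (x - y)) * f (x - y) * (exp (- \<sigma> * y) * g y) = exp (- \<sigma> * x) * (f (x - y) * g y)" for y
  proof -
    have "exp (- \<sigma> * x) = exp (- \<sigma> * (x - y)) * exp (- \<sigma> * y)" by (simp add: exp_add[symmetric] algebra_simps)
    then show ?thesis by simp
  qed
  then show ?thesis unfolding convl_def by (simp only: integral_mult_right_zero)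
qed

lemma integrable_imp_L1loc:
  assumes "integrable lborel f" "\<And>x. x < 0 \<Longrightarrow> f x = 0"
  shows "L1loc f"
  unfolding L1loc_def
proof safe
  fix r show "integrable lborel (trunc r f)"
    using integrable_mult_indicator[OF _ assms(1), of "{..r}"] by (simp add: trunc_def[abs_def])
qed (use assms in auto)

text \<open>The Neumann series: \<open>K n\<close> is (-1)^n times the (n + 1)-fold convolution
  power of \<kappa>, of L1 norm at most q^(n + 1), so the sum converges absolutely almost everywhere
  and is integrable.\<close>

lemma resolvent_small:
  assumes k: "integrable lborel \<kappa>" "\<And>x. x < 0 \<Longrightarrow> \<kappa> x = 0" and q: "(\<integral>x. \<bar>\<kappa> x\<bar> \<partial>lborel) < 1"
  obtains \<rho> where "integrable lborel \<rho>" "\<And>x. x < 0 \<Longrightarrow> \<rho> x = 0" "AE x in lborel. \<rho> x + convl \<kappa> \<rho> x = \<kappa> x"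
proof -
  define q where "q = (\<integral>x. \<bar>\<kappa> x\<bar> \<partial>lborel)"
  have q01: "0 \<le> q" "q < 1" using assms by (auto simp: q_def)
  define K where "K n = ((\<lambda>f x. - convl \<kappa> f x) ^^ n) \<kappa>" for n
  have K0: "K 0 = \<kappa>" and KS: "K (Suc n) = (\<lambda>x. - convl \<kappa> (K n) x)" for n by (simp_all add: K_def)
  have Ki: "integrable lborel (K n)" for n
    by (induction n) (use k in \<open>auto simp: K0 KS intro!: convl_integrable\<close>)
  have [measurable]: "K n \<in> borel_measurable borel" for n using Ki[of n] by auto
  have [measurable]: "\<kappa> \<in> borel_measurable borel" using k by auto
  have Kneg: "K n x = 0" if "x < 0" for n x
    using that by (induction n arbitrary: x) (auto simp: K0 KS k intro!: convl_neg)
  have Kn: "(\<integral>x. \<bar>K n x\<bar> \<partial>lborel) \<le> q ^ Suc n" for n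
  proof (induction n)
    case 0 then show ?case by (simp add: K0 q_def)
  next
    case (Suc n)
    have "(\<integral>x. \<bar>K (Suc n) x\<bar> \<partial>lborel) \<le> (\<integral>x. convl (\<lambda>x. \<bar>\<kappa> x\<bar>) (\<lambda>x. \<bar>K n x\<bar>) x \<partial>lborel)"
      using Ki[of "Suc n"] convl_abs_le k Ki by (intro integral_mono) (auto simp: KS intro!: convl_integrable)
    also have "\<dots> = q * (\<integral>x. \<bar>K n x\<bar> \<partial>lborel)"
      unfolding q_def using k Ki by (intro convl_integral) auto
    also have "\<dots> \<le> q * q ^ Suc n" using Suc q01 by (intro mult_left_mono)
    finally show ?case by simp
  qed
  have sumK: "summable (\<lambda>n. \<integral>x. \<bar>K n x\<bar> \<partial>lborel)"
  proof (rule summable_comparison_test)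
    show "\<exists>N. \<forall>n\<ge>N. norm (\<integral>x. \<bar>K n x\<bar> \<partial>lborel) \<le> q ^ Suc n" using Kn by auto
    show "summable (\<lambda>n. q ^ Suc n)"
      using summable_mult[OF summable_geometric, of q q] q01 by simp
  qed
  have AEsum: "AE x in lborel. summable (\<lambda>n. \<bar>K n x\<bar>)"
  proof -
    have "(\<integral>\<^sup>+x. (\<Sum>n. ennreal \<bar>K n x\<bar>) \<partial>lborel) = (\<Sum>n. \<integral>\<^sup>+x. ennreal \<bar>K n x\<bar> \<partial>lborel)"
      by (rule nn_integral_suminf) measurable
    also have "\<dots> = (\<Sum>n. ennreal (\<integral>x. \<bar>K n x\<bar> \<partial>lborel))"
      using Ki by (intro suminf_cong nn_integral_eq_integral) auto
    also have "\<dots> = ennreal (\<Sum>n. \<integral>x. \<bar>K n x\<bar> \<partial>lborel)"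
      using sumK by (intro suminf_ennreal2) auto
    finally have "(\<integral>\<^sup>+x. (\<Sum>n. ennreal \<bar>K n x\<bar>) \<partial>lborel) \<noteq> \<infinity>" by simp
    then have "AE x in lborel. (\<Sum>n. ennreal \<bar>K n x\<bar>) \<noteq> \<infinity>"
      by (intro nn_integral_PInf_AE) auto
    then show ?thesis
      by eventually_elim (intro summable_suminf_not_top, auto)
  qed
  define \<rho>0 where "\<rho>0 x = (\<Sum>n. K n x)" for x
  have ri: "integrable lborel \<rho>0" unfolding \<rho>0_def[abs_def]
    using Ki AEsum sumK by (intro integrable_suminf) auto
  have rneg: "\<rho>0 x = 0" if "x < 0" for x by (simp add: \<rho>0_def Kneg[OF that])
  \<comment> \<open>Convolution and series are interchanged for almost every x: the convolutions of
    the absolute values have summable integrals, hence are summable almost everywhere, and this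
    dominates the integrand in y.\<close>
  have S1: "AE x in lborel. (\<lambda>n. convl \<kappa> (K n) x) sums convl \<kappa> \<rho>0 x"
  proof -
    define g where "g x = (\<Sum>n. convl (\<lambda>x. \<bar>\<kappa> x\<bar>) (\<lambda>x. \<bar>K n x\<bar>) x)" for x
    have ci: "integrable lborel (convl (\<lambda>x. \<bar>\<kappa> x\<bar>) (\<lambda>x. \<bar>K n x\<bar>))" for n
      using k Ki by (intro convl_integrable) auto
    have cnn: "0 \<le> convl (\<lambda>x. \<bar>\<kappa> x\<bar>) (\<lambda>x. \<bar>K n x\<bar>) x" for n x
      unfolding convl_def by (rule Bochner_Integration.integral_nonneg) simp
    have cint: "(\<integral>x. convl (\<lambda>x. \<bar>\<kappa> x\<bar>) (\<lambda>x. \<bar>K n x\<bar>) x \<partial>lborel) = q * (\<integral>x. \<bar>K n x\<bar> \<partial>lborel)" for n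
      unfolding q_def using k Ki by (intro convl_integral) auto
    have "AE x in lborel. summable (\<lambda>n. convl (\<lambda>x. \<bar>\<kappa> x\<bar>) (\<lambda>x. \<bar>K n x\<bar>) x)"
    proof -
      have "(\<integral>\<^sup>+x. (\<Sum>n. ennreal (convl (\<lambda>x. \<bar>\<kappa> x\<bar>) (\<lambda>x. \<bar>K n x\<bar>) x)) \<partial>lborel) = (\<Sum>n. \<integral>\<^sup>+x. ennreal (convl (\<lambda>x. \<bar>\<kappa> x\<bar>) (\<lambda>x. \<bar>K n x\<bar>) x) \<partial>lborel)"
        by (rule nn_integral_suminf) measurable
      also have "\<dots> = (\<Sum>n. ennreal (q * (\<integral>x. \<bar>K n x\<bar> \<partial>lborel)))"
        using ci cnn by (intro suminf_cong) (simp add: nn_integral_eq_integral cint)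
      also have "\<dots> = ennreal (\<Sum>n. q * (\<integral>x. \<bar>K n x\<bar> \<partial>lborel))"
        using sumK q01 by (intro suminf_ennreal2) (auto intro: summable_mult)
      finally have "(\<integral>\<^sup>+x. (\<Sum>n. ennreal (convl (\<lambda>x. \<bar>\<kappa> x\<bar>) (\<lambda>x. \<bar>K n x\<bar>) x)) \<partial>lborel) \<noteq> \<infinity>" by simp
      then have "AE x in lborel. (\<Sum>n. ennreal (convl (\<lambda>x. \<bar>\<kappa> x\<bar>) (\<lambda>x. \<bar>K n x\<bar>) x)) \<noteq> \<infinity>"
        by (intro nn_integral_PInf_AE) auto
      then show ?thesis
        by eventually_elim (intro summable_suminf_not_top, auto simp: cnn)
    qed
    moreover have "AE x in lborel. \<forall>n. integrable lborel (\<lambda>y. \<kappa> (x - y) * K n y)"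
      unfolding AE_all_countable using convl_AE_integrable[OF k(1) Ki] by blast
    ultimately show ?thesis
    proof eventually_elim
      case (elim x)
      have "AE y in lborel. summable (\<lambda>n. norm (\<kappa> (x - y) * K n y))"
        using AEsum by eventually_elim (auto simp: abs_mult intro: summable_mult)
      then have "(\<lambda>n. \<integral>y. \<kappa> (x - y) * K n y \<partial>lborel) sums (\<integral>y. (\<Sum>n. \<kappa> (x - y) * K n y) \<partial>lborel)"
        using elim by (intro sums_integral) (auto simp: abs_mult convl_def)
      also have "(\<integral>y. (\<Sum>n. \<kappa> (x - y) * K n y) \<partial>lborel) = convl \<kappa> \<rho>0 x"
        unfolding convl_def
      proof (rule integral_cong_AE)
        show "AE y in lborel. (\<Sum>n. \<kappa> (x - y) * K n y) = \<kappa> (x - y) * \<rho>0 y"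
          using AEsum
        proof eventually_elim
          case (elim y)
          then show ?case unfolding \<rho>0_def by (intro suminf_mult) (rule summable_rabs_cancel)
        qed
        have [measurable]: "\<rho>0 \<in> borel_measurable borel" using ri by auto
        show "(\<lambda>y. \<kappa> (x - y) * \<rho>0 y) \<in> borel_measurable lborel" by measurable
      qed measurable
      finally show ?case by (simp add: convl_def)
    qed
  qed
  have "AE x in lborel. \<rho>0 x + convl \<kappa> \<rho>0 x = \<kappa> x"
    using S1 AEsum
  proof eventually_elim
    case (elim x)
    have "(\<lambda>n. K (Suc n) x) sums (- convl \<kappa> \<rho>0 x)" unfolding KS using elim(1) by (rule sums_minus)
    then have "(\<lambda>n. K n x) sums (- convl \<kappa> \<rho>0 x + K 0 x)" by (rule sums_Suc)
    then have "\<rho>0 x = - convl \<kappa> \<rho>0 x + K 0 x" unfolding \<rho>0_def by (rule sums_unique[symmetric])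
    then show ?case by (simp add: K0)
  qed
  then show ?thesis using that ri rneg by blast
qed

lemma resolvent_exists:
  assumes k: "exp_integrable \<kappa>"
  obtains \<rho> where "L1loc \<rho>" "cls \<rho> + cls \<kappa> * cls \<rho> = cls \<kappa>"
proof -
  have kl: "L1loc \<kappa>" using k by (simp add: exp_integrable_def)
  obtain \<sigma>0 where "integrable lborel (\<lambda>x. exp (- \<sigma>0 * x) * \<kappa> x)" using k by (auto simp: exp_integrable_def)
  from exp_integral_small[OF kl this, of 1] exp_integrable_mono[OF kl this]
  obtain \<sigma> where s: "integrable lborel (\<lambda>x. exp (- \<sigma> * x) * \<kappa> x)" "(\<integral>x. \<bar>exp (- \<sigma> * x) * \<kappa> x\<bar> \<partial>lborel) < 1"
    by auto
  obtain r where r: "integrable lborel r" "\<And>x. x < 0 \<Longrightarrow> r x = 0"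
    "AE x in lborel. r x + convl (\<lambda>x. exp (- \<sigma> * x) * \<kappa> x) r x = exp (- \<sigma> * x) * \<kappa> x"
    by (rule resolvent_small[OF s(1) _ s(2)]) (auto simp: L1loc_neg[OF kl])
  have rl: "L1loc r" by (rule integrable_imp_L1loc[OF r(1,2)])
  \<comment> \<open>\<open>r\<close> is the resolvent of the weighted kernel. As weighting is a
    homomorphism, removing the weight gives the resolvent of \<kappa>; it is only locally
    integrable, because the factor grows.\<close>
  define \<rho> where "\<rho> x = exp (\<sigma> * x) * r x" for x
  have re: "r = (\<lambda>x. exp (- \<sigma> * x) * \<rho> x)" by (auto simp: \<rho>_def exp_minus fun_eq_iff)
  note [measurable] = L1loc_measurable[OF rl]
  have \<rho>l: "L1loc \<rho>"
    unfolding L1loc_def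
  proof safe
    show "\<rho> \<in> borel_measurable borel" unfolding \<rho>_def[abs_def] by measurable
    show "\<rho> x = 0" if "x < 0" for x using r(2)[OF that] by (simp add: \<rho>_def)
    fix b
    show "integrable lborel (trunc b \<rho>)"
    proof (rule Bochner_Integration.integrable_bound[OF Bochner_Integration.integrable_mult_right[OF r(1), of "exp (\<bar>\<sigma>\<bar> * \<bar>b\<bar>)"]])
      have "\<bar>trunc b \<rho> x\<bar> \<le> exp (\<bar>\<sigma>\<bar> * \<bar>b\<bar>) * \<bar>r x\<bar>" for x
      proof (cases "0 \<le> x \<and> x \<le> b")
        case True
        have "\<sigma> * x \<le> \<bar>\<sigma> * x\<bar>" by simp
        also have "\<dots> \<le> \<bar>\<sigma>\<bar> * \<bar>b\<bar>" unfolding abs_mult using True by (intro mult_left_mono) auto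
        finally have "\<sigma> * x \<le> \<bar>\<sigma>\<bar> * \<bar>b\<bar>" .
        then have "exp (\<sigma> * x) \<le> exp (\<bar>\<sigma>\<bar> * \<bar>b\<bar>)" by simp
        from mult_right_mono[OF this abs_ge_zero[of "r x"]] True show ?thesis by (simp add: trunc_def \<rho>_def abs_mult)
      qed (use r(2)[of x] in \<open>auto simp: trunc_def \<rho>_def indicator_def not_le\<close>)
      then show "AE x in lborel. norm (trunc b \<rho> x) \<le> norm (exp (\<bar>\<sigma>\<bar> * \<bar>b\<bar>) * r x)" by (simp add: abs_mult)
      have [measurable]: "\<rho> \<in> borel_measurable borel" unfolding \<rho>_def[abs_def] by measurable
      show "trunc b \<rho> \<in> borel_measurable lborel" by measurable
    qed
  qed
  have "AE x in lborel. \<rho> x + convl \<kappa> \<rho> x = \<kappa> x"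
    using r(3)
  proof eventually_elim
    case (elim x)
    have "exp (- \<sigma> * x) * (\<rho> x + convl \<kappa> \<rho> x) = exp (- \<sigma> * x) * \<kappa> x"
      using elim unfolding re convl_exp by (simp add: algebra_simps)
    then show ?case by simp
  qed
  then have "cls \<rho> + cls \<kappa> * cls \<rho> = cls \<kappa>"
    using \<rho>l kl by (simp add: cls_mult cls_add cls_eq L1loc_convl L1loc_add)
  then show ?thesis using that \<rho>l by blast
qed

lemma exp_integrable_convl:
  assumes f: "exp_integrable f" and g: "exp_integrable g"
  shows "exp_integrable (convl f g)"
proof -
  have l: "L1loc f" "L1loc g" using assms by (auto simp: exp_integrable_def)
  obtain s1 s2 where s: "s1 \<ge> 0" "s2 \<ge> 0" "integrable lborel (\<lambda>x. exp (- s1 * x) * f x)" "integrable lborel (\<lambda>x. exp (- s2 * x) * g x)"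
    using assms by (auto simp: exp_integrable_def)
  let ?s = "max s1 s2"
  have "integrable lborel (convl (\<lambda>x. exp (- ?s * x) * f x) (\<lambda>x. exp (- ?s * x) * g x))"
    by (intro convl_integrable exp_integrable_mono[OF l(1) s(3)] exp_integrable_mono[OF l(2) s(4)]) auto
  then have "integrable lborel (\<lambda>x. exp (- ?s * x) * convl f g x)"
    unfolding convl_exp[abs_def] by simp
  with s show ?thesis unfolding exp_integrable_def using l by (auto intro!: L1loc_convl exI[of _ ?s])
qed

lemma exp_integrable_add:
  assumes f: "exp_integrable f" and g: "exp_integrable g"
  shows "exp_integrable (\<lambda>x. f x + g x)"
proof -
  have l: "L1loc f" "L1loc g" using assms by (auto simp: exp_integrable_def)
  obtain s1 s2 where s: "s1 \<ge> 0" "s2 \<ge> 0" "integrable lborel (\<lambda>x. exp (- s1 * x) * f x)" "integrable lborel (\<lambda>x. exp (- s2 * x) * g x)"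
    using assms by (auto simp: exp_integrable_def)
  let ?s = "max s1 s2"
  have "integrable lborel (\<lambda>x. exp (- ?s * x) * f x + exp (- ?s * x) * g x)"
    by (intro Bochner_Integration.integrable_add exp_integrable_mono[OF l(1) s(3)] exp_integrable_mono[OF l(2) s(4)]) auto
  with s show ?thesis unfolding exp_integrable_def using l by (auto intro!: L1loc_add exI[of _ ?s] simp: distrib_left)
qed

lemma exp_integrable_scale: "exp_integrable f \<Longrightarrow> exp_integrable (\<lambda>x. c * f x)"
  unfolding exp_integrable_def
  by (auto intro!: L1loc_scale simp: mult.left_commute[of _ c])

lemma exp_integrable_rl_ker: assumes a: "a > 0" shows "exp_integrable (rl_ker a)"
  unfolding exp_integrable_def
proof (intro conjI exI[of _ 1] L1loc_rl_ker a)
  have i: "integrable lborel (\<lambda>t. indicator {0..} t * (t powr (a - 1) / exp t))"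
    using nonneg_has_integral_lborel(1)[OF Gamma_integral_real[OF a]] by simp
  have eq: "(\<lambda>x. exp (- 1 * x) * rl_ker a x) = (\<lambda>x. (indicator {0..} x * (x powr (a - 1) / exp x)) / Gamma a)"
    by (auto simp: rl_ker_def exp_minus indicator_def fun_eq_iff field_simps)
  show "integrable lborel (\<lambda>x. exp (- 1 * x) * rl_ker a x)"
    unfolding eq by (rule Bochner_Integration.integrable_divide[OF i])
qed simp

section \<open>Energy estimates\<close>

lemma trunc_add: "trunc r (\<lambda>x. f x + g x) = (\<lambda>x. trunc r f x + trunc r g x)"
  by (auto simp: trunc_def algebra_simps)

lemma trunc_scale: "trunc r (\<lambda>x. c * f x) = (\<lambda>x. c * trunc r f x)"
  by (auto simp: trunc_def)

lemma square_add_le: "((a::real) + b)\<^sup>2 \<le> 2 * a\<^sup>2 + 2 * b\<^sup>2"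
  using sum_squares_bound[of a b] by (simp add: power2_sum)

lemma L2loc_scale: "L2loc f \<Longrightarrow> L2loc (\<lambda>x. c * f x)"
  by (auto simp: L2loc_def L1loc_scale trunc_scale power_mult_distrib)

lemma L2loc_add: "L2loc f \<Longrightarrow> L2loc g \<Longrightarrow> L2loc (\<lambda>x. f x + g x)"
  unfolding L2loc_def
proof safe
  fix r assume a: "L1loc f" "L1loc g" "\<forall>r. integrable lborel (\<lambda>x. (trunc r f x)\<^sup>2)" "\<forall>r. integrable lborel (\<lambda>x. (trunc r g x)\<^sup>2)"
  note [measurable] = L1loc_measurable[OF a(1)] L1loc_measurable[OF a(2)]
  have "integrable lborel (\<lambda>x. 2 * (trunc r f x)\<^sup>2 + 2 * (trunc r g x)\<^sup>2)" using a by simp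
  then show "integrable lborel (\<lambda>x. (trunc r (\<lambda>x. f x + g x) x)\<^sup>2)"
    by (rule Bochner_Integration.integrable_bound) (auto simp: trunc_add square_add_le)
qed (auto intro: L1loc_add)

lemma L2loc_diff: "L2loc f \<Longrightarrow> L2loc g \<Longrightarrow> L2loc (\<lambda>x. f x - g x)"
  using L2loc_add[OF _ L2loc_scale[of g "-1"]] by simp

lemma L1loc_diff: "L1loc f \<Longrightarrow> L1loc g \<Longrightarrow> L1loc (\<lambda>x. f x - g x)"
  using L1loc_add[OF _ L1loc_scale[of g "-1"]] by simp

lemma cls_diff: "L1loc f \<Longrightarrow> L1loc g \<Longrightarrow> cls f - cls g = cls (\<lambda>x. f x - g x)"
  using cls_add[of f "\<lambda>x. - g x"] by (simp add: cls_uminus[symmetric] L1loc_uminus)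

lemma wtrunc_add: "wtrunc \<sigma> r (\<lambda>x. f x + g x) x = wtrunc \<sigma> r f x + wtrunc \<sigma> r g x"
  by (simp add: wtrunc_def trunc_add algebra_simps)

lemma wtrunc_scale: "wtrunc \<sigma> r (\<lambda>x. c * f x) x = c * wtrunc \<sigma> r f x"
  by (simp add: wtrunc_def trunc_scale)

lemma wsq_scale: "wsq \<sigma> r (\<lambda>x. c * f x) = c\<^sup>2 * wsq \<sigma> r f"
  by (simp add: wsq_def wtrunc_scale power_mult_distrib)

lemma wsq_add:
  assumes "L2loc f" "L2loc g" "\<sigma> \<ge> 0"
  shows "wsq \<sigma> r (\<lambda>x. f x + g x) \<le> 2 * wsq \<sigma> r f + 2 * wsq \<sigma> r g"
proof -
  note i = wtrunc_square_integrable[OF assms(1,3), of r] wtrunc_square_integrable[OF assms(2,3), of r]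
  have "wsq \<sigma> r (\<lambda>x. f x + g x) \<le> (\<integral>x. 2 * (wtrunc \<sigma> r f x)\<^sup>2 + 2 * (wtrunc \<sigma> r g x)\<^sup>2 \<partial>lborel)"
    unfolding wsq_def
    using i wtrunc_square_integrable[OF L2loc_add[OF assms(1,2)] assms(3), of r]
    by (intro integral_mono) (auto simp: wtrunc_add square_add_le)
  also have "\<dots> = 2 * wsq \<sigma> r f + 2 * wsq \<sigma> r g"
    using i by (simp add: wsq_def)
  finally show ?thesis .
qed

lemma wsq_diff:
  assumes "L2loc f" "L2loc g" "\<sigma> \<ge> 0"
  shows "wsq \<sigma> r (\<lambda>x. f x - g x) \<le> 2 * wsq \<sigma> r f + 2 * wsq \<sigma> r g"
  using wsq_add[OF assms(1) L2loc_scale[OF assms(2), of "-1"] assms(3), of r] wsq_scale[of \<sigma> r "-1" g] by simp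

lemma wsq_nonneg: "0 \<le> wsq \<sigma> r f"
  by (simp add: wsq_def)

lemma cls_cong_L2loc:
  assumes "L1loc f" "L2loc g" "cls f = cls g"
  shows "L2loc f" "wsq \<sigma> r f = wsq \<sigma> r g"
proof -
  note g = L2loc_L1loc[OF assms(2)]
  note [measurable] = L1loc_measurable[OF assms(1)] L1loc_measurable[OF g]
  have ae: "AE x in lborel. f x = g x" using assms g by (simp add: cls_eq)
  have "integrable lborel (\<lambda>x. (trunc r f x)\<^sup>2) \<longleftrightarrow> integrable lborel (\<lambda>x. (trunc r g x)\<^sup>2)" for r
    using ae by (intro integrable_cong_AE) (auto simp: trunc_def elim: eventually_mono)
  then show "L2loc f" using assms by (simp add: L2loc_def)
  show "wsq \<sigma> r f = wsq \<sigma> r g"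
    unfolding wsq_def using ae by (intro integral_cong_AE) (auto simp: wtrunc_def trunc_def elim: eventually_mono)
qed

text \<open>\<open>\<rho>\<close> plays the role of k/(1 + k), so that 1 - \<rho> is the inverse of
  1 + k. Everything is written without 1 because the convolution ring has no unit.\<close>

lemma resolvent_solves:
  fixes k \<rho> f :: locint
  assumes "\<rho> + k * \<rho> = k"
  shows "(f - \<rho> * f) + k * (f - \<rho> * f) = f"
proof -
  have "(f - \<rho> * f) + k * (f - \<rho> * f) = f + k * f - (\<rho> + k * \<rho>) * f" by (simp add: algebra_simps)
  then show ?thesis by (simp add: assms)
qed

lemma resolvent_unique:
  fixes k \<rho> f u :: locint
  assumes "\<rho> + k * \<rho> = k" "u + k * u = f"
  shows "u = f - \<rho> * f"
proof -
  have "f - \<rho> * f = u + k * u - (\<rho> + k * \<rho>) * u" unfolding assms(2)[symmetric] by (simp add: algebra_simps)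
  then show ?thesis by (simp add: assms(1))
qed

text \<open>w = u + g * u satisfies w + lam beta * w = f + g * u, so \<open>energy\<close> applies
  to w. By Young's inequality g * u has at most a quarter of the norm of u and can be
  absorbed.\<close>

lemma stability:
  assumes \<alpha>: "0 < \<alpha>" "\<alpha> < 1" and u: "L2loc u" and f: "L2loc f" and g: "L1loc g" and l: "lam \<ge> 0" and s: "\<sigma> \<ge> 0"
    and small: "(\<integral>x. \<bar>wtrunc \<sigma> r g x\<bar> \<partial>lborel) \<le> 1/4"
    and eq: "cls u + lam *\<^sub>R (cls (rl_ker \<alpha>) * (cls u + cls g * cls u)) = cls f"
  shows "wsq \<sigma> r u \<le> 8 * wsq \<sigma> r f"
proof -
  define gu where "gu = convl g u"
  note ul = L2loc_L1loc[OF u] and fl = L2loc_L1loc[OF f]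
  have gu: "L2loc gu" and gun: "wsq \<sigma> r gu \<le> (\<integral>x. \<bar>wtrunc \<sigma> r g x\<bar> \<partial>lborel)\<^sup>2 * wsq \<sigma> r u"
    unfolding gu_def using L2loc_convl[OF g u s] wsq_convl[OF g u s] by auto
  have "(\<integral>x. \<bar>wtrunc \<sigma> r g x\<bar> \<partial>lborel)\<^sup>2 \<le> (1/4)\<^sup>2"
    using small by (intro power_mono) auto
  then have gun': "wsq \<sigma> r gu \<le> 1/16 * wsq \<sigma> r u"
    using mult_right_mono[OF _ wsq_nonneg[of \<sigma> r u]] gun by (fastforce simp: power2_eq_square)
  have c: "cls g * cls u = cls gu" using g ul by (simp add: cls_mult gu_def)
  have w: "cls (\<lambda>x. u x + gu x) = cls u + cls gu" using ul L2loc_L1loc[OF gu] by (simp add: cls_add)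
  have "cls (\<lambda>x. u x + gu x) + lam *\<^sub>R (cls (rl_ker \<alpha>) * cls (\<lambda>x. u x + gu x)) = cls (\<lambda>x. f x + gu x)"
    using eq fl L2loc_L1loc[OF gu] unfolding w c by (simp add: cls_add[symmetric] algebra_simps)
  from energy[OF \<alpha> L2loc_add[OF u gu] L2loc_add[OF f gu] l s this]
  have "wsq \<sigma> r (\<lambda>x. u x + gu x) \<le> 2 * wsq \<sigma> r f + 2 * wsq \<sigma> r gu"
    using wsq_add[OF f gu s, of r] by (meson order_trans)
  moreover have "wsq \<sigma> r u \<le> 2 * wsq \<sigma> r (\<lambda>x. u x + gu x) + 2 * wsq \<sigma> r gu"
    using wsq_diff[OF L2loc_add[OF u gu] gu s, of r] by simp
  \<comment> \<open>With A, B, D the squared norms of u, f, g * u: A \<le> 2 (2 B + 2 D) + 2 D and D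
    \<le> A/16 give 10 A/16 \<le> 4 B, so A \<le> 8 B.\<close>
  ultimately show ?thesis using gun' wsq_nonneg[of \<sigma> r f] by linarith
qed

section \<open>Multiplication by t and the moments of the resolvent\<close>

definition tmult :: "(real \<Rightarrow> real) \<Rightarrow> real \<Rightarrow> real" where
  "tmult f x = x * f x"

lemma L1loc_tmult: assumes f: "L1loc f" shows "L1loc (tmult f)"
  unfolding L1loc_def
proof safe
  note [measurable] = L1loc_measurable[OF f]
  show tmm: "tmult f \<in> borel_measurable borel" unfolding tmult_def[abs_def] by measurable
  note [measurable] = tmm
  show "tmult f x = 0" if "x < 0" for x using L1loc_neg[OF f that] by (simp add: tmult_def)
  fix r
  show "integrable lborel (trunc r (tmult f))"
  proof (rule Bochner_Integration.integrable_bound[OF Bochner_Integration.integrable_mult_right[OF L1loc_trunc[OF f], of "\<bar>r\<bar>" r]])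
    have "\<bar>trunc r (tmult f) x\<bar> \<le> \<bar>r\<bar> * \<bar>trunc r f x\<bar>" for x
    proof (cases "x < 0 \<or> r < x")
      case False
      then have "\<bar>x\<bar> \<le> \<bar>r\<bar>" by simp
      from mult_right_mono[OF this abs_ge_zero[of "f x"]] show ?thesis by (auto simp: trunc_def tmult_def abs_mult indicator_def)
    qed (use L1loc_neg[OF f] in \<open>auto simp: trunc_def tmult_def\<close>)
    then show "AE x in lborel. norm (trunc r (tmult f) x) \<le> norm (\<bar>r\<bar> * trunc r f x)" by (simp add: abs_mult)
  qed measurable
qed

text \<open>Multiplication by x is a derivation of the convolution ring, because x = (x - y) + y
  under the integral.\<close>

lemma cls_tmult_mult:
  assumes f: "L1loc f" and g: "L1loc g"
  shows "cls (tmult (convl f g)) = cls (tmult f) * cls g + cls f * cls (tmult g)"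
proof -
  have "AE x in lborel. tmult (convl f g) x = convl (tmult f) g x + convl f (tmult g) x"
    using L1loc_convl_AE[OF f g] L1loc_convl_AE[OF L1loc_tmult[OF f] g] L1loc_convl_AE[OF f L1loc_tmult[OF g]]
  proof eventually_elim
    case (elim x)
    have "tmult (convl f g) x = (\<integral>y. x * (f (x - y) * g y) \<partial>lborel)" by (simp add: tmult_def convl_def)
    also have "(\<lambda>y. x * (f (x - y) * g y)) = (\<lambda>y. tmult f (x - y) * g y + f (x - y) * tmult g y)"
      by (auto simp: tmult_def algebra_simps)
    finally show ?case
      using elim unfolding convl_def[of "tmult f"] convl_def[of f "tmult g"] by simp
  qed
  then show ?thesis
    using f g by (simp add: cls_mult cls_add cls_eq L1loc_convl L1loc_tmult L1loc_add)
qed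

lemma tmult_rl_ker: "a > 0 \<Longrightarrow> tmult (rl_ker a) = (\<lambda>x. a * rl_ker (a + 1) x)"
  using Gamma_plus1[of a] Gamma_real_pos[of a]
  by (auto simp: tmult_def rl_ker_def fun_eq_iff powr_mult_base nonpos_Ints_def)

text \<open>The threshold is where t^(2 a - 2) becomes integrable at 0. The orders needed are 1 and
  \<alpha> + 1, which lie above it for every \<alpha>, unlike \<alpha> itself.\<close>

lemma wsq0_rl_ker:
  assumes a: "a > 1/2"
  shows "L2loc (rl_ker a)" "0 \<le> r \<Longrightarrow> wsq 0 r (rl_ker a) = r powr (2 * a - 1) / ((2 * a - 1) * (Gamma a)\<^sup>2)"
proof -
  have eq: "(\<lambda>x. (trunc r (rl_ker a) x)\<^sup>2) = (\<lambda>x. (indicator {0..r} x *\<^sub>R (x powr ((2 * a - 1) - 1))) / (Gamma a)\<^sup>2)" for r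
  proof
    fix x
    have "x powr (2 * a - 1 - 1) = (x powr (a - 1))\<^sup>2" if "x > 0"
      by (simp add: power2_eq_square powr_add[symmetric])
    then show "(trunc r (rl_ker a) x)\<^sup>2 = (indicator {0..r} x *\<^sub>R (x powr ((2 * a - 1) - 1))) / (Gamma a)\<^sup>2"
      by (auto simp: trunc_def rl_ker_def indicator_def power_divide)
  qed
  have p: "2 * a - 1 > 0" using a by simp
  note i = powr_integrable_Icc[OF p]
  show "L2loc (rl_ker a)"
    unfolding L2loc_def eq
  proof (intro conjI allI)
    show "L1loc (rl_ker a)" using L1loc_rl_ker[of a] a by simp
  qed (rule Bochner_Integration.integrable_divide[OF i(1)[unfolded set_integrable_def]])
  show "wsq 0 r (rl_ker a) = r powr (2 * a - 1) / ((2 * a - 1) * (Gamma a)\<^sup>2)" if "0 \<le> r"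
    using i(2)[OF that] unfolding wsq_def wtrunc0 eq set_lebesgue_integral_def integral_divide_zero by simp
qed

text \<open>With b = lam beta and s the resolvent of b, the functions S = 1 * s and y(t) = t s(t) satisfy
  S + b * S = lam beta_(alpha + 1) and y + b * y = alpha S, while 1 - S solves the equation with right-hand
  side 1. The energy inequality therefore bounds y on every interval [0, r].\<close>
lemma resolvent_moment_bounds:
  assumes \<alpha>: "0 < \<alpha>" "\<alpha> < 1" and l: "lam \<ge> 0" and s: "L1loc s" and r: "r \<ge> 0"
    and eq: "cls s + (lam *\<^sub>R cls (rl_ker \<alpha>)) * cls s = lam *\<^sub>R cls (rl_ker \<alpha>)"
  shows "L2loc (tmult s)" "wsq 0 r (tmult s) \<le> 4 * r"
    "wsq 0 r (tmult s) \<le> lam\<^sup>2 * (r powr (2 * \<alpha> + 1) / (Gamma (\<alpha> + 1))\<^sup>2)"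
proof -
  let ?B = "\<lambda>a. cls (rl_ker a)"
  have la: "L1loc (rl_ker \<alpha>)" "L1loc (rl_ker 1)" "L1loc (rl_ker (\<alpha> + 1))" using \<alpha> by (auto intro: L1loc_rl_ker)
  have B1: "?B 1 * ?B \<alpha> = ?B (\<alpha> + 1)" using \<alpha> by (simp add: cls_rl_ker_mult add.commute)
  define S where "S = convl s (rl_ker 1)"
  have S: "L2loc S" unfolding S_def using wsq0_rl_ker(1)[of 1] by (intro L2loc_convl[OF s _ order_refl]) simp
  note Sl = L2loc_L1loc[OF S]
  have cS: "cls S = ?B 1 * cls s" using s la by (simp add: S_def cls_mult mult.commute)
  have "?B 1 * (cls s + (lam *\<^sub>R ?B \<alpha>) * cls s) = lam *\<^sub>R ?B (\<alpha> + 1)"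
    unfolding eq by (simp add: B1)
  then have S1: "cls S + lam *\<^sub>R (?B \<alpha> * cls S) = lam *\<^sub>R ?B (\<alpha> + 1)"
    by (simp add: cS algebra_simps)
  have "AE x in lborel. s x + lam * convl (rl_ker \<alpha>) s x = lam * rl_ker \<alpha> x"
    using eq s la by (simp add: cls_mult cls_scaleR cls_add cls_eq L1loc_convl L1loc_scale L1loc_add convl_scale)
  then have "AE x in lborel. tmult s x + lam * tmult (convl (rl_ker \<alpha>) s) x = lam * tmult (rl_ker \<alpha>) x"
    by eventually_elim (simp add: tmult_def algebra_simps flip: distrib_left)
  then have "cls (tmult s) + lam *\<^sub>R cls (tmult (convl (rl_ker \<alpha>) s)) = lam *\<^sub>R cls (tmult (rl_ker \<alpha>))"
    using s la by (simp add: cls_scaleR cls_add cls_eq L1loc_convl L1loc_scale L1loc_add L1loc_tmult)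
  moreover have "cls (tmult (rl_ker \<alpha>)) = \<alpha> *\<^sub>R ?B (\<alpha> + 1)"
    using \<alpha> la by (simp add: tmult_rl_ker cls_scaleR)
  ultimately have Y0: "cls (tmult s) + lam *\<^sub>R ((\<alpha> *\<^sub>R ?B (\<alpha> + 1)) * cls s + ?B \<alpha> * cls (tmult s)) = lam *\<^sub>R (\<alpha> *\<^sub>R ?B (\<alpha> + 1))"
    using cls_tmult_mult[OF la(1) s] by simp
  have bS: "lam *\<^sub>R (?B (\<alpha> + 1) * cls s) = lam *\<^sub>R (?B \<alpha> * cls S)"
    unfolding cS B1[symmetric] by (simp add: ac_simps)
  have Y: "cls (tmult s) + lam *\<^sub>R (?B \<alpha> * cls (tmult s)) = \<alpha> *\<^sub>R cls S"
  proof -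
    have "cls (tmult s) + lam *\<^sub>R (?B \<alpha> * cls (tmult s)) = \<alpha> *\<^sub>R (lam *\<^sub>R ?B (\<alpha> + 1) - lam *\<^sub>R (?B (\<alpha> + 1) * cls s))"
      using Y0 by (simp add: algebra_simps)
    also have "\<dots> = \<alpha> *\<^sub>R cls S" unfolding bS S1[symmetric] by simp
    finally show ?thesis .
  qed
  \<comment> \<open>\<open>s\<close> is only locally integrable, so square integrability of t s is
    not evident, and \<open>energy\<close> presupposes it. Inverting the equation for
    \<open>tmult s\<close> expresses it through S, which is square integrable.\<close>
  define y' where "y' x = \<alpha> * S x - convl s (\<lambda>x. \<alpha> * S x) x" for x
  have aS: "L2loc (\<lambda>x. \<alpha> * S x)" by (rule L2loc_scale[OF S])
  have y': "L2loc y'" unfolding y'_def by (intro L2loc_diff aS L2loc_convl[OF s _ order_refl])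
  have "cls (tmult s) = cls (\<lambda>x. \<alpha> * S x) - cls s * cls (\<lambda>x. \<alpha> * S x)"
    by (rule resolvent_unique[OF eq]) (use Y Sl in \<open>simp add: cls_scaleR\<close>)
  then have "cls (tmult s) = cls y'"
    using s L2loc_L1loc[OF aS] by (simp add: y'_def[abs_def] cls_mult cls_diff L1loc_convl)
  from cls_cong_L2loc(1)[OF L1loc_tmult[OF s] y' this] show tms: "L2loc (tmult s)" .
  have "wsq 0 r (tmult s) \<le> wsq 0 r (\<lambda>x. \<alpha> * S x)"
    using Y Sl by (intro energy[OF \<alpha> tms aS l order_refl]) (simp add: cls_scaleR)
  also have "\<dots> = \<alpha>\<^sup>2 * wsq 0 r S" by (rule wsq_scale)
  also have "\<dots> \<le> 1 * wsq 0 r S"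
    using \<alpha> by (intro mult_right_mono wsq_nonneg) (simp add: power_le_one)
  finally have 1: "wsq 0 r (tmult s) \<le> wsq 0 r S" by simp
  have b1: "L2loc (rl_ker 1)" "wsq 0 r (rl_ker 1) = r" using wsq0_rl_ker[of 1] r by (auto simp: powr_one)
  have b2: "L2loc (rl_ker (\<alpha> + 1))" using wsq0_rl_ker[of "\<alpha> + 1"] \<alpha> by auto
  have "wsq 0 r S \<le> wsq 0 r (\<lambda>x. lam * rl_ker (\<alpha> + 1) x)"
    using S1 la by (intro energy[OF \<alpha> S L2loc_scale[OF b2] l order_refl]) (simp add: cls_scaleR)
  also have "\<dots> = lam\<^sup>2 * wsq 0 r (rl_ker (\<alpha> + 1))" by (rule wsq_scale)
  also have "wsq 0 r (rl_ker (\<alpha> + 1)) = r powr (2 * \<alpha> + 1) / ((2 * \<alpha> + 1) * (Gamma (\<alpha> + 1))\<^sup>2)"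
    using wsq0_rl_ker(2)[of "\<alpha> + 1" r] r \<alpha> by (simp add: algebra_simps)
  also have "lam\<^sup>2 * (r powr (2 * \<alpha> + 1) / ((2 * \<alpha> + 1) * (Gamma (\<alpha> + 1))\<^sup>2)) \<le> lam\<^sup>2 * (r powr (2 * \<alpha> + 1) / (Gamma (\<alpha> + 1))\<^sup>2)"
  proof -
    have "0 < Gamma (\<alpha> + 1)" using \<alpha> by (intro Gamma_real_pos) simp
    then have "Gamma (\<alpha> + 1) \<noteq> 0" by linarith
    then show ?thesis
      using \<alpha> by (intro mult_left_mono divide_left_mono mult_pos_pos) (auto simp: mult_le_cancel_right1)
  qed
  finally show "wsq 0 r (tmult s) \<le> lam\<^sup>2 * (r powr (2 * \<alpha> + 1) / (Gamma (\<alpha> + 1))\<^sup>2)" using 1 by simp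
  \<comment> \<open>S = 1 - e, and 1 and e both have squared norm at most r on [0, r]; this is the
    origin of the constant 4.\<close>
  define e where "e x = rl_ker 1 x - S x" for x
  have e: "L2loc e" unfolding e_def by (intro L2loc_diff b1 S)
  have "cls e + lam *\<^sub>R (?B \<alpha> * cls e) = ?B 1 + lam *\<^sub>R (?B \<alpha> * ?B 1) - (cls S + lam *\<^sub>R (?B \<alpha> * cls S))"
    using Sl la by (simp add: e_def[abs_def] cls_diff[symmetric] algebra_simps)
  also have "\<dots> = ?B 1" unfolding S1 B1[symmetric] by (simp add: mult.commute)
  finally have "wsq 0 r e \<le> wsq 0 r (rl_ker 1)" by (intro energy[OF \<alpha> e b1(1) l order_refl])
  moreover have "wsq 0 r S \<le> 2 * wsq 0 r (rl_ker 1) + 2 * wsq 0 r e"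
    using wsq_diff[OF b1(1) e order_refl, of r] by (simp add: e_def)
  ultimately show "wsq 0 r (tmult s) \<le> 4 * r" using 1 b1(2) by simp
qed

lemma min_le_geometric:
  assumes "0 \<le> y" "y \<le> a" "y \<le> b" "0 \<le> g" "g \<le> (1::real)"
  shows "y \<le> a powr g * b powr (1 - g)"
proof -
  have "y = y powr g * y powr (1 - g)" using assms(1) by (simp add: powr_add[symmetric])
  also have "\<dots> \<le> a powr g * b powr (1 - g)"
    using assms by (intro mult_mono powr_mono2) auto
  finally show ?thesis .
qed

lemma measurable_indicator_atMost[measurable (raw)]:
  fixes f g :: "'a \<Rightarrow> real"
  assumes [measurable]: "f \<in> borel_measurable M" "g \<in> borel_measurable M"
  shows "(\<lambda>x. indicator {..g x} (f x) :: real) \<in> borel_measurable M"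
proof -
  have "(\<lambda>x. indicator {..g x} (f x) :: real) = (\<lambda>x. if f x \<le> g x then 1 else 0)"
    by (auto simp: indicator_def)
  then show ?thesis by simp
qed

text \<open>Integration by parts in disguise: t^(-p) equals T^(-p) plus the integral of p x^(-p - 1)
  over [t, T]. Exchanging integrals leaves the mass of h up to x, at most M x^e, against p x^(-p -
  1), and x^(e - p - 1) is integrable at 0 because p < e. The computation uses nonnegative integrals
  so that the bound itself proves integrability.\<close>

lemma layer_cake_powr:
  fixes h :: "real \<Rightarrow> real"
  assumes h: "integrable lborel h" "\<And>t. 0 \<le> h t" "\<And>t. t \<le> 0 \<Longrightarrow> h t = 0" "\<And>t. t > T \<Longrightarrow> h t = 0"
    and \<Phi>: "\<And>r. 0 < r \<Longrightarrow> r \<le> T \<Longrightarrow> (\<integral>t. indicator {..r} t * h t \<partial>lborel) \<le> M * r powr e"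
    and p: "0 < p" "p < e" and T: "T > 0" and M: "M \<ge> 0"
  shows "integrable lborel (\<lambda>t. t powr (- p) * h t)"
    "(\<integral>t. t powr (- p) * h t \<partial>lborel) \<le> M * (T powr (e - p) * (1 + p / (e - p)))"
proof -
  have [measurable]: "h \<in> borel_measurable borel" using h by auto
  let ?w = "\<lambda>x. indicator {0<..T} x * (p * x powr (- p - 1))"
  have inner: "ennreal (t powr (- p) * h t) = ennreal (T powr (- p)) * ennreal (h t) + (\<integral>\<^sup>+x. ennreal (indicator {..x} t * h t) * ennreal (?w x) \<partial>lborel)" for t
  proof (cases "0 < t \<and> t \<le> T")
    case True
    have "(\<integral>\<^sup>+x. ennreal (p * x powr (- p - 1)) * indicator {t..T} x \<partial>lborel) = ennreal (- (T powr (- p)) - - (t powr (- p)))"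
    proof (rule nn_integral_FTC_Icc)
      fix x assume x: "x \<in> {t..T}"
      then show "((\<lambda>x. - (x powr (- p))) has_real_derivative p * x powr (- p - 1)) (at x)"
        using True by (auto intro!: derivative_eq_intros)
      show "0 \<le> p * x powr (- p - 1)" using p by simp
    qed (use True in auto)
    moreover have "(\<lambda>x. ennreal (indicator {..x} t * h t) * ennreal (?w x)) = (\<lambda>x. ennreal (h t) * (ennreal (p * x powr (- p - 1)) * indicator {t..T} x))"
      using True by (auto simp: fun_eq_iff indicator_def)
    ultimately have "(\<integral>\<^sup>+x. ennreal (indicator {..x} t * h t) * ennreal (?w x) \<partial>lborel) = ennreal (h t) * ennreal (t powr (- p) - T powr (- p))"
      by (simp add: nn_integral_cmult)
    moreover have "T powr (- p) \<le> t powr (- p)" using True p by (intro powr_mono2') auto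
    moreover from mult_left_mono[OF this h(2)[of t]] have "0 \<le> h t * t powr (- p) - h t * T powr (- p)" by simp
    ultimately show ?thesis
      using h(2)[of t] by (simp add: ennreal_mult[symmetric] ennreal_plus[symmetric] algebra_simps del: ennreal_plus)
  next
    case False
    then have "h t = 0" using h(3,4)[of t] by auto
    then show ?thesis by simp
  qed
  have hN: "(\<integral>\<^sup>+t. ennreal (indicator {..x} t * h t) \<partial>lborel) = ennreal (\<integral>t. indicator {..x} t * h t \<partial>lborel)" for x
    using h(1,2) integrable_mult_indicator[OF _ h(1), of "{..x}"] by (intro nn_integral_eq_integral) auto
  have hN': "(\<integral>\<^sup>+t. ennreal (h t) \<partial>lborel) \<le> ennreal (M * T powr e)"
  proof -
    have hT: "indicator {..T} t * h t = h t" for t using h(4)[of t] by (auto simp: indicator_def)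
    have "(\<integral>\<^sup>+t. ennreal (h t) \<partial>lborel) = ennreal (\<integral>t. indicator {..T} t * h t \<partial>lborel)"
      using hN[of T] unfolding hT .
    also have "\<dots> \<le> ennreal (M * T powr e)" by (intro ennreal_leI \<Phi>) (use T in auto)
    finally show ?thesis .
  qed
  have wI: "(\<integral>\<^sup>+x. ennreal (indicator {0<..T} x * (M * p * x powr (e - p - 1))) \<partial>lborel) = ennreal (M * p * (T powr (e - p) / (e - p)))"
  proof -
    have eq: "indicator {0<..T} x * (M * p * x powr (e - p - 1)) = M * p * (indicator {0..T} x *\<^sub>R x powr (e - p - 1))" for x
      by (auto simp: indicator_def)
    have ep: "e - p > 0" using p by simp
    note i = powr_integrable_Icc[OF ep, of T]
    have "(\<integral>\<^sup>+x. ennreal (M * p * (indicator {0..T} x *\<^sub>R x powr (e - p - 1))) \<partial>lborel) = ennreal (\<integral>x. M * p * (indicator {0..T} x *\<^sub>R x powr (e - p - 1)) \<partial>lborel)"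
      using i(1) M p by (intro nn_integral_eq_integral) (auto simp: set_integrable_def)
    also have "(\<integral>x. M * p * (indicator {0..T} x *\<^sub>R x powr (e - p - 1)) \<partial>lborel) = M * p * (T powr (e - p) / (e - p))"
      using i(2) T by (simp add: set_lebesgue_integral_def)
    finally show ?thesis unfolding eq .
  qed
  have split: "(\<integral>\<^sup>+t. ennreal (t powr (- p) * h t) \<partial>lborel)
     = (\<integral>\<^sup>+t. ennreal (T powr (- p)) * ennreal (h t) \<partial>lborel) + (\<integral>\<^sup>+t. (\<integral>\<^sup>+x. ennreal (indicator {..x} t * h t) * ennreal (?w x) \<partial>lborel) \<partial>lborel)"
  proof (subst nn_integral_add[symmetric])
    show "(\<lambda>t. \<integral>\<^sup>+x. ennreal (indicator {..x} t * h t) * ennreal (?w x) \<partial>lborel) \<in> borel_measurable lborel"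
      by measurable
    show "(\<lambda>t. ennreal (T powr (- p)) * ennreal (h t)) \<in> borel_measurable lborel"
      by measurable
  qed (rule nn_integral_cong, rule inner)
  have 2: "(\<integral>\<^sup>+t. (\<integral>\<^sup>+x. ennreal (indicator {..x} t * h t) * ennreal (?w x) \<partial>lborel) \<partial>lborel) \<le> ennreal (M * p * (T powr (e - p) / (e - p)))"
  proof -
    have "(\<integral>\<^sup>+t. (\<integral>\<^sup>+x. ennreal (indicator {..x} t * h t) * ennreal (?w x) \<partial>lborel) \<partial>lborel)
       = (\<integral>\<^sup>+x. (\<integral>\<^sup>+t. ennreal (indicator {..x} t * h t) * ennreal (?w x) \<partial>lborel) \<partial>lborel)"
      by (rule lborel_pair.Fubini') measurable
    also have "\<dots> = (\<integral>\<^sup>+x. ennreal (\<integral>t. indicator {..x} t * h t \<partial>lborel) * ennreal (?w x) \<partial>lborel)"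
    proof (rule nn_integral_cong)
      fix x
      show "(\<integral>\<^sup>+t. ennreal (indicator {..x} t * h t) * ennreal (?w x) \<partial>lborel) = ennreal (\<integral>t. indicator {..x} t * h t \<partial>lborel) * ennreal (?w x)"
        unfolding hN[symmetric] by (rule nn_integral_multc) measurable
    qed
    also have "\<dots> \<le> (\<integral>\<^sup>+x. ennreal (indicator {0<..T} x * (M * p * x powr (e - p - 1))) \<partial>lborel)"
    proof (rule nn_integral_mono)
      fix x
      show "ennreal (\<integral>t. indicator {..x} t * h t \<partial>lborel) * ennreal (?w x) \<le> ennreal (indicator {0<..T} x * (M * p * x powr (e - p - 1)))"
      proof (cases "0 < x \<and> x \<le> T")
        case True
        then have "ennreal (\<integral>t. indicator {..x} t * h t \<partial>lborel) * ennreal (?w x) \<le> ennreal (M * x powr e) * ennreal (?w x)"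
          using \<Phi>[of x] by (intro mult_right_mono ennreal_leI) auto
        also have "\<dots> = ennreal (M * x powr e * (p * x powr (- p - 1)))"
          using True M p by (simp add: ennreal_mult)
        also have "M * x powr e * (p * x powr (- p - 1)) = M * p * x powr (e - p - 1)"
        proof -
          have "x powr e * x powr (- p - 1) = x powr (e - p - 1)"
            by (simp add: powr_add[symmetric] algebra_simps)
          then show ?thesis by (simp add: ac_simps)
        qed
        finally show ?thesis using True by simp
      qed auto
    qed
    finally show ?thesis unfolding wI .
  qed
  have 1: "(\<integral>\<^sup>+t. ennreal (T powr (- p)) * ennreal (h t) \<partial>lborel) \<le> ennreal (T powr (- p)) * ennreal (M * T powr e)"
    by (simp add: nn_integral_cmult mult_left_mono hN')
  have 3: "ennreal (T powr (- p)) * ennreal (M * T powr e) + ennreal (M * p * (T powr (e - p) / (e - p))) = ennreal (M * (T powr (e - p) * (1 + p / (e - p))))"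
  proof -
    have "T powr (- p) * T powr e = T powr (e - p)" by (simp add: powr_add[symmetric])
    then have "T powr (- p) * (M * T powr e) + M * p * (T powr (e - p) / (e - p)) = M * (T powr (e - p) * (1 + p / (e - p)))"
      by (simp add: algebra_simps)
    then show ?thesis using M p by (simp add: ennreal_mult[symmetric] ennreal_plus[symmetric] del: ennreal_plus)
  qed
  have fin: "(\<integral>\<^sup>+t. ennreal (t powr (- p) * h t) \<partial>lborel) \<le> ennreal (M * (T powr (e - p) * (1 + p / (e - p))))"
    unfolding split 3[symmetric] by (rule add_mono[OF 1 2])
  show i: "integrable lborel (\<lambda>t. t powr (- p) * h t)"
    using h(2) fin by (intro integrableI_bounded) (auto simp: le_less_trans[OF _ ennreal_less_top])
  show "(\<integral>t. t powr (- p) * h t \<partial>lborel) \<le> M * (T powr (e - p) * (1 + p / (e - p)))"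
    using fin h(2) M p by (subst (asm) nn_integral_eq_integral[OF i]) (auto simp: ennreal_le_iff)
qed

section \<open>Weighted estimates\<close>

text \<open>As t^(2 \<theta>) s^2 = t^(-p) (t s)^2 with p = 2 - 2 \<theta>, the moment bounds and
  \<open>layer_cake_powr\<close> apply. The additional L1 bound is what Young's inequality needs
  later to control s * g.\<close>

lemma resolvent_weighted_bound:
  assumes \<alpha>: "0 < \<alpha>" "\<alpha> < 1" and \<gamma>: "0 < \<gamma>" "\<gamma> < 1" and \<theta>: "1/2 - \<alpha> * (1 - \<gamma>) < \<theta>" "\<theta> < 1/2" and T: "T > 0"
  obtains K where "K \<ge> 0"
    "\<And>lam s. lam > 0 \<Longrightarrow> L1loc s \<Longrightarrow> cls s + (lam *\<^sub>R cls (rl_ker \<alpha>)) * cls s = lam *\<^sub>R cls (rl_ker \<alpha>) \<Longrightarrow>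
       integrable lborel (\<lambda>t. (t powr \<theta> * trunc T s t)\<^sup>2) \<and>
       (\<integral>t. (t powr \<theta> * trunc T s t)\<^sup>2 \<partial>lborel) \<le> K * lam powr (2 * (1 - \<gamma>)) \<and>
       (\<integral>t. \<bar>trunc T s t\<bar> \<partial>lborel)\<^sup>2 \<le> K * lam powr (2 * (1 - \<gamma>))"
proof -
  define e where "e = 1 + 2 * \<alpha> * (1 - \<gamma>)"
  define p where "p = 2 - 2 * \<theta>"
  \<comment> \<open>The inequality p < e is exactly the lower bound on \<theta>.\<close>
  have p: "0 < p" "p < e" using \<theta> by (auto simp: p_def e_def)
  define G where "G = 1 / (Gamma (\<alpha> + 1))\<^sup>2"
  define M0 where "M0 = 4 powr \<gamma> * G powr (1 - \<gamma>)"
  define K1 where "K1 = M0 * (T powr (e - p) * (1 + p / (e - p)))"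
  define K2 where "K2 = T powr (1 - 2 * \<theta>) / (1 - 2 * \<theta>)"
  have nn: "G \<ge> 0" "M0 \<ge> 0" "K1 \<ge> 0" "K2 \<ge> 0" using p \<theta> by (auto simp: G_def M0_def K1_def K2_def)
  have main: "integrable lborel (\<lambda>t. (t powr \<theta> * trunc T s t)\<^sup>2) \<and>
       (\<integral>t. (t powr \<theta> * trunc T s t)\<^sup>2 \<partial>lborel) \<le> K1 * lam powr (2 * (1 - \<gamma>)) \<and>
       (\<integral>t. \<bar>trunc T s t\<bar> \<partial>lborel)\<^sup>2 \<le> K2 * (K1 * lam powr (2 * (1 - \<gamma>)))"
    if lam: "lam > 0" and s: "L1loc s" and eq: "cls s + (lam *\<^sub>R cls (rl_ker \<alpha>)) * cls s = lam *\<^sub>R cls (rl_ker \<alpha>)" for lam s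
  proof -
    note [measurable] = L1loc_measurable[OF s] L1loc_measurable[OF L1loc_tmult[OF s]]
    have ts: "L2loc (tmult s)" by (rule resolvent_moment_bounds(1)[OF \<alpha> _ s order_refl eq]) (use lam in simp)
    define h where "h t = (trunc T (tmult s) t)\<^sup>2" for t
    define M where "M = M0 * lam powr (2 * (1 - \<gamma>))"
    have M: "M \<ge> 0" using nn by (simp add: M_def)
    have h: "integrable lborel h" unfolding h_def[abs_def] using ts by (simp add: L2loc_def)
    have \<Phi>: "(\<integral>t. indicator {..r} t * h t \<partial>lborel) \<le> M * r powr e" if r: "0 < r" "r \<le> T" for r
    proof -
      have "(\<lambda>t. indicator {..r} t * h t) = (\<lambda>t. (trunc r (tmult s) t)\<^sup>2)"
        using r by (auto simp: h_def trunc_def indicator_def fun_eq_iff)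
      then have "(\<integral>t. indicator {..r} t * h t \<partial>lborel) = wsq 0 r (tmult s)" by (simp add: wsq_def wtrunc0)
      also have "\<dots> \<le> (4 * r) powr \<gamma> * (lam\<^sup>2 * (r powr (2 * \<alpha> + 1) / (Gamma (\<alpha> + 1))\<^sup>2)) powr (1 - \<gamma>)"
        using resolvent_moment_bounds(2,3)[OF \<alpha> _ s _ eq, of r] lam r \<gamma> by (intro min_le_geometric wsq_nonneg) auto
      also have "\<dots> = M * r powr e"
      proof -
        have "lam\<^sup>2 * (r powr (2 * \<alpha> + 1) / (Gamma (\<alpha> + 1))\<^sup>2) = lam powr 2 * r powr (2 * \<alpha> + 1) * G"
          using lam by (simp add: G_def)
        then have "(lam\<^sup>2 * (r powr (2 * \<alpha> + 1) / (Gamma (\<alpha> + 1))\<^sup>2)) powr (1 - \<gamma>)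
           = lam powr (2 * (1 - \<gamma>)) * r powr ((2 * \<alpha> + 1) * (1 - \<gamma>)) * G powr (1 - \<gamma>)"
          using nn by (simp add: powr_mult powr_powr)
        moreover have "r powr \<gamma> * r powr ((2 * \<alpha> + 1) * (1 - \<gamma>)) = r powr e"
          by (simp add: powr_add[symmetric] e_def algebra_simps)
        ultimately show ?thesis using r by (simp add: M_def M0_def powr_mult ac_simps)
      qed
      finally show ?thesis .
    qed
    have h0: "h t = 0" if "t \<le> 0" for t
      using that L1loc_neg[OF s, of t] by (cases "t = 0") (auto simp: h_def tmult_def trunc_def)
    have hT: "h t = 0" if "t > T" for t using that by (auto simp: h_def trunc_def)
    have hnn: "0 \<le> h t" for t by (simp add: h_def)
    note L = layer_cake_powr[OF h hnn h0 hT \<Phi> p T M]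
    have heq: "t powr (- p) * h t = (t powr \<theta> * trunc T s t)\<^sup>2" for t
    proof (cases "t > 0")
      case True
      have "t powr (- p) * (t * t) = t powr (- p) * (t powr 1 * t powr 1)" using True by simp
      also have "\<dots> = t powr (2 * \<theta>)" by (simp only: powr_add[symmetric]) (simp add: p_def)
      also have "\<dots> = t powr \<theta> * t powr \<theta>" by (simp add: powr_add[symmetric])
      finally show ?thesis
        using True by (simp add: h_def trunc_def tmult_def power2_eq_square ac_simps) 
    next
      case False
      then show ?thesis using h0[of t] L1loc_neg[OF s, of t] by (cases "t = 0") (auto simp: trunc_def)
    qed
    have A: "integrable lborel (\<lambda>t. (t powr \<theta> * trunc T s t)\<^sup>2)"
      "(\<integral>t. (t powr \<theta> * trunc T s t)\<^sup>2 \<partial>lborel) \<le> K1 * lam powr (2 * (1 - \<gamma>))"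
      using L unfolding heq by (simp_all add: K1_def M_def ac_simps)
    \<comment> \<open>Cauchy--Schwarz with the weight t^(- 2 \<theta>), integrable because \<theta>
      < 1/2: F H is |s| almost everywhere, and F H^2 is the weighted square just bounded.\<close>
    define F where "F t = indicator {0..T} t * t powr (- 2 * \<theta>)" for t
    define H where "H t = t powr (2 * \<theta>) * \<bar>trunc T s t\<bar>" for t
    have \<theta>': "1 - 2 * \<theta> > 0" using \<theta> by simp
    have F: "integrable lborel F" "(\<integral>t. F t \<partial>lborel) = K2"
      using powr_integrable_Icc[OF \<theta>', of T] T by (simp_all add: set_integrable_def set_lebesgue_integral_def F_def[abs_def] K2_def)
    have FH2: "F t * (H t)\<^sup>2 = (t powr \<theta> * trunc T s t)\<^sup>2" for t
    proof (cases "0 < t \<and> t \<le> T")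
      case True
      have "t powr (- 2 * \<theta>) * (t powr (2 * \<theta>) * t powr (2 * \<theta>)) = t powr \<theta> * t powr \<theta>"
        by (simp add: powr_add[symmetric])
      then show ?thesis using True by (simp add: F_def H_def power2_eq_square trunc_def ac_simps)
    next
      case False
      then show ?thesis using L1loc_neg[OF s, of t] by (cases "t = 0") (auto simp: trunc_def F_def H_def)
    qed
    have "F t * H t = \<bar>trunc T s t\<bar>" if "t \<noteq> 0" for t
    proof (cases "0 < t \<and> t \<le> T")
      case True
      have "t powr (- 2 * \<theta>) * t powr (2 * \<theta>) = 1" using True by (simp add: powr_add[symmetric])
      then show ?thesis using True by (simp add: F_def H_def trunc_def ac_simps)
    next
      case False
      then show ?thesis using that L1loc_neg[OF s, of t] by (auto simp: trunc_def F_def H_def)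
    qed
    then have "(\<integral>t. F t * H t \<partial>lborel) = (\<integral>t. \<bar>trunc T s t\<bar> \<partial>lborel)"
      using AE_lborel_singleton[of 0] by (intro integral_cong_AE) (auto simp: F_def[abs_def] H_def[abs_def] elim: eventually_mono)
    moreover have "(\<integral>t. F t * H t \<partial>lborel)\<^sup>2 \<le> (\<integral>t. F t \<partial>lborel) * (\<integral>t. F t * (H t)\<^sup>2 \<partial>lborel)"
      using F(1) A(1) by (intro cauchy_weight(2)) (auto simp: FH2, auto simp: F_def H_def[abs_def])
    ultimately have "(\<integral>t. \<bar>trunc T s t\<bar> \<partial>lborel)\<^sup>2 \<le> K2 * (\<integral>t. (t powr \<theta> * trunc T s t)\<^sup>2 \<partial>lborel)"
      by (simp add: FH2 F)
    also have "\<dots> \<le> K2 * (K1 * lam powr (2 * (1 - \<gamma>)))" using A(2) nn by (intro mult_left_mono)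
    finally show ?thesis using A by simp
  qed
  show ?thesis
  proof (rule that[of "K1 + K2 * K1"])
    show "K1 + K2 * K1 \<ge> 0" using nn by simp
    fix lam s assume a: "lam > 0" "L1loc s" "cls s + (lam *\<^sub>R cls (rl_ker \<alpha>)) * cls s = lam *\<^sub>R cls (rl_ker \<alpha>)"
    have "0 \<le> K1 * lam powr (2 * (1 - \<gamma>))" "0 \<le> K2 * (K1 * lam powr (2 * (1 - \<gamma>)))" using nn by simp_all
    then show "integrable lborel (\<lambda>t. (t powr \<theta> * trunc T s t)\<^sup>2) \<and>
       (\<integral>t. (t powr \<theta> * trunc T s t)\<^sup>2 \<partial>lborel) \<le> (K1 + K2 * K1) * lam powr (2 * (1 - \<gamma>)) \<and>
       (\<integral>t. \<bar>trunc T s t\<bar> \<partial>lborel)\<^sup>2 \<le> (K1 + K2 * K1) * lam powr (2 * (1 - \<gamma>))"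
      using main[OF a] by (simp add: algebra_simps)
  qed
qed

text \<open>On [0, r] the exponential weight lies between exp (- \<sigma> r) and 1, so changing
  norms costs a factor free of \<open>lam\<close>.\<close>

lemma wsq_le_wsq0:
  assumes f: "L2loc f" and s: "\<sigma> \<ge> 0"
  shows "wsq \<sigma> r f \<le> wsq 0 r f" "wsq 0 r f \<le> exp (2 * \<sigma> * \<bar>r\<bar>) * wsq \<sigma> r f"
proof -
  note fl = L2loc_L1loc[OF f]
  note i = wtrunc_square_integrable[OF f s, of r] wtrunc_square_integrable[OF f order_refl, of r]
  show "wsq \<sigma> r f \<le> wsq 0 r f" unfolding wsq_def
  proof (rule integral_mono[OF i])
    show "(wtrunc \<sigma> r f x)\<^sup>2 \<le> (wtrunc 0 r f x)\<^sup>2" for x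
      using exp_weight_bound[of f \<sigma> x r, OF L1loc_neg[OF fl] s] by (simp add: wtrunc_def abs_le_square_iff[symmetric])
  qed
  have "wsq 0 r f \<le> (\<integral>x. exp (2 * \<sigma> * \<bar>r\<bar>) * (wtrunc \<sigma> r f x)\<^sup>2 \<partial>lborel)" unfolding wsq_def
  proof (rule integral_mono[OF i(2)])
    show "integrable lborel (\<lambda>x. exp (2 * \<sigma> * \<bar>r\<bar>) * (wtrunc \<sigma> r f x)\<^sup>2)" using i(1) by simp
    fix x
    show "(wtrunc 0 r f x)\<^sup>2 \<le> exp (2 * \<sigma> * \<bar>r\<bar>) * (wtrunc \<sigma> r f x)\<^sup>2"
    proof (cases "x \<le> r")
      case True
      then have "\<sigma> * x \<le> \<sigma> * \<bar>r\<bar>" using s by (intro mult_left_mono) auto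
      then have "1 \<le> exp (\<sigma> * \<bar>r\<bar> - \<sigma> * x)" by simp
      also have "\<dots> = exp (\<sigma> * \<bar>r\<bar>) * exp (- \<sigma> * x)" by (simp add: exp_add[symmetric])
      finally have "\<bar>wtrunc 0 r f x\<bar> \<le> \<bar>exp (\<sigma> * \<bar>r\<bar>) * wtrunc \<sigma> r f x\<bar>"
        using mult_right_mono[OF _ abs_ge_zero[of "f x"], of 1 "exp (\<sigma> * \<bar>r\<bar>) * exp (- \<sigma> * x)"] True
        by (simp add: wtrunc_def trunc_def abs_mult mult.assoc)
      then have "(wtrunc 0 r f x)\<^sup>2 \<le> (exp (\<sigma> * \<bar>r\<bar>) * wtrunc \<sigma> r f x)\<^sup>2" by (simp add: abs_le_square_iff)
      also have "\<dots> = exp (2 * \<sigma> * \<bar>r\<bar>) * (wtrunc \<sigma> r f x)\<^sup>2"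
        by (simp add: power_mult_distrib power2_eq_square[of "exp _"] exp_add[symmetric])
      finally show ?thesis .
    qed (simp add: wtrunc_def trunc_def)
  qed
  then show "wsq 0 r f \<le> exp (2 * \<sigma> * \<bar>r\<bar>) * wsq \<sigma> r f" by (simp add: wsq_def)
qed

text \<open>The expression for \<open>cls p\<close> is what differentiating u = f - \<rho> * f
  yields when f = f0 + 1 * fp. It is estimated by trading f0 \<rho> for f0 s0 and a
  square-integrable remainder, where \<open>s0\<close> is the resolvent of lam beta alone.\<close>

lemma regularity:
  assumes \<alpha>: "0 < \<alpha>" "\<alpha> < 1" and \<gamma>: "0 < \<gamma>" "\<gamma> < 1" and \<theta>: "1/2 - \<alpha> * (1 - \<gamma>) < \<theta>" "\<theta> < 1/2" "0 \<le> \<theta>" and T: "T > 0"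
    and g: "L2loc g" and s: "\<sigma> \<ge> 0" and small: "(\<integral>x. \<bar>wtrunc \<sigma> T g x\<bar> \<partial>lborel) \<le> 1/4"
  obtains Q where "Q \<ge> 0"
    "\<And>lam \<rho> fp f0. lam > 0 \<Longrightarrow> L1loc \<rho> \<Longrightarrow> L2loc fp \<Longrightarrow>
       cls \<rho> + (lam *\<^sub>R (cls (rl_ker \<alpha>) + cls (rl_ker \<alpha>) * cls g)) * cls \<rho> = lam *\<^sub>R (cls (rl_ker \<alpha>) + cls (rl_ker \<alpha>) * cls g) \<Longrightarrow>
       \<exists>p. L1loc p \<and> cls p = cls fp - cls \<rho> * cls fp - f0 *\<^sub>R cls \<rho> \<and>
         integrable lborel (\<lambda>t. (t powr \<theta> * trunc T p t)\<^sup>2) \<and>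
         (\<integral>t. (t powr \<theta> * trunc T p t)\<^sup>2 \<partial>lborel) \<le> Q * (wsq 0 T fp + lam powr (2 * (1 - \<gamma>)) * f0\<^sup>2)"
proof -
  obtain K where K: "K \<ge> 0"
    "\<And>lam s. lam > 0 \<Longrightarrow> L1loc s \<Longrightarrow> cls s + (lam *\<^sub>R cls (rl_ker \<alpha>)) * cls s = lam *\<^sub>R cls (rl_ker \<alpha>) \<Longrightarrow>
       integrable lborel (\<lambda>t. (t powr \<theta> * trunc T s t)\<^sup>2) \<and>
       (\<integral>t. (t powr \<theta> * trunc T s t)\<^sup>2 \<partial>lborel) \<le> K * lam powr (2 * (1 - \<gamma>)) \<and>
       (\<integral>t. \<bar>trunc T s t\<bar> \<partial>lborel)\<^sup>2 \<le> K * lam powr (2 * (1 - \<gamma>))"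
    using resolvent_weighted_bound[OF \<alpha> \<gamma> \<theta>(1,2) T] by blast
  \<comment> \<open>Three losses are collected: t^\<theta> \<le> T^\<theta>, the removal of the
    exponential weight, and 16 = 8 * 2 from \<open>stability\<close> and from splitting h into two
    terms.\<close>
  define E where "E = (T powr \<theta>)\<^sup>2 * (exp (2 * \<sigma> * T) * 16)"
  define Q where "Q = 2 * E + 2 * E * (K * wsq 0 T g) + 2 * K"
  have E: "E \<ge> 0" by (simp add: E_def)
  note gl = L2loc_L1loc[OF g]
  have lb: "L1loc (rl_ker \<alpha>)" using \<alpha> by (simp add: L1loc_rl_ker)
  show ?thesis
  proof (rule that[of Q])
    show "Q \<ge> 0" using E K(1) wsq_nonneg[of 0 T g] by (simp add: Q_def)
    fix lam \<rho> fp and f0 :: real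
    assume lam: "lam > 0" and \<rho>: "L1loc \<rho>" and fp: "L2loc fp"
      and res: "cls \<rho> + (lam *\<^sub>R (cls (rl_ker \<alpha>) + cls (rl_ker \<alpha>) * cls g)) * cls \<rho> = lam *\<^sub>R (cls (rl_ker \<alpha>) + cls (rl_ker \<alpha>) * cls g)"
    define L where "L = lam powr (2 * (1 - \<gamma>))"
    have L: "L \<ge> 0" by (simp add: L_def)
    define k where "k = lam *\<^sub>R (cls (rl_ker \<alpha>) + cls (rl_ker \<alpha>) * cls g)"
    note res' = res[folded k_def]
    obtain s0 where s0: "L1loc s0" "cls s0 + cls (\<lambda>x. lam * rl_ker \<alpha> x) * cls s0 = cls (\<lambda>x. lam * rl_ker \<alpha> x)"
      using resolvent_exists[OF exp_integrable_scale[OF exp_integrable_rl_ker[OF \<alpha>(1)]]] by blast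
    have seq: "cls s0 + (lam *\<^sub>R cls (rl_ker \<alpha>)) * cls s0 = lam *\<^sub>R cls (rl_ker \<alpha>)"
      using s0(2) lb by (simp add: cls_scaleR)
    note Ks = K(2)[OF lam s0(1) seq, folded L_def]
    define gs where "gs = convl s0 g"
    have gs: "L2loc gs" unfolding gs_def by (rule L2loc_convl[OF s0(1) g order_refl])
    have cgs: "cls gs = cls s0 * cls g" using s0(1) gl by (simp add: gs_def cls_mult)
    define h where "h x = fp x - f0 * gs x" for x
    have h: "L2loc h" unfolding h_def by (intro L2loc_diff L2loc_scale fp gs)
    define q where "q x = h x - convl \<rho> h x" for x
    have q: "L2loc q" unfolding q_def by (intro L2loc_diff h L2loc_convl[OF \<rho> h order_refl])
    define p where "p x = q x - f0 * s0 x" for x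
    note hl = L2loc_L1loc[OF h] and ql = L2loc_L1loc[OF q] and fpl = L2loc_L1loc[OF fp] and gsl = L2loc_L1loc[OF gs]
    have p: "L1loc p" unfolding p_def by (intro L1loc_diff ql L1loc_scale s0(1))
    have ch: "cls h = cls fp - f0 *\<^sub>R (cls s0 * cls g)"
      using fpl gsl by (simp add: h_def[abs_def] cgs[symmetric] cls_diff[symmetric] cls_scaleR L1loc_scale)
    have cq: "cls q = cls h - cls \<rho> * cls h"
      using hl \<rho> by (simp add: q_def[abs_def] cls_mult cls_diff L1loc_convl)
    have cp: "cls p = cls q - f0 *\<^sub>R cls s0"
      using ql s0(1) by (simp add: p_def[abs_def] cls_scaleR cls_diff L1loc_scale)
    have qeq: "cls q + k * cls q = cls h" unfolding cq by (rule resolvent_solves[OF res'])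
    have peq: "cls p + k * cls p = cls fp - f0 *\<^sub>R k"
    proof -
      have "cls p + k * cls p = cls h - f0 *\<^sub>R (cls s0 + k * cls s0)"
        unfolding cp qeq[symmetric] by (simp add: algebra_simps)
      \<comment> \<open>With b = lam beta and k = b + b * g, the equation s0 + b * s0 = b gives s0 +
        k * s0 = b + g * (b - s0) = k - s0 * g. The term s0 * g then cancels against the one in h,
        leaving fp - f0 k.\<close>
      also have "cls s0 + k * cls s0 = (cls s0 + (lam *\<^sub>R cls (rl_ker \<alpha>)) * cls s0) + cls g * ((cls s0 + (lam *\<^sub>R cls (rl_ker \<alpha>)) * cls s0) - cls s0)"
        by (simp add: k_def algebra_simps)
      also have "\<dots> = k - cls s0 * cls g" unfolding seq by (simp add: k_def algebra_simps)
      finally show ?thesis by (simp add: ch algebra_simps)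
    qed
    have "cls p = (cls fp - f0 *\<^sub>R k) - cls \<rho> * (cls fp - f0 *\<^sub>R k)"
      by (rule resolvent_unique[OF res' peq])
    also have "\<dots> = cls fp - cls \<rho> * cls fp - f0 *\<^sub>R (k - k * cls \<rho>)" by (simp add: algebra_simps)
    also have "k - k * cls \<rho> = cls \<rho>" by (subst (1) res'[symmetric]) simp
    finally have cpf: "cls p = cls fp - cls \<rho> * cls fp - f0 *\<^sub>R cls \<rho>" .
    have "cls q + lam *\<^sub>R (cls (rl_ker \<alpha>) * (cls q + cls g * cls q)) = cls h"
      using qeq by (simp add: k_def algebra_simps)
    from stability[OF \<alpha> q h gl _ s small this] lam have "wsq \<sigma> T q \<le> 8 * wsq \<sigma> T h" by simp
    also have "wsq \<sigma> T h \<le> wsq 0 T h" by (rule wsq_le_wsq0[OF h s])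
    also have "\<dots> \<le> 2 * wsq 0 T fp + 2 * (f0\<^sup>2 * wsq 0 T gs)"
      using wsq_diff[OF fp L2loc_scale[OF gs, of f0] order_refl, of T] by (simp add: h_def[abs_def] wsq_scale)
    finally have q1: "wsq \<sigma> T q \<le> 16 * (wsq 0 T fp + f0\<^sup>2 * wsq 0 T gs)" by simp
    have "wsq 0 T gs \<le> (\<integral>x. \<bar>trunc T s0 x\<bar> \<partial>lborel)\<^sup>2 * wsq 0 T g"
      using wsq_convl[OF s0(1) g order_refl, of T] by (simp add: gs_def wtrunc0)
    also have "\<dots> \<le> K * L * wsq 0 T g" using Ks by (intro mult_right_mono wsq_nonneg) auto
    finally have gs1: "wsq 0 T gs \<le> K * L * wsq 0 T g" .
    have "wsq 0 T q \<le> exp (2 * \<sigma> * T) * wsq \<sigma> T q" using wsq_le_wsq0(2)[OF q s, of T] T by simp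
    also have "\<dots> \<le> exp (2 * \<sigma> * T) * (16 * (wsq 0 T fp + f0\<^sup>2 * (K * L * wsq 0 T g)))"
      using q1 mult_left_mono[OF gs1, of "f0\<^sup>2"] by (intro mult_left_mono) auto
    finally have "(T powr \<theta>)\<^sup>2 * wsq 0 T q \<le> (T powr \<theta>)\<^sup>2 * (exp (2 * \<sigma> * T) * (16 * (wsq 0 T fp + f0\<^sup>2 * (K * L * wsq 0 T g))))"
      by (intro mult_left_mono) auto
    then have q2: "(T powr \<theta>)\<^sup>2 * wsq 0 T q \<le> E * (wsq 0 T fp + f0\<^sup>2 * (K * L * wsq 0 T g))"
      by (simp add: E_def mult.assoc)
    let ?R = "\<lambda>t. 2 * ((T powr \<theta>)\<^sup>2 * (trunc T q t)\<^sup>2) + 2 * (f0\<^sup>2 * (t powr \<theta> * trunc T s0 t)\<^sup>2)"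
    have b: "(t powr \<theta> * trunc T p t)\<^sup>2 \<le> ?R t" for t
    proof -
      have "t powr \<theta> * trunc T p t = t powr \<theta> * trunc T q t + - f0 * (t powr \<theta> * trunc T s0 t)"
        by (simp add: p_def[abs_def] trunc_def algebra_simps)
      then have "(t powr \<theta> * trunc T p t)\<^sup>2 \<le> 2 * (t powr \<theta> * trunc T q t)\<^sup>2 + 2 * (- f0 * (t powr \<theta> * trunc T s0 t))\<^sup>2"
        using square_add_le by metis
      also have "(t powr \<theta> * trunc T q t)\<^sup>2 \<le> (T powr \<theta> * trunc T q t)\<^sup>2"
      proof (cases "0 \<le> t \<and> t \<le> T")
        case True
        then have "t powr \<theta> \<le> T powr \<theta>" using \<theta> by (intro powr_mono2) auto
        from mult_right_mono[OF this abs_ge_zero[of "trunc T q t"]]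
        show ?thesis by (simp add: abs_mult abs_le_square_iff[symmetric])
      qed (use L1loc_neg[OF ql, of t] in \<open>auto simp: trunc_def\<close>)
      finally show ?thesis by (simp add: power_mult_distrib)
    qed
    have iR: "integrable lborel ?R" using q Ks by (intro Bochner_Integration.integrable_add Bochner_Integration.integrable_mult_right) (auto simp: L2loc_def)
    note [measurable] = L1loc_measurable[OF p]
    have ip: "integrable lborel (\<lambda>t. (t powr \<theta> * trunc T p t)\<^sup>2)"
    proof (rule Bochner_Integration.integrable_bound[OF iR])
      show "AE t in lborel. norm ((t powr \<theta> * trunc T p t)\<^sup>2) \<le> norm (?R t)"
      proof (rule AE_I2)
        fix t :: real
        show "norm ((t powr \<theta> * trunc T p t)\<^sup>2) \<le> norm (?R t)"
          using b[of t] abs_ge_self[of "?R t"] unfolding real_norm_def abs_power2 abs_of_nonneg[OF zero_le_power2] by linarith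
      qed
    qed measurable
    have "(\<integral>t. (t powr \<theta> * trunc T p t)\<^sup>2 \<partial>lborel) \<le> (\<integral>t. ?R t \<partial>lborel)"
      by (rule integral_mono[OF ip iR b])
    also have "\<dots> = 2 * ((T powr \<theta>)\<^sup>2 * wsq 0 T q) + 2 * (f0\<^sup>2 * (\<integral>t. (t powr \<theta> * trunc T s0 t)\<^sup>2 \<partial>lborel))"
      using q Ks by (simp add: L2loc_def wsq_def wtrunc0)
    also have "\<dots> \<le> 2 * (E * (wsq 0 T fp + f0\<^sup>2 * (K * L * wsq 0 T g))) + 2 * (f0\<^sup>2 * (K * L))"
      using q2 Ks by (intro add_mono mult_left_mono) auto
    also have "\<dots> = 2 * E * wsq 0 T fp + (2 * E * (K * wsq 0 T g) + 2 * K) * (L * f0\<^sup>2)"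
      by (simp add: algebra_simps)
    also have "\<dots> \<le> Q * wsq 0 T fp + Q * (L * f0\<^sup>2)"
      using E K(1) L wsq_nonneg[of 0 T g] wsq_nonneg[of 0 T fp]
      by (intro add_mono mult_right_mono) (auto simp: Q_def)
    finally have "(\<integral>t. (t powr \<theta> * trunc T p t)\<^sup>2 \<partial>lborel) \<le> Q * (wsq 0 T fp + L * f0\<^sup>2)" by (simp add: distrib_left)
    with p cpf ip show "\<exists>p. L1loc p \<and> cls p = cls fp - cls \<rho> * cls fp - f0 *\<^sub>R cls \<rho> \<and>
         integrable lborel (\<lambda>t. (t powr \<theta> * trunc T p t)\<^sup>2) \<and>
         (\<integral>t. (t powr \<theta> * trunc T p t)\<^sup>2 \<partial>lborel) \<le> Q * (wsq 0 T fp + lam powr (2 * (1 - \<gamma>)) * f0\<^sup>2)"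
      unfolding L_def by blast
  qed
qed

section \<open>The derivative of the kernel g\<close>

text \<open>The substitution s = t z turns the kernel g into the integral of a weight against
  the dilates of x powr (alpha x - alpha 0) / Gamma (alpha x), a function whose derivative is only
  logarithmically singular.\<close>

lemma powr_ln_bound:
  assumes "e > 0" "0 < x" "x \<le> (T::real)"
  shows "\<bar>ln x\<bar> \<le> (1 / e + T powr e * \<bar>ln T\<bar>) * x powr (- e)"
proof -
  have T: "T > 0" using assms by simp
  show ?thesis
  proof (cases "x \<le> 1")
    case True
    have "\<bar>ln x\<bar> = ln (1 / x)" using True assms by (simp add: ln_div)
    also have "\<dots> \<le> (1 / x) powr e / e" using True assms by (intro ln_powr_bound) auto
    also have "\<dots> = 1 / e * x powr (- e)" using assms by (simp add: powr_minus powr_divide field_simps)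
    also have "\<dots> \<le> (1 / e + T powr e * \<bar>ln T\<bar>) * x powr (- e)" by (intro mult_right_mono) auto
    finally show ?thesis .
  next
    case False
    have "T powr e * x powr (- e) = (T / x) powr e" using assms T by (simp add: powr_minus powr_divide field_simps)
    moreover have "1 \<le> (T / x) powr e" using assms False by (intro ge_one_powr_ge_zero) (auto simp: field_simps)
    ultimately have 1: "1 \<le> T powr e * x powr (- e)" by simp
    have "\<bar>ln x\<bar> \<le> \<bar>ln T\<bar> * 1" using False assms by simp
    also have "\<dots> \<le> \<bar>ln T\<bar> * (T powr e * x powr (- e))" using 1 by (intro mult_left_mono) auto
    also have "\<dots> \<le> (1 / e + T powr e * \<bar>ln T\<bar>) * x powr (- e)" using assms by (simp add: algebra_simps)
    finally show ?thesis .
  qed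
qed

text \<open>Differentiation under the integral by dominated convergence. For |X n| < t/2 the segment
  from t z to (t + X n) z stays above t z/2, so the mean value inequality bounds the weighted
  difference quotient by C (t/2)^(-e) z^(1 - e) w z.\<close>

lemma dilation_integral_has_derivative:
  fixes w H H' :: "real \<Rightarrow> real"
  assumes w: "w \<in> borel_measurable borel" "\<And>z. 0 \<le> w z" "\<And>z. z \<notin> {0<..<1} \<Longrightarrow> w z = 0"
    and iw: "integrable lborel w" "integrable lborel (\<lambda>z. w z * z powr (1 - e))"
    and H: "H \<in> borel_measurable borel" "\<And>x. 0 < x \<Longrightarrow> x \<le> T \<Longrightarrow> \<bar>H x\<bar> \<le> B"
    and d: "\<And>x. 0 < x \<Longrightarrow> x < T \<Longrightarrow> (H has_real_derivative H' x) (at x)"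
    and b: "\<And>x. 0 < x \<Longrightarrow> x < T \<Longrightarrow> \<bar>H' x\<bar> \<le> C * x powr (- e)"
    and e: "0 \<le> e" and t: "0 < t" "t < T" and C: "0 \<le> C"
  shows "\<exists>D. ((\<lambda>t. \<integral>z. w z * H (t * z) \<partial>lborel) has_real_derivative D) (at t)
    \<and> \<bar>D\<bar> \<le> C * (\<integral>z. w z * z powr (1 - e) \<partial>lborel) * t powr (- e)"
proof -
  define D where "D = (\<integral>z. w z * (z * H' (t * z)) \<partial>lborel)"
  note [measurable] = w(1) H(1)
  have iH: "integrable lborel (\<lambda>z. w z * H (t * z))" if "0 < t" "t < T" for t
  proof (rule Bochner_Integration.integrable_bound[OF Bochner_Integration.integrable_mult_right[OF iw(1), of B]])
    have "\<bar>w z * H (t * z)\<bar> \<le> \<bar>B * w z\<bar>" for z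
    proof (cases "z \<in> {0<..<1}")
      case True
      have "t * z \<le> t * 1" using True that by (intro mult_left_mono) auto
      then have "t * z \<le> T" using that by linarith
      then have "\<bar>H (t * z)\<bar> \<le> B" using True that by (intro H(2)) auto
      then have "\<bar>H (t * z)\<bar> \<le> \<bar>B\<bar>" by simp
      from mult_left_mono[OF this w(2)[of z]] show ?thesis using w(2)[of z] by (simp add: abs_mult mult.commute)
    qed (simp add: w(3))
    then show "AE z in lborel. norm (w z * H (t * z)) \<le> norm (B * w z)" by simp
  qed measurable
  have lz: "(\<lambda>n. w z * ((H ((t + X n) * z) - H (t * z)) / X n)) \<longlonglongrightarrow> w z * (z * H' (t * z))"
    if X: "\<And>n. X n \<noteq> 0" "X \<longlonglongrightarrow> 0" for X :: "nat \<Rightarrow> real" and z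
  proof (cases "z \<in> {0<..<1}")
    case True
    have "t * z < t * 1" using True t by (intro mult_strict_left_mono) auto
    then have "t * z < T" using t by linarith
    then have "(H has_real_derivative H' (t * z)) (at (t * z))" using True t by (intro d) auto
    then have "((\<lambda>s. H (s * z)) has_real_derivative H' (t * z) * z) (at t)"
      by (rule DERIV_chain2) (auto intro!: derivative_eq_intros)
    then have "((\<lambda>h. (H ((t + h) * z) - H (t * z)) / h) \<longlongrightarrow> H' (t * z) * z) (at 0)" by (simp add: DERIV_def)
    moreover have "filterlim X (at 0) sequentially"
      using X(1,2) by (auto simp: filterlim_at)
    ultimately have "(\<lambda>n. (H ((t + X n) * z) - H (t * z)) / X n) \<longlonglongrightarrow> H' (t * z) * z"
      by (rule filterlim_compose)
    from tendsto_mult_left[OF this, of "w z"] show ?thesis by (simp add: mult.commute)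
  qed (simp add: w(3))
  \<comment> \<open>\<open>H'\<close> is given only pointwise as a derivative; measurability comes
    from the difference quotients.\<close>
  have Dm: "(\<lambda>z. w z * (z * H' (t * z))) \<in> borel_measurable lborel"
  proof (rule borel_measurable_LIMSEQ_real)
    show "(\<lambda>n. w z * ((H ((t + inverse (real (Suc n))) * z) - H (t * z)) / inverse (real (Suc n)))) \<longlonglongrightarrow> w z * (z * H' (t * z))" for z
      using LIMSEQ_inverse_real_of_nat by (intro lz) auto
  qed measurable
  have lim: "(\<lambda>n. \<integral>z. w z * ((H ((t + X n) * z) - H (t * z)) / X n) \<partial>lborel) \<longlonglongrightarrow> D"
    if X: "\<And>n. X n \<noteq> 0" "X \<longlonglongrightarrow> 0" "\<And>n. \<bar>X n\<bar> < min (t / 2) (T - t)" for X :: "nat \<Rightarrow> real"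
    unfolding D_def
  proof (rule integral_dominated_convergence)
    have pos: "t / 2 \<le> t + X n" "t + X n < T" for n using X(3)[of n] by auto
    show "integrable lborel (\<lambda>z. C * (t / 2) powr (- e) * (w z * z powr (1 - e)))" using iw by simp
    show "AE z in lborel. norm (w z * ((H ((t + X n) * z) - H (t * z)) / X n)) \<le> C * (t / 2) powr (- e) * (w z * z powr (1 - e))" for n
    proof (rule AE_I2)
      fix z
      show "norm (w z * ((H ((t + X n) * z) - H (t * z)) / X n)) \<le> C * (t / 2) powr (- e) * (w z * z powr (1 - e))"
      proof (cases "z \<in> {0<..<1}")
        case True
        have seg: "t / 2 * z \<le> y \<and> y < T" if y: "y \<in> closed_segment (t * z) ((t + X n) * z)" for y
        proof -
          define a b where "a = t * z" and "b = (t + X n) * z"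
          have "t / 2 * z \<le> b" "t / 2 * z \<le> a" unfolding a_def b_def using True pos[of n] t by auto
          moreover have "a \<le> t" "b \<le> t + X n"
            unfolding a_def b_def using True t pos[of n] by (auto intro!: mult_left_le)
          moreover have "min a b \<le> y" "y \<le> max a b"
            using y by (auto simp: closed_segment_eq_real_ivl a_def[symmetric] b_def[symmetric] split: if_splits)
          ultimately show ?thesis
            using t(2) pos(2)[of n] by (auto simp: min_def max_def split: if_splits)
        qed
        have "\<bar>H ((t + X n) * z) - H (t * z)\<bar> \<le> C * (t / 2 * z) powr (- e) * \<bar>(t + X n) * z - t * z\<bar>"
        proof (rule field_differentiable_bound[where f=H and f'=H' and S="closed_segment (t * z) ((t + X n) * z)", simplified real_norm_def])
          fix y assume y: "y \<in> closed_segment (t * z) ((t + X n) * z)"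
          have y0: "0 < t / 2 * z" using True t by simp
          have yb: "0 < y" "y < T" "t / 2 * z \<le> y" using seg[OF y] y0 by linarith+
          show "(H has_field_derivative H' y) (at y within closed_segment (t * z) ((t + X n) * z))"
            by (rule has_field_derivative_at_within[OF d[OF yb(1,2)]])
          have "\<bar>H' y\<bar> \<le> C * y powr (- e)" by (intro b yb)
          also have "\<dots> \<le> C * (t / 2 * z) powr (- e)"
            using e by (intro mult_left_mono powr_mono2' yb(3) y0 C) auto
          finally show "\<bar>H' y\<bar> \<le> C * (t / 2 * z) powr (- e)" .
        qed auto
        also have "\<bar>(t + X n) * z - t * z\<bar> = \<bar>X n\<bar> * z" using True by (simp add: algebra_simps abs_mult)
        also have "C * (t / 2 * z) powr (- e) * (\<bar>X n\<bar> * z) = \<bar>X n\<bar> * (C * (t / 2) powr (- e) * z powr (1 - e))"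
        proof -
          have "(t / 2 * z) powr (- e) * z = (t / 2) powr (- e) * z powr (1 - e)"
          proof -
            have "(t / 2 * z) powr (- e) * z = (t / 2) powr (- e) * (z * z powr (- e))"
              unfolding powr_mult by (simp only: mult.assoc mult.commute[of "z powr (- e)" z])
            also have "z * z powr (- e) = z powr (1 - e)" using True by (simp add: powr_mult_base)
            finally show ?thesis .
          qed
          then show ?thesis by (simp add: ac_simps)
        qed
        finally have "\<bar>H ((t + X n) * z) - H (t * z)\<bar> / \<bar>X n\<bar> \<le> C * (t / 2) powr (- e) * z powr (1 - e)"
          using X(1)[of n] by (simp add: field_simps)
        from mult_left_mono[OF this w(2)[of z]] show ?thesis
          using w(2)[of z] by (simp add: abs_mult ac_simps)
      qed (simp add: w(3))
    qed
    show "AE z in lborel. (\<lambda>n. w z * ((H ((t + X n) * z) - H (t * z)) / X n)) \<longlonglongrightarrow> w z * (z * H' (t * z))"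
      using lz[OF X(1,2)] by simp
  qed (use Dm in measurable)
  have "((\<lambda>t. \<integral>z. w z * H (t * z) \<partial>lborel) has_real_derivative D) (at t)"
    unfolding DERIV_def tendsto_at_iff_sequentially
  proof (intro allI impI)
    fix X :: "nat \<Rightarrow> real" assume X: "\<forall>i. X i \<in> UNIV - {0}" "X \<longlonglongrightarrow> 0"
    let ?f = "\<lambda>h. ((\<integral>z. w z * H ((t + h) * z) \<partial>lborel) - (\<integral>z. w z * H (t * z) \<partial>lborel)) / h"
    have "eventually (\<lambda>n. \<bar>X n\<bar> < min (t / 2) (T - t)) sequentially"
      using tendsto_rabs_zero[OF X(2)] t by (intro order_tendstoD(2)) auto
    then obtain N where N: "\<And>n. n \<ge> N \<Longrightarrow> \<bar>X n\<bar> < min (t / 2) (T - t)" by (auto simp: eventually_sequentially)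
    define Y where "Y n = X (n + N)" for n
    have Y: "\<And>n. Y n \<noteq> 0" "Y \<longlonglongrightarrow> 0" "\<And>n. \<bar>Y n\<bar> < min (t / 2) (T - t)"
      using X N LIMSEQ_ignore_initial_segment[OF X(2), of N] by (auto simp: Y_def[abs_def])
    have fY: "?f (Y n) = (\<integral>z. w z * ((H ((t + Y n) * z) - H (t * z)) / Y n) \<partial>lborel)" for n
    proof -
      have "(\<integral>z. w z * ((H ((t + Y n) * z) - H (t * z)) / Y n) \<partial>lborel) = (\<integral>z. (w z * H ((t + Y n) * z) - w z * H (t * z)) / Y n \<partial>lborel)"
        by (simp add: algebra_simps diff_divide_distrib)
      also have "\<dots> = ?f (Y n)"
        using iH[of t] iH[of "t + Y n"] t Y(3)[of n] by (subst integral_divide_zero, subst Bochner_Integration.integral_diff) auto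
      finally show ?thesis ..
    qed
    have "(\<lambda>n. ?f (Y n)) \<longlonglongrightarrow> D" unfolding fY by (rule lim[OF Y])
    then have "(\<lambda>n. ?f (X (n + N))) \<longlonglongrightarrow> D" unfolding Y_def .
    then show "(?f \<circ> X) \<longlonglongrightarrow> D" unfolding o_def by (rule LIMSEQ_offset)
  qed
  moreover have "\<bar>D\<bar> \<le> C * (\<integral>z. w z * z powr (1 - e) \<partial>lborel) * t powr (- e)"
  proof -
    have bz: "\<bar>w z * (z * H' (t * z))\<bar> \<le> C * t powr (- e) * (w z * z powr (1 - e))" for z
    proof (cases "z \<in> {0<..<1}")
      case True
      have "t * z < t * 1" using True t by (intro mult_strict_left_mono) auto
    then have "t * z < T" using t by linarith
      then have "\<bar>H' (t * z)\<bar> \<le> C * (t * z) powr (- e)" using True t by (intro b) auto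
      from mult_left_mono[OF this, of "w z * z"] have "\<bar>w z * (z * H' (t * z))\<bar> \<le> w z * z * (C * (t * z) powr (- e))"
        using True w(2)[of z] by (simp add: abs_mult mult.assoc)
      also have "\<dots> = C * t powr (- e) * (w z * z powr (1 - e))"
        using True t by (simp add: powr_mult powr_mult_base ac_simps)
      finally show ?thesis .
    qed (simp add: w(3))
    have i2: "integrable lborel (\<lambda>z. C * t powr (- e) * (w z * z powr (1 - e)))" using iw by simp
    have "integrable lborel (\<lambda>z. w z * (z * H' (t * z)))"
    proof (rule Bochner_Integration.integrable_bound[OF i2])
      show "AE z in lborel. norm (w z * (z * H' (t * z))) \<le> norm (C * t powr (- e) * (w z * z powr (1 - e)))"
        using bz order_trans[OF bz abs_ge_self] by (intro AE_I2) (simp only: real_norm_def)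
    qed (rule Dm)
    then have "\<bar>D\<bar> \<le> (\<integral>z. C * t powr (- e) * (w z * z powr (1 - e)) \<partial>lborel)"
      unfolding D_def using i2 bz by (intro order_trans[OF integral_abs_bound] integral_mono integrable_abs) auto
    also have "\<dots> = C * t powr (- e) * (\<integral>z. w z * z powr (1 - e) \<partial>lborel)"
      by (rule integral_mult_right_zero)
    finally show ?thesis by (simp only: mult.assoc mult.commute[of "t powr (- e)"])
  qed
  ultimately show ?thesis by blast
qed

lemma borel_measurable_deriv_on:
  fixes F :: "real \<Rightarrow> real"
  assumes [measurable]: "F \<in> borel_measurable borel"
    and d: "\<And>t. t \<in> {a<..<b} \<Longrightarrow> (F has_real_derivative F' t) (at t)"
  shows "(\<lambda>t. indicator {a<..<b} t * F' t) \<in> borel_measurable borel"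
proof (rule borel_measurable_LIMSEQ_real)
  fix t
  show "(\<lambda>n. indicator {a<..<b} t * ((F (t + inverse (real (Suc n))) - F t) / inverse (real (Suc n)))) \<longlonglongrightarrow> indicator {a<..<b} t * F' t"
  proof (cases "t \<in> {a<..<b}")
    case True
    have "((\<lambda>h. (F (t + h) - F t) / h) \<longlongrightarrow> F' t) (at 0)" using d[OF True] by (simp add: DERIV_def)
    moreover have "filterlim (\<lambda>n. inverse (real (Suc n))) (at 0) sequentially"
      using LIMSEQ_inverse_real_of_nat by (auto simp: filterlim_at)
    ultimately have "(\<lambda>n. (F (t + inverse (real (Suc n))) - F t) / inverse (real (Suc n))) \<longlonglongrightarrow> F' t"
      by (rule filterlim_compose)
    with True show ?thesis by simp
  qed simp
qed measurable

text \<open>The Lipschitz bound |\<alpha> x - \<alpha> 0| \<le> Qs x keeps x powr (\<alpha> x -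
  \<alpha> 0) bounded and also tames the term (\<alpha> x - \<alpha> 0)/x in its logarithmic
  derivative; only \<alpha>' x ln x stays singular. The representative is 0 outside (0, T), since
  \<alpha> is unconstrained beyond [0, T].\<close>

lemma g_ker_deriv:
  fixes \<alpha> \<alpha>' :: "real \<Rightarrow> real"
  assumes T: "T > 0" and r: "\<forall>t\<in>{0..T}. 0 < \<alpha> t \<and> \<alpha> t < 1"
    and d: "\<forall>t\<in>{0..T}. (\<alpha> has_real_derivative \<alpha>' t) (at t within {0..T}) \<and> \<bar>\<alpha>' t\<bar> \<le> Qs"
  obtains g where "L2loc g" "\<And>t. t \<in> {0<..<T} \<Longrightarrow> deriv (g_ker \<alpha>) t = g t" "\<And>t. t \<notin> {0<..<T} \<Longrightarrow> g t = 0"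
proof -
  define a0 where "a0 = \<alpha> 0"
  have a0: "0 < a0" "a0 < 1" using r T by (auto simp: a0_def)
  have cont: "continuous_on {0..T} \<alpha>"
    using d by (intro DERIV_continuous_on) auto
  have Qs: "Qs \<ge> 0" using d T by force
  have lip: "\<bar>\<alpha> x - a0\<bar> \<le> Qs * x" if "0 \<le> x" "x \<le> T" for x
  proof -
    have "norm (\<alpha> x - \<alpha> 0) \<le> Qs * norm (x - 0)"
      by (rule field_differentiable_bound[where S="{0..T}" and f'="\<alpha>'"]) (use d that T in auto)
    then show ?thesis using that by (simp add: a0_def)
  qed
  \<comment> \<open>Cutting \<alpha> off outside [0, T] makes it Borel measurable;
    \<open>rGamma\<close>, continuous on the whole line, stands for 1/Gamma so that the cut-off
    values cause no trouble.\<close>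
  define ac where "ac x = indicator {0..T} x *\<^sub>R \<alpha> x" for x
  have [measurable]: "ac \<in> borel_measurable borel"
    unfolding ac_def[abs_def] by (rule borel_measurable_continuous_on_indicator[OF _ cont]) simp
  have [measurable]: "(rGamma :: real \<Rightarrow> real) \<in> borel_measurable borel"
    by (intro borel_measurable_continuous_onI continuous_on_rGamma)
  define h where "h x = exp ((\<alpha> x - a0) * ln x) * rGamma (\<alpha> x)" for x
  define H where "H x = indicator {0<..T} x * (exp ((ac x - a0) * ln x) * rGamma (ac x))" for x
  have Hh: "H x = h x" if "0 < x" "x \<le> T" for x using that by (simp add: H_def h_def ac_def)
  have Hm: "H \<in> borel_measurable borel" unfolding H_def[abs_def] by measurable
  define S where "S = \<alpha> ` {0..T}"
  have S: "compact S" unfolding S_def by (intro compact_continuous_image cont) auto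
  have Sn: "z \<notin> \<int>\<^sub>\<le>\<^sub>0" if "z \<in> S" for z using that r by (auto simp: S_def elim!: nonpos_Ints_cases)
  obtain R where R: "\<And>z. z \<in> S \<Longrightarrow> \<bar>rGamma z\<bar> \<le> R"
    using compact_imp_bounded[OF compact_continuous_image[OF continuous_on_rGamma S]]
    unfolding bounded_iff by auto
  obtain R' where R': "\<And>z. z \<in> S \<Longrightarrow> \<bar>- rGamma z * Digamma z\<bar> \<le> R'"
  proof -
    have "continuous_on S (\<lambda>z. - rGamma z * Digamma z)"
      using Sn by (intro continuous_intros continuous_on_Polygamma) auto
    from compact_imp_bounded[OF compact_continuous_image[OF this S]] that show ?thesis
      unfolding bounded_iff by auto
  qed
  have Rnn: "R \<ge> 0" "R' \<ge> 0"
    using R[of "\<alpha> 0"] R'[of "\<alpha> 0"] T by (auto simp: S_def)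
  \<comment> \<open>Any exponent strictly between 0 and 1/2 would do: x^(-e) has to dominate the
    logarithm, and t^(- 2 e) has to be integrable at 0.\<close>
  define e where "e = (1/4 :: real)"
  define c1 where "c1 = 1 / 1 + T powr 1 * \<bar>ln T\<bar>"
  define c where "c = 1 / e + T powr e * \<bar>ln T\<bar>"
  define E where "E = exp (Qs * c1)"
  have cnn: "c1 \<ge> 0" "c \<ge> 0" "E \<ge> 0" by (auto simp: c1_def c_def e_def E_def)
  \<comment> \<open>The logarithm is bounded here by c1/x, and the Lipschitz factor x cancels the
    denominator.\<close>
  have expb: "exp ((\<alpha> x - a0) * ln x) \<le> E" if x: "0 < x" "x \<le> T" for x
  proof -
    have "(\<alpha> x - a0) * ln x \<le> \<bar>\<alpha> x - a0\<bar> * \<bar>ln x\<bar>" by (simp add: abs_mult[symmetric])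
    also have "\<dots> \<le> (Qs * x) * (c1 * x powr (- 1))"
      using lip[of x] powr_ln_bound[of 1 x T] x Qs unfolding c1_def by (intro mult_mono) auto
    also have "\<dots> = Qs * c1" using x by (simp add: powr_minus)
    finally show ?thesis by (simp add: E_def)
  qed
  define H' where "H' x = exp ((\<alpha> x - a0) * ln x) * (\<alpha>' x * ln x + (\<alpha> x - a0) / x) * rGamma (\<alpha> x)
      + exp ((\<alpha> x - a0) * ln x) * (- rGamma (\<alpha> x) * Digamma (\<alpha> x) * \<alpha>' x)" for x
  define C where "C = E * ((Qs * c + Qs * T powr e) * R) + E * (R' * Qs * T powr e)"
  have C: "C \<ge> 0" using cnn Qs Rnn by (simp add: C_def)
  have Hd: "(H has_real_derivative H' x) (at x)" if x: "0 < x" "x < T" for x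
  proof -
    have "(\<alpha> has_real_derivative \<alpha>' x) (at x)"
      using d x at_within_Icc_at[of 0 x T] by (metis atLeastAtMost_iff less_imp_le)
    note [derivative_intros] = this
    have nz: "\<alpha> x \<notin> \<int>\<^sub>\<le>\<^sub>0" using x by (intro Sn) (auto simp: S_def)
    have "(h has_real_derivative H' x) (at x)"
      unfolding h_def[abs_def] H'_def
      by (rule derivative_eq_intros refl has_field_derivative_rGamma_no_nonpos_int[THEN DERIV_chain2] | use x nz in simp)+
    moreover have "eventually (\<lambda>y. H y = h y) (nhds x)"
    proof -
      have "eventually (\<lambda>y. y \<in> {0<..<T}) (nhds x)" using x by (intro eventually_nhds_in_open) auto
      then show ?thesis by eventually_elim (auto simp: Hh)
    qed
    ultimately show ?thesis by (subst DERIV_cong_ev[OF refl _ refl]) auto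
  qed
  have H'b: "\<bar>H' x\<bar> \<le> C * x powr (- e)" if x: "0 < x" "x < T" for x
  proof -
    have xS: "\<alpha> x \<in> S" using x by (auto simp: S_def)
    have a': "\<bar>\<alpha>' x\<bar> \<le> Qs" using d x by auto
    have ln: "\<bar>ln x\<bar> \<le> c * x powr (- e)" unfolding c_def using x by (intro powr_ln_bound) (auto simp: e_def)
    have one: "1 \<le> T powr e * x powr (- e)"
    proof -
      have "T powr e * x powr (- e) = (T / x) powr e" using x T by (simp add: powr_minus powr_divide field_simps)
      moreover have "1 \<le> (T / x) powr e" using x by (intro ge_one_powr_ge_zero) (auto simp: field_simps e_def)
      ultimately show ?thesis by simp
    qed
    have q1: "\<bar>(\<alpha> x - a0) / x\<bar> \<le> Qs" using lip[of x] x by (simp add: abs_divide field_simps)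
    have "\<bar>\<alpha>' x * ln x + (\<alpha> x - a0) / x\<bar> \<le> \<bar>\<alpha>' x\<bar> * \<bar>ln x\<bar> + \<bar>(\<alpha> x - a0) / x\<bar>"
      by (metis abs_mult abs_triangle_ineq)
    also have "\<dots> \<le> Qs * (c * x powr (- e)) + Qs * (T powr e * x powr (- e))"
      using a' ln q1 mult_left_mono[OF one Qs] Qs by (intro add_mono mult_mono) auto
    finally have i1: "\<bar>\<alpha>' x * ln x + (\<alpha> x - a0) / x\<bar> \<le> (Qs * c + Qs * T powr e) * x powr (- e)"
      by (simp add: algebra_simps)
    have i2: "\<bar>- rGamma (\<alpha> x) * Digamma (\<alpha> x) * \<alpha>' x\<bar> \<le> R' * Qs * (T powr e * x powr (- e))"
    proof -
      have "\<bar>- rGamma (\<alpha> x) * Digamma (\<alpha> x) * \<alpha>' x\<bar> \<le> R' * Qs"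
        unfolding abs_mult[of "- rGamma (\<alpha> x) * Digamma (\<alpha> x)"] using R'[OF xS] a' Rnn by (intro mult_mono) auto
      also have "\<dots> \<le> R' * Qs * (T powr e * x powr (- e))" using mult_left_mono[OF one, of "R' * Qs"] Rnn Qs by simp
      finally show ?thesis .
    qed
    let ?e = "exp ((\<alpha> x - a0) * ln x)"
    have e: "\<bar>?e\<bar> \<le> E" using expb[of x] x by simp
    have "\<bar>H' x\<bar> \<le> \<bar>?e\<bar> * \<bar>\<alpha>' x * ln x + (\<alpha> x - a0) / x\<bar> * \<bar>rGamma (\<alpha> x)\<bar> + \<bar>?e\<bar> * \<bar>- rGamma (\<alpha> x) * Digamma (\<alpha> x) * \<alpha>' x\<bar>"
      unfolding H'_def abs_mult[symmetric] by (rule abs_triangle_ineq)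
    also have "\<dots> \<le> E * ((Qs * c + Qs * T powr e) * x powr (- e)) * R + E * (R' * Qs * (T powr e * x powr (- e)))"
    proof -
      have nn: "0 \<le> Qs * c + Qs * T powr e" "0 \<le> x powr (- e)"
        using Qs cnn by simp_all
      show ?thesis
        by (intro nn add_mono mult_mono e i1 i2 R[OF xS] cnn mult_nonneg_nonneg abs_ge_zero)
    qed
    also have "\<dots> = C * x powr (- e)" by (simp add: C_def algebra_simps)
    finally show ?thesis .
  qed
  have Hb: "\<bar>H x\<bar> \<le> E * R" if x: "0 < x" "x \<le> T" for x
  proof -
    have "\<alpha> x \<in> S" using x by (auto simp: S_def)
    then show ?thesis unfolding Hh[OF x] h_def abs_mult using expb[OF x] R[of "\<alpha> x"] cnn by (intro mult_mono) auto
  qed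
  \<comment> \<open>The Beta weight left by s = t z: the powers of t from the two kernels and from
    ds cancel, since t t^(-a0) t^(a0 - 1) = 1.\<close>
  define w where "w z = indicator {0<..<1} z * (z powr (a0 - 1) * (1 - z) powr (- a0)) / Gamma (1 - a0)" for z :: real
  have G: "Gamma (1 - a0) > 0" using a0 by (intro Gamma_real_pos) simp
  have w: "w \<in> borel_measurable borel" "0 \<le> w z" "z \<notin> {0<..<1} \<Longrightarrow> w z = 0" for z
    using G by (auto simp: w_def[abs_def] intro!: divide_nonneg_nonneg)
  have iw: "integrable lborel w"
    using Bochner_Integration.integrable_divide[OF Beta_lborel(1)[of a0 "1 - a0"], of "Gamma (1 - a0)"] a0
    by (simp add: w_def[abs_def])
  have iw2: "integrable lborel (\<lambda>z. w z * z powr (1 - e))"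
  proof -
    have "w z * z powr (1 - e) = indicator {0<..<1} z * (z powr (a0 + 1 - e - 1) * (1 - z) powr (1 - a0 - 1)) / Gamma (1 - a0)" for z
    proof -
      have "z powr (a0 + 1 - e - 1) = z powr (a0 - 1) * z powr (1 - e)" by (simp add: powr_add[symmetric])
      then show ?thesis by (simp add: w_def)
    qed
    then show ?thesis
      using Bochner_Integration.integrable_divide[OF Beta_lborel(1)[of "a0 + 1 - e" "1 - a0"], of "Gamma (1 - a0)"] a0
      by (simp add: e_def)
  qed
  define F where "F t = (\<integral>z. w z * H (t * z) \<partial>lborel)" for t
  note [measurable] = w(1) Hm
  have Fm: "F \<in> borel_measurable borel" unfolding F_def[abs_def] by measurable
  have gF: "g_ker \<alpha> t = F t" if t: "0 < t" "t < T" for t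
  proof -
    define k where "k s = indicator {0<..t} s * ((t - s) powr (- a0) / Gamma (1 - a0) * (s powr (a0 - 1) * H s))" for s
    have [measurable]: "k \<in> borel_measurable borel" unfolding k_def[abs_def] by measurable
    have "indicator {0..t} s *\<^sub>R (beta_ker (1 - \<alpha> 0) (t - s) * k_ker \<alpha> s) = k s" for s
    proof (cases "0 < s \<and> s \<le> t")
      case True
      then have "s powr (\<alpha> s - 1) = s powr (a0 - 1) * exp ((\<alpha> s - a0) * ln s)"
        by (simp add: powr_def exp_add[symmetric] algebra_simps)
      then show ?thesis
        using True t by (simp add: k_def beta_ker_def k_ker_def a0_def[symmetric] Hh h_def rGamma_inverse_Gamma field_simps)
    next
      case False
      then show ?thesis by (cases "s = 0") (auto simp: k_def k_ker_def indicator_def)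
    qed
    then have "g_ker \<alpha> t = (\<integral>s. k s \<partial>lebesgue)"
      by (simp add: g_ker_def conv_def set_lebesgue_integral_def)
    also have "\<dots> = (\<integral>s. k s \<partial>lborel)" by (rule integral_completion) measurable
    also have "\<dots> = t * (\<integral>z. k (t * z) \<partial>lborel)"
      using lborel_integral_real_affine[of t k 0] t by simp
    also have "\<dots> = (\<integral>z. t * k (t * z) \<partial>lborel)" by simp
    also have "\<dots> = F t"
      unfolding F_def
    proof (rule integral_cong_AE)
      show "AE z in lborel. t * k (t * z) = w z * H (t * z)"
        using AE_lborel_singleton[of 1]
      proof eventually_elim
        case (elim z)
        show ?case
        proof (cases "0 < z \<and> z < 1")
          case True
          have 1: "t - t * z = t * (1 - z)" by (simp add: algebra_simps)
          have "t * (t powr (- a0) * t powr (a0 - 1)) = t * t powr (- 1)"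
            by (simp only: powr_add[symmetric]) simp
          also have "\<dots> = 1" using t by (simp add: powr_minus)
          finally have "t * (t powr (- a0) * t powr (a0 - 1)) = 1" .
          have "t * ((t * (1 - z)) powr (- a0) * (t * z) powr (a0 - 1)) = z powr (a0 - 1) * (1 - z) powr (- a0)"
            (is "?l = ?r")
          proof -
            have "?l = (t * (t powr (- a0) * t powr (a0 - 1))) * ?r"
              using True t by (simp add: powr_mult)
            also have "\<dots> = ?r" unfolding \<open>t * (t powr (- a0) * t powr (a0 - 1)) = 1\<close> by simp
            finally show ?thesis .
          qed
          moreover have "t * k (t * z) = t * ((t * (1 - z)) powr (- a0) * (t * z) powr (a0 - 1)) * H (t * z) / Gamma (1 - a0)"
            using True t by (simp add: k_def 1)
          ultimately show ?thesis using True by (simp add: w_def)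
        next
          case False
          then have "\<not> (0 < t * z \<and> t * z \<le> t)" using t elim by (auto simp: zero_less_mult_iff)
          then show ?thesis using False by (auto simp: k_def w_def)
        qed
      qed
    qed measurable
    finally show ?thesis .
  qed
  let ?I = "\<integral>z. w z * z powr (1 - e) \<partial>lborel"
  have der: "\<exists>D. (F has_real_derivative D) (at t) \<and> \<bar>D\<bar> \<le> C * ?I * t powr (- e)" if t: "0 < t" "t < T" for t
    unfolding F_def[abs_def]
    by (rule dilation_integral_has_derivative[OF w iw iw2 Hm Hb Hd H'b _ t C]) (auto simp: e_def)
  have dF: "(F has_real_derivative deriv F t) (at t)" "\<bar>deriv F t\<bar> \<le> C * ?I * t powr (- e)" if t: "t \<in> {0<..<T}" for t
    using der[of t] t DERIV_imp_deriv by force+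
  define g where "g t = indicator {0<..<T} t * deriv F t" for t
  have gm: "g \<in> borel_measurable borel"
    unfolding g_def[abs_def] by (rule borel_measurable_deriv_on[OF Fm dF(1)])
  have gb: "\<bar>g t\<bar> \<le> C * ?I * (indicator {0..T} t * t powr (- e))" for t
  proof (cases "t \<in> {0<..<T}")
    case True
    then show ?thesis using dF(2)[of t] by (simp add: g_def)
  next
    case False
    have "0 \<le> ?I" using w(2) by (intro Bochner_Integration.integral_nonneg) simp
    then show ?thesis using False C by (simp add: g_def)
  qed
  have gb2: "(g t)\<^sup>2 \<le> (C * ?I)\<^sup>2 * (indicator {0..T} t * t powr (1 - 2 * e - 1))" for t
  proof -
    have "t powr (1 - 2 * e - 1) = t powr (- e) * t powr (- e)" by (simp add: powr_add[symmetric])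
    moreover have "(g t)\<^sup>2 \<le> (C * ?I * (indicator {0..T} t * t powr (- e)))\<^sup>2"
      using power_mono[OF gb[of t], of 2] by simp
    ultimately show ?thesis by (auto simp: power2_eq_square indicator_def ac_simps)
  qed
  have i1: "integrable lborel (\<lambda>t. indicator {0..T} t * t powr (- e))"
    using powr_integrable_Icc(1)[of "1 - e" T] by (simp add: set_integrable_def e_def)
  have i2: "integrable lborel (\<lambda>t. indicator {0..T} t * t powr (1 - 2 * e - 1))"
    using powr_integrable_Icc(1)[of "1 - 2 * e" T] by (simp add: set_integrable_def e_def)
  note [measurable] = gm
  have gi: "integrable lborel g"
    by (rule Bochner_Integration.integrable_bound[OF Bochner_Integration.integrable_mult_right[OF i1, of "C * ?I"]])
      (use gb order_trans[OF gb abs_ge_self] in auto)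
  have gi2: "integrable lborel (\<lambda>t. (g t)\<^sup>2)"
    by (rule Bochner_Integration.integrable_bound[OF Bochner_Integration.integrable_mult_right[OF i2, of "(C * ?I)\<^sup>2"]])
      (use order_trans[OF gb2 abs_ge_self] in auto)
  have "L1loc g" by (rule integrable_imp_L1loc[OF gi]) (simp add: g_def)
  moreover have "integrable lborel (\<lambda>t. (trunc r g t)\<^sup>2)" for r
    by (rule Bochner_Integration.integrable_bound[OF gi2]) (auto simp: trunc_def indicator_def)
  ultimately have "L2loc g" by (simp add: L2loc_def)
  moreover have "deriv (g_ker \<alpha>) t = g t" if t: "t \<in> {0<..<T}" for t
  proof -
    have "eventually (\<lambda>y. y \<in> {0<..<T}) (nhds t)" using t by (intro eventually_nhds_in_open) auto
    then have "eventually (\<lambda>y. g_ker \<alpha> y = F y) (nhds t)" by eventually_elim (auto simp: gF)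
    then have "deriv (g_ker \<alpha>) t = deriv F t" by (intro deriv_cong_ev) auto
    then show ?thesis using t by (simp add: g_def)
  qed
  ultimately show ?thesis using that by (auto simp: g_def)
qed

section \<open>Lebesgue representatives and the Volterra equation\<close>

text \<open>The problem is posed with the completed measure, whereas the convolution ring consists
  of Borel functions over \<open>lborel\<close>. A function equal almost everywhere to a Borel one
  can pass between the two settings.\<close>

lemma
  fixes f F :: "real \<Rightarrow> real"
  assumes ae: "AE x in lborel. f x = F x" and F[measurable]: "F \<in> borel_measurable borel"
  shows lebesgue_measurable_AE: "f \<in> borel_measurable lebesgue"
    and lebesgue_integrable_AE: "integrable lebesgue f \<longleftrightarrow> integrable lborel F"
    and lebesgue_integral_AE: "(\<integral>x. f x \<partial>lebesgue) = (\<integral>x. F x \<partial>lborel)"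
proof -
  have Fm: "F \<in> borel_measurable lborel" by simp
  have FL: "F \<in> borel_measurable lebesgue" by (rule measurable_completion[OF Fm])
  have ae': "AE x in lebesgue. F x = f x" using ae by (intro AE_completion) (auto elim: eventually_mono)
  show m: "f \<in> borel_measurable lebesgue" by (rule borel_measurable_AE[OF FL ae'])
  show "integrable lebesgue f \<longleftrightarrow> integrable lborel F"
    using integrable_cong_AE[OF FL m ae'] integrable_completion[OF Fm] by simp
  show "(\<integral>x. f x \<partial>lebesgue) = (\<integral>x. F x \<partial>lborel)"
    using integral_cong_AE[OF FL m ae'] integral_completion[OF Fm] by simp
qed

definition ae_on :: "real \<Rightarrow> (real \<Rightarrow> real) \<Rightarrow> (real \<Rightarrow> real) \<Rightarrow> bool" where
  "ae_on T f g \<longleftrightarrow> (AE t in lborel. t \<in> {0..T} \<longrightarrow> f t = g t)"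

lemma ae_on_sym: "ae_on T f g \<Longrightarrow> ae_on T g f"
  unfolding ae_on_def by (auto elim: eventually_mono)

lemma ae_on_trans: "ae_on T f g \<Longrightarrow> ae_on T g h \<Longrightarrow> ae_on T f h"
  unfolding ae_on_def by (erule (1) eventually_elim2) auto

lemma ae_on_eq: "(\<And>t. t \<in> {0..T} \<Longrightarrow> f t = g t) \<Longrightarrow> ae_on T f g"
  unfolding ae_on_def by auto

lemma ae_on_0: "ae_on T f g \<longleftrightarrow> (AE t in lborel. t \<in> {0<..T} \<longrightarrow> f t = g t)"
proof
  show "ae_on T f g \<Longrightarrow> AE t in lborel. t \<in> {0<..T} \<longrightarrow> f t = g t"
    unfolding ae_on_def by (erule eventually_mono) auto
  assume "AE t in lborel. t \<in> {0<..T} \<longrightarrow> f t = g t"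
  then show "ae_on T f g"
    unfolding ae_on_def using AE_lborel_singleton[of 0] by eventually_elim auto
qed

lemma conv_eq_convl:
  assumes f: "ae_on T f F" and F: "L1loc F" and g: "ae_on T g G" and G: "L1loc G" and t: "t \<in> {0..T}"
  shows "conv f g t = convl F G t"
proof -
  note [measurable] = L1loc_measurable[OF F] L1loc_measurable[OF G]
  \<comment> \<open>The exceptional set of f need not be Borel. It is enclosed in a Borel null set,
    to whose indicator \<open>AE_reflect\<close> applies.\<close>
  define N where "N = (\<lambda>s. if s \<in> {0..T} \<and> f s \<noteq> F s then 1 else (0::real))"
  have "AE s in lborel. N s = 0" using f unfolding ae_on_def by eventually_elim (auto simp: N_def)
  then obtain N' where N': "N' \<in> null_sets lborel" "{s. N s \<noteq> 0} \<subseteq> N'"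
    by (auto simp: eventually_ae_filter)
  have "AE s in lborel. indicator N' s = (0::real)"
    using AE_not_in[OF N'(1)] by eventually_elim auto
  then have "AE s in lborel. indicator N' (t - s) = (0::real)"
    using N'(1) by (intro AE_reflect[of "indicator N'" "\<lambda>_. 0"]) (auto simp: null_sets_def)
  then have "AE s in lborel. t - s \<in> {0..T} \<longrightarrow> f (t - s) = F (t - s)"
    by eventually_elim (use N'(2) in \<open>auto simp: N_def indicator_def split: if_splits\<close>)
  with g[unfolded ae_on_def] have "AE s in lborel. indicator {0..t} s *\<^sub>R (f (t - s) * g s) = F (t - s) * G s"
  proof eventually_elim
    case (elim s)
    show ?case
    proof (cases "s \<in> {0..t}")
      case True then show ?thesis using elim t by auto
    next
      case False
      then show ?thesis using L1loc_neg[OF F, of "t - s"] L1loc_neg[OF G, of s] by auto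
    qed
  qed
  from lebesgue_integral_AE[OF this] show ?thesis
    by (simp add: conv_def convl_def set_lebesgue_integral_def)
qed

lemma set_integral_eq_convl:
  assumes g: "ae_on T g G" and G: "L1loc G" and t: "t \<in> {0..T}"
  shows "(LINT s:{0..t}|lebesgue. g s) = convl (rl_ker 1) G t"
proof -
  note [measurable] = L1loc_measurable[OF G]
  have "AE s in lborel. indicator {0..t} s *\<^sub>R g s = indicator {0..t} s *\<^sub>R G s"
    using g unfolding ae_on_def by eventually_elim (use t in \<open>auto simp: indicator_def\<close>)
  from lebesgue_integral_AE[OF this] show ?thesis
    by (simp add: convl_rl_ker1[OF G] set_lebesgue_integral_def)
qed

lemma L2_L2loc:
  assumes F: "L2loc F" and f: "ae_on T f F"
  shows "L2 T f" "(L2_norm T f)\<^sup>2 = wsq 0 T F"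
proof -
  note Fl = L2loc_L1loc[OF F]
  note [measurable] = L1loc_measurable[OF Fl]
  have a1: "AE x in lborel. indicator {0..T} x *\<^sub>R f x = trunc T F x"
    using f unfolding ae_on_def by eventually_elim (use L1loc_neg[OF Fl] in \<open>auto simp: indicator_def trunc_def\<close>)
  have a2: "AE x in lborel. indicator {0..T} x *\<^sub>R (f x)\<^sup>2 = (trunc T F x)\<^sup>2"
    using f unfolding ae_on_def by eventually_elim (use L1loc_neg[OF Fl] in \<open>auto simp: indicator_def trunc_def\<close>)
  show "L2 T f"
    unfolding L2_def set_borel_measurable_def set_integrable_def
    using lebesgue_measurable_AE[OF a1] lebesgue_integrable_AE[OF a2] F by (simp add: L2loc_def)
  have "(LINT t:{0..T}|lebesgue. (f t)\<^sup>2) = wsq 0 T F"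
    unfolding set_lebesgue_integral_def wsq_def wtrunc0 using lebesgue_integral_AE[OF a2] by simp
  then show "(L2_norm T f)\<^sup>2 = wsq 0 T F" by (simp add: L2_norm_def wsq_nonneg)
qed

lemma L2_representative:
  assumes f: "L2 T f"
  obtains F where "L2loc F" "ae_on T f F"
proof -
  have "(\<lambda>x. indicator {0..T} x *\<^sub>R f x) \<in> borel_measurable lebesgue"
    using f by (simp add: L2_def set_borel_measurable_def)
  from completion_ex_borel_measurable_real[OF this]
  obtain F0 where F0: "F0 \<in> borel_measurable lborel" "AE x in lborel. indicator {0..T} x *\<^sub>R f x = F0 x" by auto
  define F where "F x = indicator {0..T} x * F0 x" for x
  have [measurable]: "F \<in> borel_measurable borel" using F0(1) unfolding F_def[abs_def] by measurable
  have ae: "ae_on T f F"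
    unfolding ae_on_def using F0(2) by eventually_elim (auto simp: F_def indicator_def split: if_splits)
  have a2: "AE x in lborel. indicator {0..T} x *\<^sub>R (f x)\<^sup>2 = (F x)\<^sup>2"
    using ae unfolding ae_on_def by eventually_elim (auto simp: F_def indicator_def)
  have i2: "integrable lborel (\<lambda>x. (F x)\<^sup>2)"
    using f lebesgue_integrable_AE[OF a2] by (simp add: L2_def set_integrable_def)
  \<comment> \<open>On a bounded interval |F| \<le> 1 + F^2 makes a square-integrable function
    integrable.\<close>
  have "integrable lborel (\<lambda>x. indicator {0..T} x + (F x)\<^sup>2)"
    using i2 by (intro Bochner_Integration.integrable_add) (auto intro!: integrable_real_indicator simp: emeasure_lborel_Icc_eq)
  then have i1: "integrable lborel F"
  proof (rule Bochner_Integration.integrable_bound)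
    have "\<bar>F x\<bar> \<le> \<bar>indicator {0..T} x + (F x)\<^sup>2\<bar>" for x
    proof (cases "x \<in> {0..T}")
      case True
      have "0 \<le> \<bar>F x\<bar>" "0 \<le> (F x)\<^sup>2" by simp_all
      then show ?thesis using sum_squares_bound[of 1 "\<bar>F x\<bar>"] True by simp
    qed (simp add: F_def)
    then show "AE x in lborel. norm (F x) \<le> norm (indicator {0..T} x + (F x)\<^sup>2)" by simp
  qed measurable
  have "L1loc F" by (rule integrable_imp_L1loc[OF i1]) (simp add: F_def)
  moreover have "integrable lborel (\<lambda>t. (trunc r F t)\<^sup>2)" for r
    by (rule Bochner_Integration.integrable_bound[OF i2]) (auto simp: trunc_def indicator_def)
  ultimately have "L2loc F" by (simp add: L2loc_def)
  with ae that show ?thesis by blast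
qed

lemma ae_on_vanishes:
  assumes "L1loc F" "L1loc G"
  shows "ae_on T F G \<longleftrightarrow> vanishes T (cls F - cls G)"
  using assms by (simp add: cls_diff vanishes_cls L1loc_diff ae_on_0)

lemma convl_rl_ker1_0: "L1loc f \<Longrightarrow> convl (rl_ker 1) f 0 = 0"
proof -
  assume f: "L1loc f"
  have "AE x in lborel. indicator {0} x *\<^sub>R f x = 0"
    using AE_lborel_singleton[of 0] by eventually_elim auto
  from integral_cong_AE[OF _ _ this] f show ?thesis
    by (simp add: convl_rl_ker1 set_lebesgue_integral_def L1loc_def)
qed

section \<open>Primitives, H1 derivatives and the Volterra form of the equation\<close>

lemma H1_deriv_is:
  assumes "H1 T v" shows "is_H1_deriv T v (H1_deriv T v)"
  using assms unfolding H1_def H1_deriv_def by (auto intro: someI[where P="is_H1_deriv T v"])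

lemma is_H1_deriv_representative:
  assumes "is_H1_deriv T v g"
  obtains G where "L2loc G" "ae_on T g G" "\<And>t. t \<in> {0..T} \<Longrightarrow> v t = v 0 + convl (rl_ker 1) G t"
proof -
  obtain G where G: "L2loc G" "ae_on T g G" using L2_representative assms by (auto simp: is_H1_deriv_def)
  have "v t = v 0 + convl (rl_ker 1) G t" if "t \<in> {0..T}" for t
  proof -
    have "v t = v 0 + (LINT s:{0..t}|lebesgue. g s)"
      using assms that unfolding is_H1_deriv_def by blast
    then show ?thesis unfolding set_integral_eq_convl[OF G(2) L2loc_L1loc[OF G(1)] that] .
  qed
  with G that show ?thesis by blast
qed

text \<open>\<open>H1_deriv\<close> is an arbitrary choice among the derivatives. Two of them have
  the same primitive on [0, T], so cancelling the convolution with 1 shows that they agree almost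
  everywhere.\<close>

lemma H1_primitive:
  assumes U: "L2loc U"
  shows "H1 T (convl (rl_ker 1) U)" "ae_on T (H1_deriv T (convl (rl_ker 1) U)) U"
proof -
  note Ul = L2loc_L1loc[OF U]
  have l1: "L1loc (rl_ker 1)" by (simp add: L1loc_rl_ker)
  let ?v = "convl (rl_ker 1) U"
  have v: "L2loc ?v" by (rule L2loc_convl[OF l1 U order_refl])
  have "is_H1_deriv T ?v U"
    unfolding is_H1_deriv_def
  proof (intro conjI ballI)
    show "L2 T U" by (rule L2_L2loc(1)[OF U ae_on_eq]) simp
    show "?v t = ?v 0 + (LINT s:{0..t}|lebesgue. U s)" if "t \<in> {0..T}" for t
      using set_integral_eq_convl[OF ae_on_eq Ul that, of U] convl_rl_ker1_0[OF Ul] by simp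
  qed
  moreover have "L2 T ?v" by (rule L2_L2loc(1)[OF v ae_on_eq]) simp
  ultimately show H: "H1 T ?v" unfolding H1_def by blast
  obtain G where G: "L2loc G" "ae_on T (H1_deriv T ?v) G" "\<And>t. t \<in> {0..T} \<Longrightarrow> ?v t = ?v 0 + convl (rl_ker 1) G t"
    using is_H1_deriv_representative[OF H1_deriv_is[OF H]] by blast
  note Gl = L2loc_L1loc[OF G(1)]
  have "ae_on T ?v (convl (rl_ker 1) G)" using G(3) convl_rl_ker1_0[OF Ul] by (intro ae_on_eq) simp
  then have "vanishes T (cls ?v - cls (convl (rl_ker 1) G))" using Ul Gl l1 by (simp add: ae_on_vanishes[symmetric] L1loc_convl)
  then have "vanishes T (cls (rl_ker 1) * (cls U - cls G))" using Ul Gl l1 by (simp add: cls_mult[symmetric] algebra_simps)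
  then have "vanishes T (cls U - cls G)" by (rule vanishes_rl_ker1_cancel)
  then have "ae_on T U G" using Ul Gl by (simp add: ae_on_vanishes)
  with G(2) show "ae_on T (H1_deriv T ?v) U" using ae_on_trans ae_on_sym by blast
qed

lemma beta_ker_rl_ker: "ae_on T (beta_ker a) (rl_ker a)"
  by (rule ae_on_eq) (auto simp: beta_ker_def rl_ker_def)

text \<open>The fractional equation is the Volterra equation convolved with the kernel of order 1 -
  a, because the kernels of orders a and 1 - a convolve to 1. Existence uses the direction from the
  Volterra equation, uniqueness the converse, where a further convolution with the kernel of order a
  permits cancelling 1.\<close>

lemma solves_iff_volterra:
  assumes a: "0 < \<alpha> 0" "\<alpha> 0 < 1" and U: "L1loc U" and du: "ae_on T (H1_deriv T w) U" and w: "\<And>t. t \<in> {0..T} \<Longrightarrow> w t = convl (rl_ker 1) U t"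
    and g: "L1loc g" "\<And>t. t \<in> {0<..<T} \<Longrightarrow> deriv (g_ker \<alpha>) t = g t" and F: "L1loc F" "ae_on T f F" and T: "T > 0"
  shows "solves T \<alpha> lam f w \<longleftrightarrow>
    vanishes T (cls U + (lam *\<^sub>R (cls (rl_ker (\<alpha> 0)) + cls (rl_ker (\<alpha> 0)) * cls g)) * cls U - cls F)"
proof -
  let ?B = "\<lambda>a. cls (rl_ker a)"
  let ?W = "convl (rl_ker 1) U"
  let ?X = "cls U + (lam *\<^sub>R (?B (\<alpha> 0) + ?B (\<alpha> 0) * cls g)) * cls U - cls F"
  let ?Y = "?B (1 - \<alpha> 0) * cls U + lam *\<^sub>R (?B 1 * cls U) + lam *\<^sub>R (cls g * (?B 1 * cls U)) - ?B (1 - \<alpha> 0) * cls F"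
  have l: "L1loc (rl_ker (\<alpha> 0))" "L1loc (rl_ker (1 - \<alpha> 0))" "L1loc (rl_ker 1)" using a by (auto intro: L1loc_rl_ker)
  have dg: "ae_on T (deriv (g_ker \<alpha>)) g"
    unfolding ae_on_0 using AE_lborel_singleton[of T] by eventually_elim (auto simp: g(2))
  have wW: "ae_on T w ?W" using w by (rule ae_on_eq)
  have w0: "w 0 = 0" using w[of 0] convl_rl_ker1_0[OF U] T by simp
  let ?L = "\<lambda>t. convl (rl_ker (1 - \<alpha> 0)) U t + lam * ?W t + lam * convl g ?W t"
  have eqs: "caputo T (\<alpha> 0) w t + lam * w t + lam * conv (deriv (g_ker \<alpha>)) w t = ?L t"
    "RL_int (1 - \<alpha> 0) f t = convl (rl_ker (1 - \<alpha> 0)) F t" if "t \<in> {0<..T}" for t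
    using that conv_eq_convl[OF beta_ker_rl_ker l(2) du U] conv_eq_convl[OF beta_ker_rl_ker l(2) F(2,1)]
      conv_eq_convl[OF dg g(1) wW L1loc_convl[OF l(3) U]] w[of t]
    by (auto simp: caputo_def RL_int_def)
  have "solves T \<alpha> lam f w \<longleftrightarrow> (AE t in lborel. t \<in> {0<..T} \<longrightarrow> ?L t = convl (rl_ker (1 - \<alpha> 0)) F t)"
    unfolding solves_def AE_completion_iff using w0 by (auto simp: eqs cong: imp_cong)
  also have "\<dots> \<longleftrightarrow> ae_on T ?L (convl (rl_ker (1 - \<alpha> 0)) F)" by (simp add: ae_on_0)
  also have "\<dots> \<longleftrightarrow> vanishes T (cls ?L - cls (convl (rl_ker (1 - \<alpha> 0)) F))"
    using l U g(1) F(1) by (intro ae_on_vanishes L1loc_add L1loc_scale L1loc_convl)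
  also have "cls ?L - cls (convl (rl_ker (1 - \<alpha> 0)) F) = ?Y"
    using l U g(1) F(1) by (simp add: cls_mult cls_add cls_scaleR L1loc_convl L1loc_scale L1loc_add)
  also have "vanishes T ?Y \<longleftrightarrow> vanishes T ?X"
  proof
    have B1: "?B (\<alpha> 0) * ?B (1 - \<alpha> 0) = ?B 1" "?B (1 - \<alpha> 0) * ?B (\<alpha> 0) = ?B 1"
      using a by (simp_all add: cls_rl_ker_mult)
    have Y: "?Y = ?B (1 - \<alpha> 0) * ?X"
      by (simp add: algebra_simps B1[symmetric])
    then show "vanishes T ?X \<Longrightarrow> vanishes T ?Y" by (simp only: vanishes_mult)
    assume "vanishes T ?Y"
    then have "vanishes T (?B (\<alpha> 0) * (?B (1 - \<alpha> 0) * ?X))" unfolding Y by (rule vanishes_mult)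
    then have "vanishes T (?B 1 * ?X)" by (simp only: mult.assoc[symmetric] B1)
    then show "vanishes T ?X" by (rule vanishes_rl_ker1_cancel)
  qed
  finally show ?thesis .
qed

section \<open>The main estimate\<close>

lemma set_integrable_L1loc:
  assumes p: "L1loc p" and u: "ae_on T u p" and cd: "0 \<le> c" "d \<le> T"
  shows "set_integrable lebesgue {c..d} u"
proof -
  note [measurable] = L1loc_measurable[OF p]
  have "AE t in lborel. indicator {c..d} t *\<^sub>R u t = indicator {c..d} t *\<^sub>R p t"
    using u unfolding ae_on_def by eventually_elim (use cd in \<open>auto simp: indicator_def\<close>)
  from lebesgue_integrable_AE[OF this]
  have "set_integrable lebesgue {c..d} u \<longleftrightarrow> set_integrable lborel {c..d} p" by (simp add: set_integrable_def)
  moreover have "set_integrable lborel {c..d} p"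
    by (rule set_integrable_subset[OF L1loc_integrable_Icc[OF p, of d]]) (use cd in auto)
  ultimately show ?thesis by simp
qed

text \<open>Integration by parts when p is merely integrable: Fubini on the triangle s \<le> t
  reduces it to the integral of \<phi>' over [s, T], which is - \<phi> s because \<phi> vanishes
  near T. The constant f0 drops out since \<phi>' has integral 0 over [0, T].\<close>

lemma primitive_weak_deriv:
  assumes p: "L1loc p" and u: "ae_on T u (\<lambda>t. f0 + convl (rl_ker 1) p t)" and T: "T > 0"
    and u_int: "\<And>c d. 0 < c \<Longrightarrow> d < T \<Longrightarrow> set_integrable lebesgue {c..d} u"
  shows "weak_deriv_on 0 T u p"
  unfolding weak_deriv_on_def
proof safe
  fix c d :: real assume cd: "0 < c" "d < T"
  show "set_integrable lebesgue {c..d} u" by (rule u_int[OF cd])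
  show "set_integrable lebesgue {c..d} p"
    by (rule set_integrable_L1loc[OF p, of T]) (use cd in \<open>auto intro: ae_on_eq\<close>)
next
  fix \<phi> :: "real \<Rightarrow> real" assume tf: "test_fun 0 T \<phi>"
  define \<psi> where "\<psi> = deriv \<phi>"
  have "\<phi> differentiable (at x)" "\<psi> differentiable (at x)" for x
    using tf unfolding test_fun_def \<psi>_def by (metis funpow_0, metis funpow_simps_right(1) funpow.simps(2) comp_apply funpow_0 o_apply)
  then have d: "(\<phi> has_real_derivative \<psi> x) (at x)" and c: "isCont \<psi> x" for x
    by (auto simp: \<psi>_def DERIV_deriv_iff_real_differentiable intro: differentiable_imp_continuous_within)
  have cont: "continuous_on S \<psi>" "continuous_on S \<phi>" for S
    using c DERIV_isCont[OF d] by (auto intro!: continuous_at_imp_continuous_on)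
  have [measurable]: "\<psi> \<in> borel_measurable borel" "\<phi> \<in> borel_measurable borel"
    using cont[of UNIV] by (auto intro: borel_measurable_continuous_onI)
  note [measurable] = L1loc_measurable[OF p]
  obtain c d where "0 < c" "d < T" "\<And>x. x \<notin> {c..d} \<Longrightarrow> \<phi> x = 0"
    using tf by (auto simp: test_fun_def)
  then have z: "\<phi> 0 = 0" "\<phi> T = 0" by auto
  have ftc: "(\<integral>t. indicator {a..T} t * \<psi> t \<partial>lborel) = - \<phi> a" if "a \<le> T" for a
    using integral_FTC_atLeastAtMost[of a T \<phi> \<psi>] that cont d z
    by (simp add: has_field_derivative_at_within flip: has_real_derivative_iff_has_vector_derivative)
  let ?P = "trunc T p"
  have iP: "integrable lborel ?P" by (rule L1loc_trunc[OF p])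
  have i\<psi>: "integrable lborel (\<lambda>t. indicator {0..T} t * \<psi> t)"
    using borel_integrable_atLeastAtMost'[OF cont(1), of 0 T] by (simp add: set_integrable_def)
  have K: "integrable (lborel \<Otimes>\<^sub>M lborel) (\<lambda>(t, s). indicator {..t} s * ((indicator {0..T} t * \<psi> t) * ?P s))"
    by (rule Bochner_Integration.integrable_bound[OF integrable_tensor[OF i\<psi> iP]]) (auto simp: indicator_def)
  have W: "indicator {0..T} t * (convl (rl_ker 1) p t * \<psi> t) = (\<integral>s. indicator {..t} s * ((indicator {0..T} t * \<psi> t) * ?P s) \<partial>lborel)" for t
  proof (cases "t \<in> {0..T}")
    case True
    have "(\<integral>s. indicator {..t} s * ((indicator {0..T} t * \<psi> t) * ?P s) \<partial>lborel) = (\<integral>s. \<psi> t * (indicator {0..t} s *\<^sub>R p s) \<partial>lborel)"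
      by (rule Bochner_Integration.integral_cong) (use True L1loc_neg[OF p] in \<open>auto simp: trunc_def indicator_def\<close>)
    also have "\<dots> = \<psi> t * convl (rl_ker 1) p t" by (simp add: convl_rl_ker1[OF p] set_lebesgue_integral_def)
    finally show ?thesis using True by simp
  qed simp
  have "(\<integral>t. indicator {0..T} t * (convl (rl_ker 1) p t * \<psi> t) \<partial>lborel) = (\<integral>s. (\<integral>t. indicator {..t} s * ((indicator {0..T} t * \<psi> t) * ?P s) \<partial>lborel) \<partial>lborel)"
    unfolding W by (rule lborel_pair.Fubini_integral[OF K, symmetric])
  also have "\<dots> = (\<integral>s. - (?P s * \<phi> s) \<partial>lborel)"
  proof (rule Bochner_Integration.integral_cong, simp)
    fix s
    show "(\<integral>t. indicator {..t} s * ((indicator {0..T} t * \<psi> t) * ?P s) \<partial>lborel) = - (?P s * \<phi> s)"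
    proof (cases "s \<in> {0..T}")
      case True
      have "(\<integral>t. indicator {..t} s * ((indicator {0..T} t * \<psi> t) * ?P s) \<partial>lborel) = (\<integral>t. ?P s * (indicator {s..T} t * \<psi> t) \<partial>lborel)"
        by (rule Bochner_Integration.integral_cong) (use True in \<open>auto simp: indicator_def\<close>)
      also have "\<dots> = ?P s * (- \<phi> s)" using ftc[of s] True by simp
      finally show ?thesis by simp
    qed (use L1loc_neg[OF p, of s] in \<open>auto simp: trunc_def\<close>)
  qed
  finally have main: "(\<integral>t. indicator {0..T} t * (convl (rl_ker 1) p t * \<psi> t) \<partial>lborel) = - (\<integral>s. ?P s * \<phi> s \<partial>lborel)" by simp
  have iW: "integrable lborel (\<lambda>t. indicator {0..T} t * (convl (rl_ker 1) p t * \<psi> t))"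
    unfolding W using lborel_pair.integrable_fst'[OF K] by simp
  have [measurable]: "convl (rl_ker 1) p \<in> borel_measurable borel" by measurable
  have "AE t in lborel. indicator {0<..<T} t *\<^sub>R (u t * deriv \<phi> t) = f0 * (indicator {0..T} t * \<psi> t) + indicator {0..T} t * (convl (rl_ker 1) p t * \<psi> t)"
    using u[unfolded ae_on_def] AE_lborel_singleton[of 0] AE_lborel_singleton[of T]
    by eventually_elim (auto simp: indicator_def \<psi>_def algebra_simps)
  from lebesgue_integral_AE[OF this]
  have "(LINT t:{0<..<T}|lebesgue. u t * deriv \<phi> t) = f0 * (\<integral>t. indicator {0..T} t * \<psi> t \<partial>lborel) + (\<integral>t. indicator {0..T} t * (convl (rl_ker 1) p t * \<psi> t) \<partial>lborel)"
    using i\<psi> iW by (simp add: set_lebesgue_integral_def)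
  also have "\<dots> = - (\<integral>s. ?P s * \<phi> s \<partial>lborel)" using ftc[of 0] T z main by simp
  also have "(\<integral>s. ?P s * \<phi> s \<partial>lborel) = (LINT t:{0<..<T}|lebesgue. p t * \<phi> t)"
  proof -
    have "AE t in lborel. indicator {0<..<T} t *\<^sub>R (p t * \<phi> t) = ?P t * \<phi> t"
      using AE_lborel_singleton[of 0] AE_lborel_singleton[of T]
      by eventually_elim (use L1loc_neg[OF p] in \<open>auto simp: indicator_def trunc_def\<close>)
    from lebesgue_integral_AE[OF this] show ?thesis by (simp add: set_lebesgue_integral_def)
  qed
  finally show "(LINT t:{0<..<T}|lebesgue. u t * deriv \<phi> t) = - (LINT t:{0<..<T}|lebesgue. p t * \<phi> t)" .
qed

theorem theorem3p1:
  fixes T Qstar \<gamma> \<theta> :: real and \<alpha> \<alpha>' :: "real \<Rightarrow> real"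
  assumes "T > 0"
    and "\<forall>t\<in>{0..T}. 0 < \<alpha> t \<and> \<alpha> t < 1"
    and "\<forall>t\<in>{0..T}. (\<alpha> has_real_derivative \<alpha>' t) (at t within {0..T}) \<and> \<bar>\<alpha>' t\<bar> \<le> Qstar"
    and "3/4 < \<gamma>" and "\<gamma> < 1"
    and "max (1/2 - \<alpha> 0 * (1 - \<gamma>)) (\<alpha> 0 - 1/2) < \<theta>" and "\<theta> < 1/2"
  shows "\<exists>Q > 0. \<forall>lam f. lam > 0 \<and> L2 T f \<longrightarrow>
           (\<exists>v. H1 T v \<and> solves T \<alpha> lam f v
                \<and> (\<forall>w. H1 T w \<and> solves T \<alpha> lam f w \<longrightarrow> (\<forall>t\<in>{0..T}. w t = v t))
                \<and> H1_norm T v \<le> Q * L2_norm T f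
                \<and> (H1 T f \<longrightarrow>
                     (\<exists>v2. weak_deriv_on 0 T (H1_deriv T v) v2
                           \<and> L2 T (\<lambda>t. t powr \<theta> * v2 t)
                           \<and> L2_norm T (\<lambda>t. t powr \<theta> * v2 t)
                               \<le> Q * (H1_norm T f + lam powr (1 - \<gamma>) * \<bar>f 0\<bar>))))"
proof -
  note T = assms(1)
  have a: "0 < \<alpha> 0" "\<alpha> 0 < 1" using assms(1,2) by auto
  have \<gamma>: "0 < \<gamma>" "\<gamma> < 1" using assms(4,5) by auto
  have th: "1/2 - \<alpha> 0 * (1 - \<gamma>) < \<theta>" "\<theta> < 1/2" using assms(6,7) by auto
  \<comment> \<open>Here \<gamma> > 3/4 enters: \<theta> exceeds 1/4, so t^\<theta> is at most
    T^\<theta> on [0, T].\<close>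
  have "\<alpha> 0 * (1 - \<gamma>) \<le> 1 * (1/4)" using a assms(4,5) by (intro mult_mono) auto
  then have th0: "0 \<le> \<theta>" using th by linarith
  obtain g where g: "L2loc g" "\<And>t. t \<in> {0<..<T} \<Longrightarrow> deriv (g_ker \<alpha>) t = g t" "\<And>t. t \<notin> {0<..<T} \<Longrightarrow> g t = 0"
    using g_ker_deriv[OF assms(1-3)] by blast
  note gl = L2loc_L1loc[OF g(1)]
  have trg: "trunc r g = (\<lambda>x. if x \<le> r then g x else 0)" for r by (auto simp: trunc_def)
  have "trunc T g = g" using g(3) by (auto simp: trg)
  then have ig: "integrable lborel g" using L1loc_trunc[OF gl, of T] by simp
  then have eg: "exp_integrable g" using gl unfolding exp_integrable_def by (auto intro!: exI[of _ 0])
  \<comment> \<open>\<sigma> is determined by g before \<open>lam\<close> and f appear, which keeps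
    every constant below independent of both.\<close>
  obtain \<sigma> where s: "\<sigma> \<ge> 0" "(\<integral>x. \<bar>exp (- \<sigma> * x) * g x\<bar> \<partial>lborel) < 1/4"
    using exp_integral_small[OF gl, of 0 "1/4"] ig by auto
  have small: "(\<integral>x. \<bar>wtrunc \<sigma> T g x\<bar> \<partial>lborel) \<le> 1/4"
    using s(2) \<open>trunc T g = g\<close> by (simp add: wtrunc_def)
  obtain Q2 where Q2: "Q2 \<ge> 0"
    "\<And>lam \<rho> fp f0. lam > 0 \<Longrightarrow> L1loc \<rho> \<Longrightarrow> L2loc fp \<Longrightarrow>
       cls \<rho> + (lam *\<^sub>R (cls (rl_ker (\<alpha> 0)) + cls (rl_ker (\<alpha> 0)) * cls g)) * cls \<rho> = lam *\<^sub>R (cls (rl_ker (\<alpha> 0)) + cls (rl_ker (\<alpha> 0)) * cls g) \<Longrightarrow>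
       \<exists>p. L1loc p \<and> cls p = cls fp - cls \<rho> * cls fp - f0 *\<^sub>R cls \<rho> \<and>
         integrable lborel (\<lambda>t. (t powr \<theta> * trunc T p t)\<^sup>2) \<and>
         (\<integral>t. (t powr \<theta> * trunc T p t)\<^sup>2 \<partial>lborel) \<le> Q2 * (wsq 0 T fp + lam powr (2 * (1 - \<gamma>)) * f0\<^sup>2)"
    using regularity[OF a \<gamma> th th0 T g(1) s(1) small] by blast
  \<comment> \<open>T^2 bounds the squared norm of integration, as 1 has L1 norm T on [0, T], and
    the summand 1 accounts for v' itself. The exponential removes the weight, and 8 comes from
    \<open>stability\<close>.\<close>
  define Q1 where "Q1 = (T\<^sup>2 + 1) * (exp (2 * \<sigma> * T) * 8)"
  define Q where "Q = sqrt Q1 + sqrt Q2"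
  have Q1: "Q1 > 0" by (auto simp: Q1_def intro!: mult_pos_pos add_nonneg_pos)
  let ?b = "rl_ker (\<alpha> 0)"
  have lb: "L1loc ?b" "L1loc (rl_ker 1)" using a by (auto intro: L1loc_rl_ker)
  show ?thesis
  proof (intro exI[of _ Q] conjI allI impI)
    show "Q > 0" using Q1 Q2(1) by (auto simp: Q_def intro!: add_pos_nonneg)
    fix lam :: real and f assume "lam > 0 \<and> L2 T f"
    then have lam: "lam > 0" and f: "L2 T f" by auto
    obtain F where F: "L2loc F" "ae_on T f F" using L2_representative[OF f] by blast
    note Fl = L2loc_L1loc[OF F(1)]
    define k where "k = lam *\<^sub>R (cls ?b + cls ?b * cls g)"
    have "exp_integrable (\<lambda>x. lam * (?b x + convl ?b g x))"
      by (intro exp_integrable_scale exp_integrable_add exp_integrable_convl exp_integrable_rl_ker a eg)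
    then obtain \<rho> where \<rho>: "L1loc \<rho>" "cls \<rho> + cls (\<lambda>x. lam * (?b x + convl ?b g x)) * cls \<rho> = cls (\<lambda>x. lam * (?b x + convl ?b g x))"
      using resolvent_exists by blast
    have "cls (\<lambda>x. lam * (?b x + convl ?b g x)) = k"
      using lb gl by (simp add: k_def cls_scaleR cls_add cls_mult L1loc_convl L1loc_add)
    with \<rho>(2) have res: "cls \<rho> + k * cls \<rho> = k" by simp
    define U where "U x = F x - convl \<rho> F x" for x
    have U: "L2loc U" unfolding U_def by (intro L2loc_diff F(1) L2loc_convl[OF \<rho>(1) F(1) order_refl])
    note Ul = L2loc_L1loc[OF U]
    have cU: "cls U = cls F - cls \<rho> * cls F"
      using Fl \<rho>(1) by (simp add: U_def[abs_def] cls_mult cls_diff L1loc_convl)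
    have Ueq: "cls U + k * cls U = cls F" unfolding cU by (rule resolvent_solves[OF res])
    define v where "v = convl (rl_ker 1) U"
    note Hv = H1_primitive[OF U, of T, folded v_def]
    note vol = solves_iff_volterra[OF a _ _ _ gl g(2) Fl F(2) T, where lam=lam, folded k_def]
    have sv: "solves T \<alpha> lam f v"
      using Ueq by (subst vol[OF Ul Hv(2)]) (auto simp: v_def vanishes_def intro!: exI[of _ "\<lambda>x. 0"] L1loc_zero simp: cls_zero)
    have uniq: "w t = v t" if w: "H1 T w" "solves T \<alpha> lam f w" and t: "t \<in> {0..T}" for w t
    proof -
      have w0: "w 0 = 0" using w(2) by (simp add: solves_def)
      obtain W where W: "L2loc W" "ae_on T (H1_deriv T w) W" "\<And>t. t \<in> {0..T} \<Longrightarrow> w t = w 0 + convl (rl_ker 1) W t"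
        using is_H1_deriv_representative[OF H1_deriv_is[OF w(1)]] by blast
      note Wl = L2loc_L1loc[OF W(1)]
      have wW: "w t = convl (rl_ker 1) W t" if "t \<in> {0..T}" for t using W(3)[OF that] w0 by simp
      \<comment> \<open>W solves the Volterra equation exactly for the right-hand side F + j, where
        the defect j vanishes up to T. Hence W - U = j - \<rho> * j lies in the ideal.\<close>
      define j where "j = cls W + k * cls W - cls F"
      have j: "vanishes T j" using w(2) vol[OF Wl W(2) wW] by (simp add: j_def)
      have "cls W = (cls F + j) - cls \<rho> * (cls F + j)"
        by (rule resolvent_unique[OF res]) (simp add: j_def)
      then have "cls W - cls U = j - cls \<rho> * j" by (simp add: cU algebra_simps)
      then have "vanishes T (cls W - cls U)" using j by (simp add: vanishes_diff vanishes_mult)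
      then have "ae_on T W U" using Wl Ul by (simp add: ae_on_vanishes)
      \<comment> \<open>Primitives do not see null sets, so w and v agree at every point of
        [0, T].\<close>
      have "convl (rl_ker 1) W t = (LINT s:{0..t}|lebesgue. W s)"
        by (rule set_integral_eq_convl[OF ae_on_eq Wl t, symmetric]) simp
      also have "\<dots> = v t" unfolding v_def by (rule set_integral_eq_convl[OF \<open>ae_on T W U\<close> Ul t])
      finally show ?thesis using wW[OF t] by simp
    qed
    have nF: "wsq 0 T F = (L2_norm T f)\<^sup>2" using L2_L2loc(2)[OF F] by simp
    have nn: "0 \<le> L2_norm T h" for h
      unfolding L2_norm_def by (auto simp: set_lebesgue_integral_def intro!: Bochner_Integration.integral_nonneg)
    have v2: "L2loc v" unfolding v_def by (rule L2loc_convl[OF lb(2) U order_refl])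
    have H1v: "H1_norm T v \<le> Q * L2_norm T f"
    proof -
      have "(\<integral>x. \<bar>wtrunc 0 T (rl_ker 1) x\<bar> \<partial>lborel) = T"
      proof -
        have "AE x in lborel. \<bar>wtrunc 0 T (rl_ker 1) x\<bar> = indicator {0..T} x"
          using AE_lborel_singleton[of 0] by eventually_elim (auto simp: wtrunc0 trunc_def rl_ker1 indicator_def)
        then have "(\<integral>x. \<bar>wtrunc 0 T (rl_ker 1) x\<bar> \<partial>lborel) = (\<integral>x. indicator {0..T} x \<partial>lborel)"
          by (intro integral_cong_AE) auto
        then show ?thesis using T by simp
      qed
      then have 1: "wsq 0 T v \<le> T\<^sup>2 * wsq 0 T U"
        using wsq_convl[OF lb(2) U order_refl, of T] by (simp add: v_def)
      have "cls U + lam *\<^sub>R (cls ?b * (cls U + cls g * cls U)) = cls F"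
        using Ueq by (simp add: k_def algebra_simps)
      from stability[OF a U F(1) gl _ s(1) small this] lam
      have "wsq \<sigma> T U \<le> 8 * wsq 0 T F" using wsq_le_wsq0(1)[OF F(1) s(1), of T] by simp
      then have "exp (2 * \<sigma> * T) * wsq \<sigma> T U \<le> exp (2 * \<sigma> * T) * 8 * wsq 0 T F" by simp
      moreover have "wsq 0 T U \<le> exp (2 * \<sigma> * T) * wsq \<sigma> T U"
        using wsq_le_wsq0(2)[OF U s(1), of T] T by simp
      ultimately have 2: "wsq 0 T U \<le> exp (2 * \<sigma> * T) * 8 * wsq 0 T F" by linarith
      have "(H1_norm T v)\<^sup>2 = wsq 0 T v + wsq 0 T U"
        using L2_L2loc(2)[OF v2 ae_on_eq, of T v] L2_L2loc(2)[OF U Hv(2)] by (simp add: H1_norm_def wsq_nonneg)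
      also have "\<dots> \<le> (T\<^sup>2 + 1) * wsq 0 T U" using 1 by (simp add: algebra_simps)
      also have "\<dots> \<le> (T\<^sup>2 + 1) * (exp (2 * \<sigma> * T) * 8 * wsq 0 T F)" using 2 by (intro mult_left_mono) auto
      also have "\<dots> = (sqrt Q1 * L2_norm T f)\<^sup>2" using Q1 by (simp add: Q1_def nF power_mult_distrib)
      finally have "H1_norm T v \<le> sqrt Q1 * L2_norm T f"
        by (rule power2_le_imp_le) (use Q1 nn in auto)
      also have "\<dots> \<le> Q * L2_norm T f" using nn Q2(1) by (intro mult_right_mono) (auto simp: Q_def)
      finally show ?thesis .
    qed
    have second: "\<exists>v2. weak_deriv_on 0 T (H1_deriv T v) v2
                           \<and> L2 T (\<lambda>t. t powr \<theta> * v2 t)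
                           \<and> L2_norm T (\<lambda>t. t powr \<theta> * v2 t)
                               \<le> Q * (H1_norm T f + lam powr (1 - \<gamma>) * \<bar>f 0\<bar>)" if Hf: "H1 T f"
    proof -
      obtain P where P: "L2loc P" "ae_on T (H1_deriv T f) P" "\<And>t. t \<in> {0..T} \<Longrightarrow> f t = f 0 + convl (rl_ker 1) P t"
        using is_H1_deriv_representative[OF H1_deriv_is[OF Hf]] by blast
      note Pl = L2loc_L1loc[OF P(1)]
      obtain p where p: "L1loc p" "cls p = cls P - cls \<rho> * cls P - f 0 *\<^sub>R cls \<rho>"
         "integrable lborel (\<lambda>t. (t powr \<theta> * trunc T p t)\<^sup>2)"
         "(\<integral>t. (t powr \<theta> * trunc T p t)\<^sup>2 \<partial>lborel) \<le> Q2 * (wsq 0 T P + lam powr (2 * (1 - \<gamma>)) * (f 0)\<^sup>2)"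
        using Q2(2)[OF lam \<rho>(1) P(1) res[unfolded k_def], of "f 0"] by blast
      \<comment> \<open>Y is f(0) + 1 * P as a ring element, with \<open>rl_ker 1\<close> for the
        constant 1, and the formula for \<open>cls p\<close> makes Z = Y - \<rho> * Y. As U = F -
        \<rho> * F, the difference U - Z lies in the ideal because F - Y does.\<close>
      define Z where "Z t = f 0 * rl_ker 1 t + convl (rl_ker 1) p t" for t
      define Y where "Y t = f 0 * rl_ker 1 t + convl (rl_ker 1) P t" for t
      have l: "L1loc Z" "L1loc Y" unfolding Z_def Y_def using lb p(1) Pl by (auto intro!: L1loc_add L1loc_scale L1loc_convl)
      have cZ: "cls Z = f 0 *\<^sub>R cls (rl_ker 1) + cls (rl_ker 1) * cls p" and cY: "cls Y = f 0 *\<^sub>R cls (rl_ker 1) + cls (rl_ker 1) * cls P"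
        using lb p(1) Pl by (simp_all add: Z_def[abs_def] Y_def[abs_def] cls_add cls_scaleR cls_mult L1loc_scale L1loc_convl)
      have "f t = Y t" if "t \<in> {0<..T}" for t using P(3)[of t] that by (simp add: Y_def rl_ker1)
      then have "ae_on T f Y" unfolding ae_on_0 by (intro AE_I2) blast
      then have "ae_on T F Y" using F(2) ae_on_sym ae_on_trans by blast
      then have FY: "vanishes T (cls F - cls Y)" using Fl l by (simp add: ae_on_vanishes)
      have "cls U - cls Z = (cls F - cls Y) - cls \<rho> * (cls F - cls Y)"
        by (simp add: cU cZ cY p(2) algebra_simps)
      then have "vanishes T (cls U - cls Z)" using FY by (simp add: vanishes_diff vanishes_mult)
      then have "ae_on T U Z" using Ul l by (simp add: ae_on_vanishes)
      moreover have "ae_on T Z (\<lambda>t. f 0 + convl (rl_ker 1) p t)" unfolding ae_on_0 by (auto simp: Z_def rl_ker1)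
      ultimately have dv: "ae_on T (H1_deriv T v) (\<lambda>t. f 0 + convl (rl_ker 1) p t)" using Hv(2) ae_on_trans by blast
      have wd: "weak_deriv_on 0 T (H1_deriv T v) p"
        by (rule primitive_weak_deriv[OF p(1) dv T]) (rule set_integrable_L1loc[OF Ul Hv(2)], auto)
      define q where "q t = t powr \<theta> * trunc T p t" for t
      note [measurable] = L1loc_measurable[OF p(1)]
      have [measurable]: "q \<in> borel_measurable borel" unfolding q_def[abs_def] by measurable
      have q0: "q t = 0" if "t < 0" for t using L1loc_neg[OF p(1) that] by (simp add: q_def trunc_def)
      have qT: "q t = 0" if "t > T" for t using that by (simp add: q_def trunc_def)
      have iq: "integrable lborel (\<lambda>t. (q t)\<^sup>2)" using p(3) by (simp add: q_def)
      have "L1loc q"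
      proof (rule integrable_imp_L1loc[OF _ q0])
        have "(\<lambda>t. (indicator {0..T} t :: real)\<^sup>2) = indicator {0..T}"
          by (auto simp: indicator_def)
        then have "integrable lborel (\<lambda>t. (indicator {0..T} t :: real)\<^sup>2)" using T by simp
        then have "integrable lborel (\<lambda>t. indicator {0..T} t * q t)"
          by (rule mult_square_integrable[OF _ iq]) measurable
        moreover have "t \<in> {0..T}" if "q t \<noteq> 0" for t using that q0[of t] qT[of t] by force
        then have "(\<lambda>t. indicator {0..T} t * q t) = q" by (auto simp: indicator_def fun_eq_iff)
        ultimately show "integrable lborel q" by simp
      qed
      moreover have "integrable lborel (\<lambda>t. (trunc r q t)\<^sup>2)" for r
        by (rule Bochner_Integration.integrable_bound[OF iq]) (auto simp: trunc_def indicator_def)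
      ultimately have q: "L2loc q" by (simp add: L2loc_def)
      have aq: "ae_on T (\<lambda>t. t powr \<theta> * p t) q" by (rule ae_on_eq) (simp add: q_def trunc_def)
      have L: "L2 T (\<lambda>t. t powr \<theta> * p t)" by (rule L2_L2loc(1)[OF q aq])
      have "trunc T q = q" using qT by (auto simp: trunc_def indicator_def fun_eq_iff not_le)
      then have "(L2_norm T (\<lambda>t. t powr \<theta> * p t))\<^sup>2 = (\<integral>t. (q t)\<^sup>2 \<partial>lborel)"
        using L2_L2loc(2)[OF q aq] by (simp add: wsq_def wtrunc0)
      also have "\<dots> \<le> Q2 * (wsq 0 T P + lam powr (2 * (1 - \<gamma>)) * (f 0)\<^sup>2)" using p(4) by (simp add: q_def)
      also have "\<dots> \<le> Q2 * (H1_norm T f + lam powr (1 - \<gamma>) * \<bar>f 0\<bar>)\<^sup>2"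
      proof (intro mult_left_mono Q2(1))
        \<comment> \<open>Both terms are at most squares of nonnegative numbers, and a sum of such
          squares is at most the square of the sum.\<close>
        have h: "wsq 0 T P \<le> (H1_norm T f)\<^sup>2"
          using L2_L2loc(2)[OF P(1,2)] by (simp add: H1_norm_def add_nonneg_nonneg wsq_nonneg)
        have "lam powr (2 * (1 - \<gamma>)) = (lam powr (1 - \<gamma>))\<^sup>2"
          by (simp add: power2_eq_square powr_add[symmetric])
        then have "lam powr (2 * (1 - \<gamma>)) * (f 0)\<^sup>2 = (lam powr (1 - \<gamma>) * \<bar>f 0\<bar>)\<^sup>2" by (simp add: power_mult_distrib)
        moreover have "0 \<le> 2 * H1_norm T f * (lam powr (1 - \<gamma>) * \<bar>f 0\<bar>)" by (simp add: H1_norm_def)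
        ultimately show "wsq 0 T P + lam powr (2 * (1 - \<gamma>)) * (f 0)\<^sup>2 \<le> (H1_norm T f + lam powr (1 - \<gamma>) * \<bar>f 0\<bar>)\<^sup>2"
          using h unfolding power2_sum by linarith
      qed
      also have "\<dots> = (sqrt Q2 * (H1_norm T f + lam powr (1 - \<gamma>) * \<bar>f 0\<bar>))\<^sup>2"
        using Q2(1) by (simp add: power_mult_distrib)
      finally have "L2_norm T (\<lambda>t. t powr \<theta> * p t) \<le> sqrt Q2 * (H1_norm T f + lam powr (1 - \<gamma>) * \<bar>f 0\<bar>)"
        by (rule power2_le_imp_le) (use Q2(1) in \<open>simp add: H1_norm_def\<close>)
      also have "\<dots> \<le> Q * (H1_norm T f + lam powr (1 - \<gamma>) * \<bar>f 0\<bar>)"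
        using Q1 by (intro mult_right_mono) (auto simp: Q_def H1_norm_def)
      finally show ?thesis using wd L by blast
    qed
    show "\<exists>v. H1 T v \<and> solves T \<alpha> lam f v
                \<and> (\<forall>w. H1 T w \<and> solves T \<alpha> lam f w \<longrightarrow> (\<forall>t\<in>{0..T}. w t = v t))
                \<and> H1_norm T v \<le> Q * L2_norm T f
                \<and> (H1 T f \<longrightarrow>
                     (\<exists>v2. weak_deriv_on 0 T (H1_deriv T v) v2
                           \<and> L2 T (\<lambda>t. t powr \<theta> * v2 t)
                           \<and> L2_norm T (\<lambda>t. t powr \<theta> * v2 t)
                               \<le> Q * (H1_norm T f + lam powr (1 - \<gamma>) * \<bar>f 0\<bar>)))"
      using Hv(1) sv uniq H1v second by blast
  qed
qed

end
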